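(* Let $n\ge 2$ and $2\le k\le n$ be integers, and let $\Omega\subset\mathbb{R}^n$ be a bounded strictly $(k-1)$-convex domain with boundary $\partial\Omega\in C^2$. Let $\theta$ be the unique solution in $\Phi_0^k(\Omega)$ of $$S_k(D^2\theta)=-\frac{1}{k-1}\,\theta\ \text{ in }\Omega,\qquad \theta<0\ \text{ in }\Omega,\qquad \theta=0\ \text{ on }\partial\Omega.$$ Let $u(t,x)$ be a solution of the problem $$\begin{cases} u_t=S_k(D^2u) & \text{in } (0,\infty)\times\Omega,\\ u(t,\cdot)\ \text{is } k\text{-admissible for each } t\ge 0,\\ u(t,x)=0 & \text{on } [0,\infty)\times\partial\Omega.\end{cases}$$ Then, for all $t\ge 0$, $$\sup_{x\in\Omega}\left|(1+t)^{1/(k-1)}u(t,x)-\theta(x)\right|\le C(1+t)^{-1},$$ where $C$ is a positive constant depending on the dimension $n$, on $\Omega$, and on $u(0,\cdot)$ (and not on $t$). Further, this estimate is the best possible, in the sense that the rate $(1+t)^{-1}$ cannot be improved: there exist solutions $u$ of the problem for which $\sup_{x\in\Omega}|(1+t)^{1/(k-1)}u(t,x)-\theta(x)|$ is not $o((1+t)^{-1})$ as $t\to\infty$.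
   Context: For a $C^2$ function $u$ on a domain in $\mathbb{R}^n$, $D^2u$ denotes its Hessian matrix (with respect to $x$) and the $k$-Hessian operator is $S_k(D^2u)=\sigma_k(\Lambda(D^2u))=\sum_{1\le i_1<\dots<i_k\le n}\lambda_{i_1}\cdots\lambda_{i_k}$, where $\Lambda(D^2u)=(\lambda_1,\dots,\lambda_n)$ are the eigenvalues of $D^2u$ and $\sigma_k$ is the $k$-th elementary symmetric function. $\Phi^k(\Omega)=\{u\in C^2(\Omega)\cap C(\overline\Omega): \sigma_j(\Lambda(D^2u))>0 \text{ in }\Omega,\ j=1,\dots,k\}$; its elements are called $k$-admissible on $\Omega$. $\Phi_0^k(\Omega)$ is the set of functions in $\Phi^k(\Omega)$ vanishing on $\partial\Omega$. A domain $\Omega$ is strictly $m$-convex if $\sigma_j(\kappa_1,\dots,\kappa_{n-1})>0$ on $\partial\Omega$ for each $j=1,\dots,m$, where $\kappa_1,\dots,\kappa_{n-1}$ are the principal curvatures of $\partial\Omega$ relative to the interior normal. Solutions $u(t,x)$, $t\in[0,\infty)$, $x\in\overline\Omega$, are understood in the classical sense. The existence and uniqueness of $\theta$ is known under the stated hypotheses on $\Omega$. *)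

theory Defs
  imports
    "HOL-Analysis.Analysis"
    "HOL-Computational_Algebra.Polynomial"
    "HOL-Library.Landau_Symbols"
begin

definition elem_sym :: "nat \<Rightarrow> real list \<Rightarrow> real" where
  "elem_sym k xs = (\<Sum>I | I \<subseteq> {..<length xs} \<and> card I = k. \<Prod>i\<in>I. xs ! i)"

definition char_pol :: "real^'n^'n \<Rightarrow> real poly" where
  "char_pol A = det (\<chi> i j. (if i = j then [:0, 1:] else 0) - [:A $ i $ j:])"

(* Real eigenvalues with algebraic multiplicity, in increasing order; for a symmetric
   matrix these are all the n eigenvalues. *)
definition eigenvalues :: "real^'n^'n \<Rightarrow> real list" where
  "eigenvalues A = sorted_list_of_multiset (proots (char_pol A))"

definition gradient :: "(real^'n \<Rightarrow> real) \<Rightarrow> real^'n \<Rightarrow> real^'n" where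
  "gradient f x = (\<chi> i. frechet_derivative f (at x) (axis i 1))"

definition hessian :: "(real^'n \<Rightarrow> real) \<Rightarrow> real^'n \<Rightarrow> real^'n^'n" where
  "hessian f x = matrix (frechet_derivative (gradient f) (at x))"

(* Meant for open S. *)
definition C2_on :: "(real^'n) set \<Rightarrow> (real^'n \<Rightarrow> real) \<Rightarrow> bool" where
  "C2_on S f \<longleftrightarrow>
     (\<forall>x\<in>S. f differentiable (at x)) \<and>
     (\<forall>x\<in>S. gradient f differentiable (at x)) \<and>
     continuous_on S (hessian f)"

definition hess_op :: "nat \<Rightarrow> (real^'n \<Rightarrow> real) \<Rightarrow> real^'n \<Rightarrow> real" where
  "hess_op k u x = elem_sym k (eigenvalues (hessian u x))"

definition admissible :: "nat \<Rightarrow> (real^'n) set \<Rightarrow> (real^'n \<Rightarrow> real) set" where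
  "admissible k \<Omega> = {u. C2_on \<Omega> u \<and> continuous_on (closure \<Omega>) u \<and>
     (\<forall>j\<in>{1..k}. \<forall>x\<in>\<Omega>. elem_sym j (eigenvalues (hessian u x)) > 0)}"

definition admissible0 :: "nat \<Rightarrow> (real^'n) set \<Rightarrow> (real^'n \<Rightarrow> real) set" where
  "admissible0 k \<Omega> = {u \<in> admissible k \<Omega>. \<forall>x\<in>frontier \<Omega>. u x = 0}"

definition C2_defining_function ::
  "(real^'n) set \<Rightarrow> real^'n \<Rightarrow> (real^'n) set \<Rightarrow> (real^'n \<Rightarrow> real) \<Rightarrow> bool" where
  "C2_defining_function \<Omega> p U \<rho> \<longleftrightarrow>
     open U \<and> p \<in> U \<and> C2_on U \<rho> \<and>
     (\<forall>x\<in>U. gradient \<rho> x \<noteq> 0 \<and> (x \<in> \<Omega> \<longleftrightarrow> \<rho> x < 0) \<and> (x \<in> frontier \<Omega> \<longleftrightarrow> \<rho> x = 0))"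

definition C2_boundary :: "(real^'n) set \<Rightarrow> bool" where
  "C2_boundary \<Omega> \<longleftrightarrow> (\<forall>p\<in>frontier \<Omega>. \<exists>U \<rho>. C2_defining_function \<Omega> p U \<rho>)"

(* On the boundary this is the interior unit normal, since the domain is where \<rho> < 0. *)
definition interior_normal :: "(real^'n \<Rightarrow> real) \<Rightarrow> real^'n \<Rightarrow> real^'n" where
  "interior_normal \<rho> x = - (gradient \<rho> x /\<^sub>R norm (gradient \<rho> x))"

(* ks lists the principal curvatures at the boundary point p: there is an orthonormal basis es
   of the tangent space consisting of eigenvectors of the Weingarten map v \<mapsto> - D_v N, with N
   the interior unit normal.  A ball of radius R has all principal curvatures 1/R. *)
definition principal_curvatures :: "(real^'n) set \<Rightarrow> real^'n \<Rightarrow> real list \<Rightarrow> bool" where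
  "principal_curvatures \<Omega> p ks \<longleftrightarrow>
     (\<exists>U \<rho> es. C2_defining_function \<Omega> p U \<rho> \<and>
        length ks = CARD('n) - 1 \<and> length es = CARD('n) - 1 \<and>
        (\<forall>i<CARD('n) - 1. \<forall>j<CARD('n) - 1. (es ! i) \<bullet> (es ! j) = (if i = j then 1 else 0)) \<and>
        (\<forall>i<CARD('n) - 1. (es ! i) \<bullet> interior_normal \<rho> p = 0 \<and>
           - frechet_derivative (interior_normal \<rho>) (at p) (es ! i) = (ks ! i) *\<^sub>R (es ! i)))"

(* The principal curvatures at p are unique up to order, so any listing may be used. *)
definition strictly_convex_domain :: "nat \<Rightarrow> (real^'n) set \<Rightarrow> bool" where
  "strictly_convex_domain m \<Omega> \<longleftrightarrow>
     (\<forall>p\<in>frontier \<Omega>. \<exists>ks. principal_curvatures \<Omega> p ks \<and> (\<forall>j\<in>{1..m}. elem_sym j ks > 0))"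

definition profile :: "nat \<Rightarrow> (real^'n) set \<Rightarrow> (real^'n \<Rightarrow> real) \<Rightarrow> bool" where
  "profile k \<Omega> \<theta> \<longleftrightarrow> \<theta> \<in> admissible0 k \<Omega> \<and>
     (\<forall>x\<in>\<Omega>. hess_op k \<theta> x = - (1 / (real k - 1)) * \<theta> x \<and> \<theta> x < 0)"

(* Once continuously differentiable in t and twice in x, jointly, on (0,\<infinity>) \<times> \<Omega>. *)
definition C12_on :: "(real^'n) set \<Rightarrow> (real \<Rightarrow> real^'n \<Rightarrow> real) \<Rightarrow> bool" where
  "C12_on \<Omega> u \<longleftrightarrow>
     (\<forall>t>0. \<forall>x\<in>\<Omega>. (\<lambda>s. u s x) differentiable (at t)) \<and>
     (\<forall>t>0. C2_on \<Omega> (u t)) \<and>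
     continuous_on ({0<..} \<times> \<Omega>) (\<lambda>(t, x). deriv (\<lambda>s. u s x) t) \<and>
     continuous_on ({0<..} \<times> \<Omega>) (\<lambda>(t, x). gradient (u t) x) \<and>
     continuous_on ({0<..} \<times> \<Omega>) (\<lambda>(t, x). hessian (u t) x)"

definition hessian_flow :: "nat \<Rightarrow> (real^'n) set \<Rightarrow> (real \<Rightarrow> real^'n \<Rightarrow> real) \<Rightarrow> bool" where
  "hessian_flow k \<Omega> u \<longleftrightarrow>
     continuous_on ({0..} \<times> closure \<Omega>) (\<lambda>(t, x). u t x) \<and> C12_on \<Omega> u \<and>
     (\<forall>t>0. \<forall>x\<in>\<Omega>. deriv (\<lambda>s. u s x) t = hess_op k (u t) x) \<and>
     (\<forall>t\<ge>0. u t \<in> admissible k \<Omega>) \<and>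
     (\<forall>t\<ge>0. \<forall>x\<in>frontier \<Omega>. u t x = 0)"

definition deviation ::
  "nat \<Rightarrow> (real^'n) set \<Rightarrow> (real^'n \<Rightarrow> real) \<Rightarrow> (real \<Rightarrow> real^'n \<Rightarrow> real) \<Rightarrow> real \<Rightarrow> real" where
  "deviation k \<Omega> \<theta> u t = (SUP x\<in>\<Omega>. \<bar>(1 + t) powr (1 / (real k - 1)) * u t x - \<theta> x\<bar>)"

end

theory Submission
  imports Defs "HOL-Computational_Algebra.Fundamental_Theorem_Algebra"
begin

text \<open>
  The operator \<open>S\<^sub>k\<close> is monotone on \<open>k\<close>-admissible functions, so the flow obeys a comparison
  principle, and the functions \<open>(s + t) powr (-1/(k-1)) * \<theta> + const\<close> solve it.  Subtracting a small
  constant and letting \<open>s\<close> be small puts such a solution below any initial datum, which gives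
  \<open>u \<ge> t powr (-1/(k-1)) * \<theta>\<close> without any boundary regularity of \<open>u\<close>.  For the opposite bound one
  needs \<open>u(0) \<le> a \<theta>\<close> for some \<open>a > 0\<close>.  Away from the boundary this is clear; near it, both functions
  are compared with a local defining function \<open>\<rho>\<close> of the domain: strict \<open>(k-1)\<close>-convexity makes
  \<open>B(\<rho> + M \<rho>\<^sup>2 - \<epsilon>|x - x\<^sub>0|\<^sup>2)\<close> a subsolution, so \<open>\<theta> \<ge> B \<rho>\<close>, and \<open>c(\<rho> - M \<rho>\<^sup>2 + |x - x\<^sub>0|\<^sup>2)\<close> is
  superharmonic, so \<open>u(0) \<le> c \<rho>\<close>.  The two bounds differ from \<open>\<theta>\<close> by \<open>O(1/(1 + t))\<close> after rescaling,
  and the solution \<open>(2 + t) powr (-1/(k-1)) * \<theta>\<close> attains this rate.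
\<close>

subsection \<open>Elementary symmetric polynomials and the Garding cone\<close>

text \<open>Monotonicity of S_k fails on arbitrary matrices: it needs the cone where sigma_1, ...,
  sigma_k are positive, and there it rests on Newton's inequality, hence on the fact that
  derivatives of real-rooted polynomials are real-rooted. The exponent 1/(k-1) is forced by
  homogeneity of degree k: c(t) theta solves the equation iff c' = -c^k/(k-1). The two bounds are
  not symmetric. From below, an error e at the boundary is harmless, since the shift s(e) > 0 only
  improves on s = 0 and can be forgotten as e tends to 0. From above, the same device would in
  general let s(e) tend to infinity, so a genuine multiple of theta must dominate u(0) up to the
  boundary; the functions are merely continuous there and offer no normal derivatives to compare,
  hence the barriers. The constant is fixed before theta and u are given; uniqueness of both reduces
  this to one pair, and uniqueness of theta is itself read off from the parabolic lower bound as t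
  tends to infinity.\<close>

text \<open>Factors 1 + x X rather than X - x: the order k is then the coefficient index whatever
  the length of the list, and zero entries contribute factors 1.\<close>

lemma elem_sym_conv_coeff: "elem_sym k xs = coeff (\<Prod>x\<leftarrow>xs. [:1, x:]) k"
proof -
  let ?n = "length xs"
  have m: "(\<Prod>i\<in>I. [:0, xs ! i:]) = monom (\<Prod>i\<in>I. xs ! i) (card I)" if "finite I" for I :: "nat set"
    using that
  proof induction
    case (insert i I)
    have "[:0, xs ! i:] = monom (xs ! i) 1"
      by (simp add: monom_altdef)
    with insert show ?case
      by (simp add: mult_monom)
  qed simp
  have "(\<Prod>x\<leftarrow>xs. [:1, x:]) = (\<Prod>i<?n. [:1, xs ! i:])"
    by (simp add: prod.list_conv_set_nth atLeast0LessThan)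
  also have "\<dots> = (\<Prod>i<?n. [:0, xs ! i:] + 1)"
    by (simp add: one_pCons)
  also have "\<dots> = (\<Sum>I\<in>Pow {..<?n}. monom (\<Prod>i\<in>I. xs ! i) (card I))"
    by (subst prod_add) (auto intro!: sum.cong m intro: finite_subset)
  finally have "coeff (\<Prod>x\<leftarrow>xs. [:1, x:]) k =
      (\<Sum>I\<in>Pow {..<?n}. if card I = k then \<Prod>i\<in>I. xs ! i else 0)"
    by (simp add: coeff_sum)
  also have "\<dots> = (\<Sum>I\<in>{I \<in> Pow {..<?n}. card I = k}. \<Prod>i\<in>I. xs ! i)"
    by (rule sum.inter_filter [symmetric]) simp
  finally show ?thesis
    by (simp add: elem_sym_def)
qed

lemma elem_sym_0 [simp]: "elem_sym 0 xs = 1"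
  unfolding elem_sym_conv_coeff by (induction xs) auto

lemma elem_sym_Cons: "elem_sym (Suc k) (x # xs) = elem_sym (Suc k) xs + x * elem_sym k xs"
  by (simp add: elem_sym_conv_coeff)

lemma elem_sym_eq_0: "length xs < k \<Longrightarrow> elem_sym k xs = 0"
proof (induction xs arbitrary: k)
  case Nil
  then show ?case by (simp add: elem_sym_conv_coeff coeff_eq_0)
next
  case (Cons x xs)
  then show ?case by (cases k) (auto simp: elem_sym_Cons)
qed

lemma elem_sym_mset_cong:
  assumes "mset xs = mset ys"
  shows "elem_sym k xs = elem_sym k ys"
proof -
  have "mset (map (\<lambda>x. [:1, x:]) xs) = mset (map (\<lambda>x. [:1, x:]) ys)"
    using assms by simp
  then show ?thesis
    unfolding elem_sym_conv_coeff by (metis prod_mset_prod_list)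
qed

lemma elem_sym_scale: "elem_sym k (map ((*) c) xs) = c ^ k * elem_sym k xs"
proof (induction xs arbitrary: k)
  case (Cons x xs)
  then show ?case by (cases k) (auto simp: elem_sym_Cons algebra_simps)
next
  case Nil
  then show ?case by (cases k) (simp_all add: elem_sym_eq_0)
qed

lemma elem_sym_1: "elem_sym (Suc 0) xs = sum_list xs"
  by (induction xs) (auto simp: elem_sym_Cons, simp add: elem_sym_conv_coeff)

section \<open>Real-rooted polynomials and Newton's inequality\<close>

text \<open>The scalar may be 0, so the zero polynomial is included and differentiation can be
  iterated without a degree bound.\<close>

definition real_rooted :: "real poly \<Rightarrow> bool" where
  "real_rooted p \<longleftrightarrow> (\<exists>c xs. p = smult c (\<Prod>x\<leftarrow>xs. [:-x, 1:]))"

lemma real_rooted_0 [simp]: "real_rooted 0"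
  unfolding real_rooted_def by (intro exI[of _ 0]) simp

lemma real_rooted_mult:
  assumes "real_rooted p" "real_rooted q"
  shows "real_rooted (p * q)"
proof -
  from assms obtain c xs d ys where
    "p = smult c (\<Prod>x\<leftarrow>xs. [:-x, 1:])" "q = smult d (\<Prod>x\<leftarrow>ys. [:-x, 1:])"
    unfolding real_rooted_def by blast
  then have "p * q = smult (c * d) (\<Prod>x\<leftarrow>xs @ ys. [:-x, 1:])"
    by (simp add: mult.commute)
  then show ?thesis
    unfolding real_rooted_def by blast
qed

lemma real_rooted_linear: "real_rooted [:a, b:]"
proof (cases "b = 0")
  case True
  then show ?thesis
    unfolding real_rooted_def by (intro exI[of _ a] exI[of _ "[]"]) (simp add: one_pCons)
next
  case False
  then show ?thesis
    unfolding real_rooted_def by (intro exI[of _ b] exI[of _ "[-a / b]"]) simp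
qed

lemma poly_map_complex_of_real: "poly (map_poly complex_of_real p) (complex_of_real x) = complex_of_real (poly p x)"
  by (induction p) (auto simp: map_poly_pCons)

lemma poly_map_complex_of_real_cnj:
  "poly (map_poly complex_of_real p) (cnj z) = cnj (poly (map_poly complex_of_real p) z)"
  by (induction p) (auto simp: map_poly_pCons)

lemma map_complex_of_real_mult:
  "map_poly complex_of_real (p * q) = map_poly complex_of_real p * map_poly complex_of_real q"
  by (intro poly_eqI) (simp add: coeff_map_poly coeff_mult)

text \<open>Induction on the degree: the fundamental theorem of algebra yields a root, the
  assumption makes it real, and it splits off as a real linear factor.\<close>

lemma real_rootedI:
  assumes "\<And>z. poly (map_poly complex_of_real p) z = 0 \<Longrightarrow> Im z = 0" and "p \<noteq> 0"
  shows "real_rooted p"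
  using assms
proof (induction "degree p" arbitrary: p)
  case 0
  then obtain a where "p = [:a:]" by (metis degree_0_id degree_eq_zeroE)
  then show ?case using real_rooted_linear[of a 0] by simp
next
  case (Suc n)
  have "degree (map_poly complex_of_real p) = Suc n"
    using Suc by (simp add: degree_map_poly)
  then have "\<not> constant (poly (map_poly complex_of_real p))"
    by (simp add: constant_degree)
  then obtain z where z: "poly (map_poly complex_of_real p) z = 0"
    using fundamental_theorem_of_algebra by blast
  then obtain a where "z = complex_of_real a"
    using Suc.prems(1) by (metis complex_is_Real_iff Reals_cases)
  then have "poly p a = 0"
    using z by (simp add: poly_map_complex_of_real)
  then obtain q where q: "p = [:-a, 1:] * q"
    by (metis poly_eq_0_iff_dvd dvdE)
  have "q \<noteq> 0" using q Suc.prems by auto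
  have "real_rooted q"
  proof (rule Suc.hyps)
    show "n = degree q"
      using Suc.hyps(2) degree_mult_eq[of "[:-a, 1:]" q] \<open>q \<noteq> 0\<close> unfolding q[symmetric] by simp
    show "Im z = 0" if "poly (map_poly complex_of_real q) z = 0" for z
      using that Suc.prems(1)[of z] by (simp only: q map_complex_of_real_mult poly_mult) simp
  qed fact
  then show ?case
    unfolding q by (intro real_rooted_mult real_rooted_linear)
qed

lemma pderiv_linear_mult:
  fixes q :: "'a::idom poly"
  shows "pderiv ([:-a, 1:] * q) = q + [:-a, 1:] * pderiv q"
  by (subst pderiv_mult) (simp add: pderiv_pCons)

text \<open>Together with complex conjugation, this confines the roots of the derivative to the real line.\<close>
lemma upper_half_plane_log_deriv:
  fixes xs :: "real list"
  assumes "Im z > 0"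
  defines "p \<equiv> map_poly complex_of_real (\<Prod>x\<leftarrow>xs. [:-x, 1:])"
  shows "poly p z \<noteq> 0 \<and> Im (poly (pderiv p) z / poly p z) \<le> 0 \<and>
    (xs \<noteq> [] \<longrightarrow> Im (poly (pderiv p) z / poly p z) < 0)"
  unfolding p_def
proof (induction xs)
  case Nil
  then show ?case by (simp add: pderiv_1)
next
  case (Cons x xs)
  let ?q = "map_poly complex_of_real (\<Prod>x\<leftarrow>xs. [:-x, 1:])"
  let ?p = "map_poly complex_of_real (\<Prod>x\<leftarrow>x # xs. [:-x, 1:])"
  have p: "?p = [:- complex_of_real x, 1:] * ?q"
    by (simp only: list.map prod_list.Cons map_complex_of_real_mult) (simp add: map_poly_pCons)
  have nz: "z - x \<noteq> 0" using assms by (auto simp: complex_eq_iff)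
  \<comment> \<open>The logarithmic derivative is the sum of 1/(z - x) over the roots; each summand
    maps the open upper half plane into the lower one.\<close>
  have "(Re z - x)\<^sup>2 + (Im z)\<^sup>2 > 0"
    using assms by (intro add_nonneg_pos) auto
  then have "Im (1 / (z - x)) < 0"
    using assms by (simp add: Im_divide divide_neg_pos)
  moreover have "poly (pderiv ?p) z / poly ?p z = 1 / (z - x) + poly (pderiv ?q) z / poly ?q z"
    unfolding p pderiv_linear_mult using Cons nz by (simp add: field_simps)
  ultimately show ?case
    using Cons nz unfolding p by auto
qed

text \<open>Gauss-Lucas for real roots. Working with half planes instead of Rolle's theorem avoids
  counting multiplicities.\<close>

lemma real_rooted_pderiv:
  assumes "real_rooted p"
  shows "real_rooted (pderiv p)"
proof (cases "pderiv p = 0")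
  case False
  from assms obtain c xs where p: "p = smult c (\<Prod>x\<leftarrow>xs. [:-x, 1:])"
    unfolding real_rooted_def by blast
  let ?q = "\<Prod>x\<leftarrow>xs. [:-x, 1:]"
  have "c \<noteq> 0" using p False by auto
  have "xs \<noteq> []" using p False by (auto simp: pderiv_smult pderiv_1)
  have d: "map_poly complex_of_real (pderiv p) =
      smult (complex_of_real c) (pderiv (map_poly complex_of_real ?q))"
    unfolding p by (intro poly_eqI) (simp add: coeff_map_poly coeff_pderiv)
  have up: "poly (map_poly complex_of_real (pderiv p)) z \<noteq> 0" if "Im z > 0" for z
    using upper_half_plane_log_deriv[OF that, of xs] \<open>c \<noteq> 0\<close> \<open>xs \<noteq> []\<close> unfolding d by auto
  show ?thesis
  proof (rule real_rootedI)
    fix z assume z: "poly (map_poly complex_of_real (pderiv p)) z = 0"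
    then have "poly (map_poly complex_of_real (pderiv p)) (cnj z) = 0"
      by (simp add: poly_map_complex_of_real_cnj)
    with z up[of z] up[of "cnj z"] show "Im z = 0"
      by (cases "Im z" "0::real" rule: linorder_cases) auto
  qed fact
qed simp

text \<open>Away from the roots, p'^2 - p p'' is p^2 times the sum of 1/(x - a)^2, being -p^2 times
  the derivative of p'/p. Induction over the linear factors gives the sign without any
  division.\<close>

lemma laguerre_inequality:
  assumes "real_rooted p"
  shows "poly p x * poly (pderiv (pderiv p)) x \<le> (poly (pderiv p) x)\<^sup>2"
proof -
  have *: "poly q x * poly (pderiv (pderiv q)) x \<le> (poly (pderiv q) x)\<^sup>2"
    if "q = (\<Prod>x\<leftarrow>xs. [:-x, 1:])" for q xs
    using that
  proof (induction xs arbitrary: q)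
    case Nil
    then show ?case by (simp add: pderiv_1)
  next
    case (Cons a xs)
    define r where "r = (\<Prod>x\<leftarrow>xs. [:-x, 1:])"
    have q: "q = [:-a, 1:] * r" using Cons by (simp add: r_def)
    have d1: "poly (pderiv q) x = poly r x + (x - a) * poly (pderiv r) x"
      unfolding q pderiv_linear_mult by (simp add: algebra_simps)
    have d2: "poly (pderiv (pderiv q)) x = 2 * poly (pderiv r) x + (x - a) * poly (pderiv (pderiv r)) x"
      unfolding q pderiv_linear_mult pderiv_add by (simp add: algebra_simps)
    have "(poly (pderiv q) x)\<^sup>2 - poly q x * poly (pderiv (pderiv q)) x =
        (poly r x)\<^sup>2 + (x - a)\<^sup>2 * ((poly (pderiv r) x)\<^sup>2 - poly r x * poly (pderiv (pderiv r)) x)"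
      unfolding d1 d2 unfolding q by (simp add: algebra_simps power2_eq_square)
    also have "\<dots> \<ge> 0"
      using Cons.IH[OF r_def] by (intro add_nonneg_nonneg mult_nonneg_nonneg) auto
    finally show ?case by simp
  qed
  from assms obtain c xs where p: "p = smult c (\<Prod>x\<leftarrow>xs. [:-x, 1:])"
    unfolding real_rooted_def by blast
  show ?thesis
    using mult_left_mono[OF *[OF refl, of xs], of "c\<^sup>2"] unfolding p
    by (simp add: pderiv_smult power2_eq_square mult_ac)
qed

lemma real_rooted_pderiv_funpow: "real_rooted p \<Longrightarrow> real_rooted ((pderiv ^^ n) p)"
  by (induction n) (auto simp: real_rooted_pderiv)

lemma coeff_pderiv_funpow:
  fixes p :: "real poly"
  shows "fact i * coeff ((pderiv ^^ j) p) i = fact (i + j) * coeff p (i + j)"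
proof (induction j arbitrary: i)
  case (Suc j)
  have "fact i * coeff ((pderiv ^^ Suc j) p) i = fact (Suc i) * coeff ((pderiv ^^ j) p) (Suc i)"
    by (simp add: coeff_pderiv)
  also have "\<dots> = fact (i + Suc j) * coeff p (i + Suc j)"
    using Suc[of "Suc i"] by simp
  finally show ?case .
qed simp

text \<open>Laguerre's inequality at 0 for the k-th derivative of the generating polynomial: the
  values there are factorials times elementary symmetric functions.\<close>

lemma newton_inequality:
  "elem_sym k xs * elem_sym (Suc (Suc k)) xs \<le> (elem_sym (Suc k) xs)\<^sup>2"
proof -
  define p where "p = (\<Prod>x\<leftarrow>xs. [:1, x:])"
  have "real_rooted p"
    unfolding p_def
  proof (induction xs)
    case (Cons x xs)
    then show ?case
      using real_rooted_mult[OF real_rooted_linear Cons.IH, of 1 x] by simp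
  qed (use real_rooted_linear[of 1 0] in \<open>simp add: one_pCons\<close>)
  then have *: "poly ((pderiv ^^ k) p) 0 * poly (pderiv (pderiv ((pderiv ^^ k) p))) 0
      \<le> (poly (pderiv ((pderiv ^^ k) p)) 0)\<^sup>2"
    by (intro laguerre_inequality real_rooted_pderiv_funpow)
  have c: "poly ((pderiv ^^ j) p) 0 = fact j * elem_sym j xs" for j
    using coeff_pderiv_funpow[of 0 j p] by (simp add: poly_0_coeff_0 elem_sym_conv_coeff p_def)
  have "(fact k * elem_sym k xs) * (fact (Suc (Suc k)) * elem_sym (Suc (Suc k)) xs)
      \<le> (fact (Suc k) * elem_sym (Suc k) xs)\<^sup>2"
    using * c[of k] c[of "Suc k"] c[of "Suc (Suc k)"] by simp
  \<comment> \<open>The factorials leave the factor (k+1)/(k+2) < 1 in favour of the claim; it is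
    discarded below.\<close>
  then have "(fact k * fact (Suc k)) * ((k + 2) * (elem_sym k xs * elem_sym (Suc (Suc k)) xs))
      \<le> (fact k * fact (Suc k)) * ((k + 1) * (elem_sym (Suc k) xs)\<^sup>2)"
    by (simp add: power2_eq_square algebra_simps)
  then have **: "(k + 2) * (elem_sym k xs * elem_sym (Suc (Suc k)) xs) \<le> (k + 1) * (elem_sym (Suc k) xs)\<^sup>2"
    by (subst (asm) mult_le_cancel_left_pos) auto
  show ?thesis
  proof (rule ccontr)
    assume "\<not> ?thesis"
    then have less: "(elem_sym (Suc k) xs)\<^sup>2 < elem_sym k xs * elem_sym (Suc (Suc k)) xs" by simp
    then have "(k + 1) * (elem_sym (Suc k) xs)\<^sup>2 \<le> (k + 1) * (elem_sym k xs * elem_sym (Suc (Suc k)) xs)"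
      by (intro mult_left_mono) auto
    moreover have "0 < elem_sym k xs * elem_sym (Suc (Suc k)) xs"
      using less zero_le_power2[of "elem_sym (Suc k) xs"] by linarith
    ultimately show False using ** by (simp add: algebra_simps)
  qed
qed

section \<open>The Garding cone and monotonicity on it\<close>

definition garding_cone :: "nat \<Rightarrow> real list set" where
  "garding_cone k = {xs. \<forall>j\<in>{1..k}. elem_sym j xs > 0}"

lemma garding_coneD: "xs \<in> garding_cone k \<Longrightarrow> j \<le> k \<Longrightarrow> elem_sym j xs > 0"
  by (cases "j = 0") (auto simp: garding_cone_def)

lemma garding_cone_Suc: "xs \<in> garding_cone (Suc k) \<longleftrightarrow> xs \<in> garding_cone k \<and> elem_sym (Suc k) xs > 0"
  by (auto simp: garding_cone_def le_Suc_eq)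

lemma garding_cone_0 [simp]: "xs \<in> garding_cone 0"
  by (simp add: garding_cone_def)

lemma garding_cone_mset_cong: "mset xs = mset ys \<Longrightarrow> xs \<in> garding_cone k \<longleftrightarrow> ys \<in> garding_cone k"
  unfolding garding_cone_def using elem_sym_mset_cong[of xs ys] by simp

text \<open>This is ellipticity: \<open>elem_sym k xs\<close> is the derivative of
  \<open>elem_sym (Suc k) (x # xs)\<close> with respect to x. In the induction step,
  \<open>?b \<le> 0\<close> would turn the two inequalities for \<open>x # xs\<close> into
  \<open>?b^2 < ?a * ?c\<close>, against Newton's inequality.\<close>

lemma garding_cone_tail:
  assumes "x # xs \<in> garding_cone (Suc k)"
  shows "xs \<in> garding_cone k"
  using assms
proof (induction k)
  case (Suc k)
  then have IH: "xs \<in> garding_cone k" by (simp add: garding_cone_Suc)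
  let ?a = "elem_sym k xs" and ?b = "elem_sym (Suc k) xs" and ?c = "elem_sym (Suc (Suc k)) xs"
  have a: "?a > 0" using IH by (rule garding_coneD) simp
  have 1: "?b + x * ?a > 0" and 2: "?c + x * ?b > 0"
    using garding_coneD[OF Suc.prems, of "Suc k"] garding_coneD[OF Suc.prems, of "Suc (Suc k)"]
    by (auto simp: elem_sym_Cons)
  have "?b > 0"
  proof (rule ccontr)
    assume "\<not> ?b > 0"
    then have b: "0 \<le> - ?b" by simp
    have "?b\<^sup>2 = - ?b * - ?b" by (simp add: power2_eq_square)
    also have "\<dots> \<le> - ?b * (x * ?a)" using b 1 by (intro mult_left_mono) auto
    also have "\<dots> = (- x * ?b) * ?a" by simp
    also have "\<dots> < ?c * ?a" using a 2 by (intro mult_strict_right_mono) auto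
    finally show False using newton_inequality[of k xs] by (simp add: mult.commute)
  qed
  with IH show ?case by (simp add: garding_cone_Suc)
qed simp

lemma garding_cone_mono_Cons:
  assumes "x # xs \<in> garding_cone k" "x \<le> y"
  shows "y # xs \<in> garding_cone k \<and> elem_sym k (x # xs) \<le> elem_sym k (y # xs)"
proof -
  have *: "elem_sym j (x # xs) \<le> elem_sym j (y # xs)" if "j \<le> k" for j
  proof (cases j)
    case (Suc i)
    have "x # xs \<in> garding_cone (Suc i)"
      using assms(1) that Suc by (auto simp: garding_cone_def)
    then have "xs \<in> garding_cone i" by (rule garding_cone_tail)
    then have "elem_sym i xs > 0" by (rule garding_coneD) simp
    then show ?thesis using assms(2) Suc by (simp add: elem_sym_Cons mult_right_mono)
  qed simp
  show ?thesis
    using * assms(1) unfolding garding_cone_def by (auto intro: less_le_trans)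
qed

lemma garding_cone_mono:
  assumes "xs \<in> garding_cone k" "list_all2 (\<le>) xs ys"
  shows "ys \<in> garding_cone k \<and> elem_sym k xs \<le> elem_sym k ys"
proof -
  \<comment> \<open>Entries already raised are parked in \<open>zs\<close>; by permutation
    invariance the entry to be raised can always be treated as the head.\<close>
  have "ys @ zs \<in> garding_cone k \<and> elem_sym k (xs @ zs) \<le> elem_sym k (ys @ zs)"
    if "xs @ zs \<in> garding_cone k" for zs
    using assms(2) that
  proof (induction arbitrary: zs rule: list_all2_induct)
    case (Cons x xs y ys)
    have 1: "y # xs @ zs \<in> garding_cone k" "elem_sym k (x # xs @ zs) \<le> elem_sym k (y # xs @ zs)"
      using garding_cone_mono_Cons[of x "xs @ zs" k y] Cons by auto
    have m: "mset (y # xs @ zs) = mset (xs @ y # zs)" "mset (ys @ y # zs) = mset (y # ys @ zs)"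
      by auto
    have "xs @ y # zs \<in> garding_cone k"
      using 1 garding_cone_mset_cong[OF m(1)] by simp
    from Cons.IH[OF this] have "y # ys @ zs \<in> garding_cone k"
      "elem_sym k (y # xs @ zs) \<le> elem_sym k (y # ys @ zs)"
      using garding_cone_mset_cong[OF m(2)] elem_sym_mset_cong[OF m(1)] elem_sym_mset_cong[OF m(2)]
      by auto
    with 1 show ?case by auto
  qed simp
  from this[of "[]"] show ?thesis using assms(1) by simp
qed

subsection \<open>Symmetric matrices\<close>

lemma symmetric_matrix_inner:
  fixes A :: "real^'n^'n"
  assumes "transpose A = A"
  shows "v \<bullet> (A *v w) = (A *v v) \<bullet> w"
  by (metis assms dot_lmul_matrix transpose_matrix_vector)

text \<open>The Rayleigh quotient is maximised over the unit sphere of S; invariance keeps the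
  residual \<open>A *v v - c *\<^sub>R v\<close> in S, where it may serve as a variation.\<close>

lemma symmetric_eigenvector_exists:
  fixes A :: "real^'n^'n"
  assumes sym: "transpose A = A" and S: "subspace S" "S \<noteq> {0}"
    and inv: "\<And>v. v \<in> S \<Longrightarrow> A *v v \<in> S"
  obtains v c where "v \<in> S" "norm v = 1" "A *v v = c *\<^sub>R v"
proof -
  let ?K = "sphere 0 1 \<inter> S"
  have "compact ?K"
    using closed_subspace[OF S(1)] by (intro compact_Int_closed) auto
  moreover obtain w where w: "w \<in> S" "w \<noteq> 0"
    using S subspace_0[OF S(1)] by auto
  then have "w /\<^sub>R norm w \<in> ?K"
    using S(1) by (simp add: subspace_scale)
  then have "?K \<noteq> {}" by blast
  moreover have "continuous_on ?K (\<lambda>x. x \<bullet> (A *v x))"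
    by (intro continuous_intros)
  ultimately obtain v where v: "v \<in> ?K" and max: "\<And>x. x \<in> ?K \<Longrightarrow> x \<bullet> (A *v x) \<le> v \<bullet> (A *v v)"
    using continuous_attains_sup[of ?K "\<lambda>x. x \<bullet> (A *v x)"] by blast
  define c where "c = v \<bullet> (A *v v)"
  define g where "g x = c * (x \<bullet> x) - x \<bullet> (A *v x)" for x
  have g_nonneg: "g x \<ge> 0" if "x \<in> S" for x
  proof (cases "x = 0")
    case False
    then have "x /\<^sub>R norm x \<in> ?K"
      using S(1) that by (simp add: subspace_scale)
    from max[OF this] have "(x \<bullet> (A *v x)) / (norm x)\<^sup>2 \<le> c"
      by (simp add: c_def matrix_vector_mult_scaleR power2_eq_square divide_inverse mult_ac)
    with False show ?thesis
      by (simp add: g_def divide_le_eq power2_norm_eq_inner)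
  qed (simp add: g_def)
  define w where "w = A *v v - c *\<^sub>R v"
  have wS: "w \<in> S"
    unfolding w_def using v inv S(1) by (auto intro: subspace_diff subspace_scale)
  have vv: "v \<bullet> v = 1" using v by (simp add: norm_eq_1)
  \<comment> \<open>First variation in the direction w: \<open>g\<close> is nonnegative on S and
    vanishes at v, so the linear term \<open>- 2 * t * (w \<bullet> w)\<close> must be balanced by
    \<open>t^2 * g w\<close>; small t then forces w = 0.\<close>
  have "2 * (w \<bullet> w) \<le> t * g w" if "t > 0" for t
  proof -
    have "0 \<le> g (v - (- t) *\<^sub>R w)"
      using v wS S(1) by (intro g_nonneg subspace_diff subspace_scale) auto
    also have "\<dots> = g v - 2 * t * (w \<bullet> (A *v v) - c * (w \<bullet> v)) + t\<^sup>2 * g w"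
      using symmetric_matrix_inner[OF sym, of v w]
      by (simp add: g_def algebra_simps inner_add_left inner_add_right matrix_vector_right_distrib
          matrix_vector_mult_scaleR power2_eq_square inner_commute)
    also have "w \<bullet> (A *v v) - c * (w \<bullet> v) = w \<bullet> w"
      by (simp add: w_def inner_diff_right)
    also have "g v = 0" by (simp add: g_def c_def vv)
    finally have "t * (2 * (w \<bullet> w)) \<le> t * (t * g w)"
      by (simp add: power2_eq_square mult_ac)
    with that show ?thesis by simp
  qed note * = this
  have "w \<bullet> w \<le> 0"
  proof (rule ccontr)
    assume "\<not> w \<bullet> w \<le> 0"
    then have pos: "w \<bullet> w > 0" by (simp only: not_le)
    have gw: "g w > 0" using *[of 1] pos by linarith
    show False using *[of "(w \<bullet> w) / g w"] pos gw by simp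
  qed
  then have "w = 0" using inner_gt_zero_iff[of w] by linarith
  then have "A *v v = c *\<^sub>R v" by (simp add: w_def)
  with v that show thesis by (auto simp: norm_eq_1)
qed

text \<open>A list rather than a set, so that positions match those of the eigenvalues and of the
  tangent frame in \<open>principal_curvatures\<close>.\<close>

definition orthonormal_list :: "'a::real_inner list \<Rightarrow> bool" where
  "orthonormal_list bs \<longleftrightarrow> (\<forall>i<length bs. \<forall>j<length bs. bs ! i \<bullet> bs ! j = (if i = j then 1 else 0))"

lemma orthonormal_list_conv_set:
  "orthonormal_list bs \<longleftrightarrow>
    distinct bs \<and> (\<forall>v\<in>set bs. \<forall>w\<in>set bs. v \<bullet> w = (if v = w then 1 else 0))"
proof
  assume *: "orthonormal_list bs"
  have "distinct bs"
    unfolding distinct_conv_nth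
  proof (intro allI impI notI)
    fix i j assume ij: "i < length bs" "j < length bs" "i \<noteq> j" "bs ! i = bs ! j"
    then have "bs ! i \<bullet> bs ! i = 0" "bs ! i \<bullet> bs ! i = 1"
      using * unfolding orthonormal_list_def by metis+
    then show False by simp
  qed
  moreover have "\<forall>v\<in>set bs. \<forall>w\<in>set bs. v \<bullet> w = (if v = w then 1 else 0)"
    using * \<open>distinct bs\<close> unfolding orthonormal_list_def
    by (auto simp: in_set_conv_nth nth_eq_iff_index_eq)
  ultimately show "distinct bs \<and> (\<forall>v\<in>set bs. \<forall>w\<in>set bs. v \<bullet> w = (if v = w then 1 else 0))" ..
qed (auto simp: orthonormal_list_def nth_eq_iff_index_eq)

lemma orthonormal_list_Cons:
  "orthonormal_list (v # bs) \<longleftrightarrow> norm v = 1 \<and> (\<forall>w\<in>set bs. v \<bullet> w = 0) \<and> orthonormal_list bs"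
proof
  assume "orthonormal_list (v # bs)"
  then show "norm v = 1 \<and> (\<forall>w\<in>set bs. v \<bullet> w = 0) \<and> orthonormal_list bs"
    unfolding orthonormal_list_conv_set by (auto simp: norm_eq_1)
next
  assume *: "norm v = 1 \<and> (\<forall>w\<in>set bs. v \<bullet> w = 0) \<and> orthonormal_list bs"
  then have v: "v \<bullet> v = 1" "v \<notin> set bs" by (auto simp: norm_eq_1)
  have "w \<bullet> v = 0" if "w \<in> set bs" for w
    using * that by (subst inner_commute) blast
  with * v show "orthonormal_list (v # bs)"
    unfolding orthonormal_list_conv_set by auto
qed

lemma orthonormal_list_independent:
  fixes bs :: "'a::euclidean_space list"
  assumes "orthonormal_list bs"
  shows "independent (set bs)"
  using assms unfolding orthonormal_list_conv_set
  by (intro pairwise_orthogonal_independent)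
    (auto simp: pairwise_def orthogonal_def, metis inner_zero_left zero_neq_one)

lemma orthonormal_list_subset:
  assumes "orthonormal_list bs" "distinct cs" "set cs \<subseteq> set bs"
  shows "orthonormal_list cs"
  using assms unfolding orthonormal_list_conv_set by blast

text \<open>Stated for invariant subspaces to allow induction on the dimension: by symmetry, the
  part of S orthogonal to an eigenvector is invariant again.\<close>

lemma symmetric_eigenbasis_subspace:
  fixes A :: "real^'n^'n"
  assumes sym: "transpose A = A" and S: "subspace S"
    and inv: "\<And>v. v \<in> S \<Longrightarrow> A *v v \<in> S"
  shows "\<exists>bs. orthonormal_list bs \<and> length bs = dim S \<and> set bs \<subseteq> S \<and>
    (\<forall>b\<in>set bs. \<exists>c. A *v b = c *\<^sub>R b)"
  using S inv
proof (induction "dim S" arbitrary: S)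
  case 0
  then show ?case by (intro exI[of _ "[]"]) (simp add: orthonormal_list_def)
next
  case (Suc d)
  have "S \<noteq> {0}" using Suc.hyps(2) by auto
  then obtain v c where v: "v \<in> S" "norm v = 1" "A *v v = c *\<^sub>R v"
    using symmetric_eigenvector_exists[OF sym] Suc.prems by metis
  define T where "T = {y \<in> S. v \<bullet> y = 0}"
  have T: "subspace T"
    using Suc.prems(1) unfolding subspace_def T_def by (auto simp: inner_add_right)
  have "v \<noteq> 0" using v by auto
  have "{y \<in> S. \<forall>x\<in>span {v}. orthogonal x y} = T"
    unfolding T_def orthogonal_def by (auto simp: span_singleton)
  moreover have "dim (span {v}) = 1"
    using \<open>v \<noteq> 0\<close> by (simp add: dim_eq_card_independent dim_span independent_insert)
  moreover have "span {v} \<subseteq> S"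
    using v Suc.prems(1) by (simp add: span_minimal)
  ultimately have dimT: "d = dim T"
    using dim_subspace_orthogonal_to_vectors[of "span {v}" S] Suc.hyps(2) Suc.prems(1) by simp
  have "A *v w \<in> T" if "w \<in> T" for w
    using that Suc.prems(2)[of w] symmetric_matrix_inner[OF sym, of v w] v
    by (simp add: T_def)
  from Suc.hyps(1)[OF dimT T this] obtain bs where bs: "orthonormal_list bs" "length bs = dim T"
    "set bs \<subseteq> T" "\<forall>b\<in>set bs. \<exists>c. A *v b = c *\<^sub>R b" by blast
  have "orthonormal_list (v # bs)"
    using bs v unfolding orthonormal_list_Cons T_def by blast
  with bs v dimT Suc.hyps(2) show ?case
    by (intro exI[of _ "v # bs"]) (auto simp: T_def)
qed

definition eigenbasis :: "real^'n^'n \<Rightarrow> (real^'n) list \<Rightarrow> real list \<Rightarrow> bool" where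
  "eigenbasis A bs ks \<longleftrightarrow> orthonormal_list bs \<and> length bs = CARD('n) \<and> length ks = CARD('n) \<and>
     (\<forall>i<CARD('n). A *v bs ! i = ks ! i *\<^sub>R bs ! i)"

lemma symmetric_sorted_eigenbasis:
  fixes A :: "real^'n^'n"
  assumes "transpose A = A"
  obtains bs ks where "eigenbasis A bs ks" "sorted ks"
proof -
  obtain bs where bs: "orthonormal_list bs" "length bs = CARD('n)" "\<forall>b\<in>set bs. \<exists>c. A *v b = c *\<^sub>R b"
    using symmetric_eigenbasis_subspace[OF assms subspace_UNIV] by (auto simp: dim_UNIV)
  \<comment> \<open>On a unit eigenvector the quadratic form returns the eigenvalue, so the
    eigenvectors themselves can be sorted by it.\<close>
  define \<mu> where "\<mu> v = v \<bullet> (A *v v)" for v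
  define cs where "cs = sort_key \<mu> bs"
  have cs: "set cs = set bs" "length cs = length bs" "distinct cs" "sorted (map \<mu> cs)"
    using bs by (auto simp: cs_def orthonormal_list_conv_set)
  have o: "orthonormal_list cs"
    using orthonormal_list_subset[OF bs(1) cs(3)] cs(1) by simp
  have "A *v b = \<mu> b *\<^sub>R b" if b: "b \<in> set cs" for b
  proof -
    obtain c where c: "A *v b = c *\<^sub>R b" using bs(3) cs(1) b by auto
    have "b \<bullet> b = 1" using o b by (simp add: orthonormal_list_conv_set)
    then show ?thesis by (simp add: \<mu>_def c)
  qed
  then have "eigenbasis A cs (map \<mu> cs)"
    unfolding eigenbasis_def using o cs(2) bs(2) by simp
  then show thesis using that cs(4) by blast
qed

text \<open>Matrices are indexed by the type \<open>'n\<close> and lists by numbers;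
  \<open>h\<close> translates between the two.\<close>

lemma eigenbasis_diagonalization:
  fixes A :: "real^'n^'n"
  assumes "eigenbasis A bs ks"
  obtains Q :: "real^'n^'n" and h :: "'n \<Rightarrow> nat" where
    "bij_betw h UNIV {..<CARD('n)}" "transpose Q ** Q = mat 1"
    "A ** Q = Q ** (\<chi> i j. if i = j then ks ! h j else 0)"
proof -
  obtain h :: "'n \<Rightarrow> nat" where h: "bij_betw h UNIV {..<CARD('n)}"
    using ex_bij_betw_finite_nat[of "UNIV :: 'n set"] by (auto simp: atLeast0LessThan)
  have hl: "h i < CARD('n)" for i using h by (auto simp: bij_betw_def)
  have hi: "h i = h j \<longleftrightarrow> i = j" for i j using h by (auto simp: bij_betw_def inj_on_def)
  define Q :: "real^'n^'n" where "Q = (\<chi> i j. (bs ! h j) $ i)"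
  have "(transpose Q ** Q) $ i $ j = bs ! h i \<bullet> bs ! h j" for i j
    by (simp add: matrix_matrix_mult_def transpose_def Q_def inner_vec_def)
  then have "transpose Q ** Q = mat 1"
    using assms hl hi by (simp add: vec_eq_iff mat_def eigenbasis_def orthonormal_list_def)
  moreover have "(A ** Q) $ i $ j = (A *v (bs ! h j)) $ i" for i j
    by (simp add: matrix_matrix_mult_def matrix_vector_mult_def Q_def)
  then have "A ** Q = Q ** (\<chi> i j. if i = j then ks ! h j else 0)"
    using assms hl unfolding eigenbasis_def
    by (simp add: vec_eq_iff matrix_matrix_mult_def Q_def if_distrib cong: if_cong)
  ultimately show thesis using that h by blast
qed

lemma proots_prod_linear: "proots (\<Prod>k\<leftarrow>ks. [:-k, 1:]) = mset (ks :: 'a::idom list)"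
proof (induction ks)
  case (Cons k ks)
  have "(\<Prod>k\<leftarrow>ks. [:-k, 1:]) \<noteq> 0" by (auto simp: prod_list_zero_iff)
  with Cons show ?case by (simp add: proots_mult del: mult_pCons_left)
qed simp

text \<open>The characteristic polynomial is a determinant over \<open>real poly\<close>, so the
  similarity is carried out there: \<open>P\<close> embeds constant matrices, the scalar matrix
  \<open>X\<close> commutes with everything, and \<open>det (P Q)\<close>, nonzero by orthogonality,
  cancels in the integral domain.\<close>

lemma eigenbasis_char_pol:
  fixes A :: "real^'n^'n"
  assumes "eigenbasis A bs ks"
  shows "char_pol A = (\<Prod>k\<leftarrow>ks. [:-k, 1:])"
proof -
  from eigenbasis_diagonalization[OF assms] obtain Q :: "real^'n^'n" and h :: "'n \<Rightarrow> nat" where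
    h: "bij_betw h UNIV {..<CARD('n)}" and Q: "transpose Q ** Q = mat 1"
    and AQ: "A ** Q = Q ** (\<chi> i j. if i = j then ks ! h j else 0)" .
  define P :: "real^'n^'n \<Rightarrow> real poly^'n^'n" where "P M = (\<chi> i j. [:M $ i $ j:])" for M
  define X :: "real poly^'n^'n" where "X = (\<chi> i j. if i = j then [:0, 1:] else 0)"
  define D :: "real^'n^'n" where "D = (\<chi> i j. if i = j then ks ! h j else 0)"
  have const_sum: "(\<Sum>x\<in>I. [:f x:]) = [:\<Sum>x\<in>I. f x:]" for f :: "'n \<Rightarrow> real" and I
    by (induction I rule: infinite_finite_induct) auto
  have P_mult: "P (M ** N) = P M ** P N" for M N
    by (simp add: P_def vec_eq_iff matrix_matrix_mult_def const_sum mult.commute)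
  have X_comm: "X ** M = M ** X" for M
    by (simp add: X_def vec_eq_iff matrix_matrix_mult_def if_distrib if_distribR mult.commute cong: if_cong)
  have diff: "(M - N) ** K = M ** K - N ** K" "K ** (M - N) = K ** M - K ** N"
    for M N K :: "real poly^'n^'n"
    by (simp_all add: vec_eq_iff matrix_matrix_mult_def left_diff_distrib right_diff_distrib sum_subtractf)
  have "char_pol A = det (X - P A)"
    unfolding char_pol_def X_def P_def by (rule arg_cong[where f = det]) (simp add: vec_eq_iff)
  have "(X - P A) ** P Q = P Q ** (X - P D)"
    unfolding diff P_mult[symmetric] AQ D_def[symmetric] X_comm ..
  then have "det (X - P A) * det (P Q) = det (P Q) * det (X - P D)"
    by (metis det_mul)
  moreover have "P (transpose Q) ** P Q = mat 1"
    unfolding P_mult[symmetric] Q by (simp add: P_def mat_def vec_eq_iff one_pCons)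
  then have "det (P Q) \<noteq> 0"
    by (metis det_I det_mul mult_zero_right zero_neq_one)
  ultimately have "char_pol A = det (X - P D)"
    using \<open>char_pol A = det (X - P A)\<close> by (simp add: mult.commute)
  also have "\<dots> = (\<Prod>i\<in>UNIV. [:- (ks ! h i), 1:])"
    by (subst det_diagonal) (auto simp: X_def P_def D_def)
  also have "\<dots> = (\<Prod>i<CARD('n). [:- (ks ! i), 1:])"
    by (rule prod.reindex_bij_betw[OF h])
  also have "\<dots> = (\<Prod>k\<leftarrow>ks. [:-k, 1:])"
    using assms by (simp add: prod.list_conv_set_nth eigenbasis_def atLeast0LessThan)
  finally show ?thesis .
qed

text \<open>The bridge from roots of the characteristic polynomial to spectral theory: any
  eigenbasis, however it was found, computes \<open>eigenvalues\<close>.\<close>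

lemma eigenbasis_eigenvalues:
  assumes "eigenbasis A bs ks"
  shows "eigenvalues A = sort ks"
  unfolding eigenvalues_def eigenbasis_char_pol[OF assms] proots_prod_linear
  by simp

lemma symmetric_eigenbasis:
  fixes A :: "real^'n^'n"
  assumes "transpose A = A"
  obtains bs where "eigenbasis A bs (eigenvalues A)"
  using symmetric_sorted_eigenbasis[OF assms] eigenbasis_eigenvalues
  by (metis sorted_sort_id)

lemma sum_list_eigenvalues:
  fixes A :: "real^'n^'n"
  assumes "transpose A = A"
  shows "sum_list (eigenvalues A) = trace A"
proof -
  from symmetric_eigenbasis[OF assms] obtain bs where e: "eigenbasis A bs (eigenvalues A)" .
  from eigenbasis_diagonalization[OF e] obtain Q :: "real^'n^'n" and h :: "'n \<Rightarrow> nat" where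
    h: "bij_betw h UNIV {..<CARD('n)}" and Q: "transpose Q ** Q = mat 1"
    and AQ: "A ** Q = Q ** (\<chi> i j. if i = j then eigenvalues A ! h j else 0)" .
  let ?D = "\<chi> i j. if i = j then eigenvalues A ! h j else 0"
  have "Q ** transpose Q = mat 1"
    using Q matrix_left_right_inverse by blast
  then have "A = (A ** Q) ** transpose Q"
    by (simp add: matrix_mul_assoc[symmetric])
  also have "\<dots> = Q ** (?D ** transpose Q)"
    by (simp only: AQ matrix_mul_assoc)
  finally have "trace A = trace (Q ** (?D ** transpose Q))"
    by (rule arg_cong)
  also have "\<dots> = trace ((?D ** transpose Q) ** Q)"
    by (rule trace_mul_sym)
  also have "\<dots> = trace ?D"
    by (simp add: matrix_mul_assoc[symmetric] Q)
  also have "\<dots> = (\<Sum>i\<in>UNIV. eigenvalues A ! h i)"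
    by (simp add: trace_def)
  also have "\<dots> = (\<Sum>i<CARD('n). eigenvalues A ! i)"
    by (rule sum.reindex_bij_betw[OF h])
  also have "\<dots> = sum_list (eigenvalues A)"
    using e by (simp add: sum.list_conv_set_nth eigenbasis_def atLeast0LessThan)
  finally show ?thesis by simp
qed

lemma eigenvalues_scaleR:
  fixes A :: "real^'n^'n"
  assumes "transpose A = A"
  shows "mset (eigenvalues (c *\<^sub>R A)) = mset (map ((*) c) (eigenvalues A))"
proof -
  from symmetric_eigenbasis[OF assms] obtain bs where e: "eigenbasis A bs (eigenvalues A)" .
  have "eigenbasis (c *\<^sub>R A) bs (map ((*) c) (eigenvalues A))"
    using e by (auto simp: eigenbasis_def scaleR_matrix_vector_assoc[symmetric])
  from eigenbasis_eigenvalues[OF this] show ?thesis by simp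
qed

lemma orthonormal_list_expand:
  fixes bs :: "'a::euclidean_space list"
  assumes "orthonormal_list bs" "v \<in> span (set bs)"
  shows "(\<Sum>b\<in>set bs. (v \<bullet> b) *\<^sub>R b) = v"
  using assms unfolding orthonormal_list_conv_set
  by (intro orthonormal_basis_expand) (auto simp: pairwise_def orthogonal_def norm_eq_1)

lemma orthonormal_list_norm:
  fixes bs :: "'a::euclidean_space list"
  assumes "orthonormal_list bs" "v \<in> span (set bs)"
  shows "(\<Sum>b\<in>set bs. (v \<bullet> b)\<^sup>2) = v \<bullet> v"
proof -
  have "v \<bullet> v = v \<bullet> (\<Sum>b\<in>set bs. (v \<bullet> b) *\<^sub>R b)"
    by (simp only: orthonormal_list_expand[OF assms])
  then show ?thesis by (simp add: inner_sum_right power2_eq_square)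
qed

lemma orthonormal_list_quadratic_form:
  fixes A :: "real^'n^'n"
  assumes "transpose A = A" "orthonormal_list bs" "v \<in> span (set bs)"
    and "\<And>b. b \<in> set bs \<Longrightarrow> A *v b = \<mu> b *\<^sub>R b"
  shows "v \<bullet> (A *v v) = (\<Sum>b\<in>set bs. \<mu> b * (v \<bullet> b)\<^sup>2)"
proof -
  have "v \<bullet> (A *v v) = (A *v v) \<bullet> v" by (rule inner_commute)
  also have "\<dots> = (A *v v) \<bullet> (\<Sum>b\<in>set bs. (v \<bullet> b) *\<^sub>R b)"
    by (simp only: orthonormal_list_expand[OF assms(2,3)])
  also have "\<dots> = (\<Sum>b\<in>set bs. (v \<bullet> b) * (v \<bullet> (A *v b)))"
    by (simp add: inner_sum_right symmetric_matrix_inner[OF assms(1), symmetric])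
  also have "\<dots> = (\<Sum>b\<in>set bs. \<mu> b * (v \<bullet> b)\<^sup>2)"
    by (intro sum.cong) (auto simp: assms(4) power2_eq_square)
  finally show ?thesis .
qed

text \<open>Courant--Fischer: the span of the top eigenvectors of \<open>A\<close> meets the span of the bottom
  eigenvectors of \<open>B\<close> for dimension reasons.\<close>
lemma eigenvalues_mono:
  fixes A B :: "real^'n^'n"
  assumes A: "transpose A = A" and B: "transpose B = B"
    and le: "\<And>v. v \<bullet> (A *v v) \<le> v \<bullet> (B *v v)"
  shows "list_all2 (\<le>) (eigenvalues A) (eigenvalues B)"
proof -
  let ?n = "CARD('n)"
  obtain as where as: "eigenbasis A as (eigenvalues A)" using symmetric_eigenbasis[OF A] .
  obtain bs where bs: "eigenbasis B bs (eigenvalues B)" using symmetric_eigenbasis[OF B] .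
  have len: "length as = ?n" "length bs = ?n" "length (eigenvalues A) = ?n" "length (eigenvalues B) = ?n"
    and o: "orthonormal_list as" "orthonormal_list bs"
    using as bs by (auto simp: eigenbasis_def)
  then have d: "distinct as" "distinct bs" by (auto simp: orthonormal_list_conv_set)
  have sorted: "sorted (eigenvalues A)" "sorted (eigenvalues B)"
    using eigenbasis_eigenvalues[OF as] eigenbasis_eigenvalues[OF bs] by (metis sorted_sort)+
  show ?thesis
    unfolding list_all2_conv_all_nth
  proof (intro conjI allI impI)
    fix i assume "i < length (eigenvalues A)"
    then have i: "i < ?n" using len by simp
    \<comment> \<open>Index i belongs to both lists: the spans have dimensions n - i and i + 1, one
      more than n together, so they share a nonzero vector.\<close>
    define cs where "cs = drop i as"
    define ds where "ds = take (Suc i) bs"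
    have oc: "orthonormal_list cs" "orthonormal_list ds"
      unfolding cs_def ds_def
      by (rule orthonormal_list_subset[OF o(1)] orthonormal_list_subset[OF o(2)];
          use d in \<open>simp add: set_drop_subset set_take_subset\<close>)+
    have dims: "dim (span (set cs)) = ?n - i" "dim (span (set ds)) = Suc i"
      using orthonormal_list_independent[OF oc(1)] orthonormal_list_independent[OF oc(2)] d len i
      by (simp_all add: dim_span dim_eq_card_independent cs_def ds_def distinct_card)
    have "dim {x + y |x y. x \<in> span (set cs) \<and> y \<in> span (set ds)} \<le> ?n"
      using dim_subset_UNIV[of "{x + y |x y. x \<in> span (set cs) \<and> y \<in> span (set ds)}"] by simp
    then have "dim (span (set cs) \<inter> span (set ds)) \<noteq> 0"
      using dim_sums_Int[OF subspace_span subspace_span, of "set cs" "set ds"] dims i by linarith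
    then obtain v where v: "v \<in> span (set cs)" "v \<in> span (set ds)" "v \<noteq> 0"
      by (auto simp: dim_eq_0)
    define \<mu> where "\<mu> b = b \<bullet> (A *v b)" for b
    define \<nu> where "\<nu> b = b \<bullet> (B *v b)" for b
    have \<mu>: "A *v (as ! j) = \<mu> (as ! j) *\<^sub>R (as ! j)" "\<mu> (as ! j) = eigenvalues A ! j" if "j < ?n" for j
      using as o(1) that len unfolding \<mu>_def eigenbasis_def orthonormal_list_def by auto
    have \<nu>: "B *v (bs ! j) = \<nu> (bs ! j) *\<^sub>R (bs ! j)" "\<nu> (bs ! j) = eigenvalues B ! j" if "j < ?n" for j
      using bs o(2) that len unfolding \<nu>_def eigenbasis_def orthonormal_list_def by auto
    have c: "A *v b = \<mu> b *\<^sub>R b \<and> eigenvalues A ! i \<le> \<mu> b" if b: "b \<in> set cs" for b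
    proof -
      obtain j where j: "b = as ! (i + j)" "i + j < ?n"
        using b len unfolding cs_def by (auto simp: in_set_conv_nth)
      then show ?thesis
        using \<mu>[of "i + j"] sorted_nth_mono[OF sorted(1), of i "i + j"] len by simp
    qed
    have e: "B *v b = \<nu> b *\<^sub>R b \<and> \<nu> b \<le> eigenvalues B ! i" if b: "b \<in> set ds" for b
    proof -
      obtain j where j: "b = bs ! j" "j \<le> i" "j < ?n"
        using b len i unfolding ds_def by (auto simp: in_set_conv_nth)
      then show ?thesis
        using \<nu>[of j] sorted_nth_mono[OF sorted(2), of j i] len i by simp
    qed
    have "eigenvalues A ! i * (v \<bullet> v) \<le> v \<bullet> (A *v v)"
      unfolding orthonormal_list_norm[OF oc(1) v(1), symmetric] sum_distrib_left
      by (subst orthonormal_list_quadratic_form[OF A oc(1) v(1), of \<mu>])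
        (use c in \<open>auto intro!: sum_mono mult_right_mono\<close>)
    also have "\<dots> \<le> v \<bullet> (B *v v)" by (rule le)
    also have "\<dots> \<le> eigenvalues B ! i * (v \<bullet> v)"
      unfolding orthonormal_list_norm[OF oc(2) v(2), symmetric] sum_distrib_left
      by (subst orthonormal_list_quadratic_form[OF B oc(2) v(2), of \<nu>])
        (use e in \<open>auto intro!: sum_mono mult_right_mono\<close>)
    finally show "eigenvalues A ! i \<le> eigenvalues B ! i"
      using v(3) by simp
  qed (simp add: len)
qed

text \<open>Only the smaller matrix is assumed to be in the cone, since the cone is stable upwards.
  In comparisons, admissibility is therefore required of the lower function alone.\<close>

lemma elem_sym_eigenvalues_mono:
  fixes A B :: "real^'n^'n"
  assumes "transpose A = A" "transpose B = B"
    and "\<And>v. v \<bullet> (A *v v) \<le> v \<bullet> (B *v v)"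
    and "eigenvalues A \<in> garding_cone k"
  shows "eigenvalues B \<in> garding_cone k"
    and "elem_sym k (eigenvalues A) \<le> elem_sym k (eigenvalues B)"
  using garding_cone_mono[OF assms(4) eigenvalues_mono[OF assms(1-3)]] by auto

lemma elem_sym_eigenvalues_scaleR:
  fixes A :: "real^'n^'n"
  assumes "transpose A = A"
  shows "elem_sym k (eigenvalues (c *\<^sub>R A)) = c ^ k * elem_sym k (eigenvalues A)"
  using elem_sym_mset_cong[OF eigenvalues_scaleR[OF assms, of c], of k] by (simp add: elem_sym_scale)

text \<open>The sum of \<open>ks ! i\<close> times the orthogonal projection onto
  \<open>bs ! i\<close>; it provides a comparison matrix with prescribed spectrum.\<close>

lemma symmetric_matrix_with_eigenbasis:
  fixes bs :: "(real^'n) list"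
  assumes "orthonormal_list bs" "length bs = CARD('n)" "length ks = CARD('n)"
  obtains A :: "real^'n^'n" where "transpose A = A" "eigenbasis A bs ks"
    "\<And>v. v \<bullet> (A *v v) = (\<Sum>i<CARD('n). ks ! i * (v \<bullet> bs ! i)\<^sup>2)"
proof -
  define A :: "real^'n^'n" where "A = (\<chi> a b. \<Sum>i<CARD('n). ks ! i * (bs ! i) $ a * (bs ! i) $ b)"
  have Av: "A *v v = (\<Sum>i<CARD('n). (ks ! i * (v \<bullet> bs ! i)) *\<^sub>R bs ! i)" for v
  proof -
    have "(A *v v) $ a = (\<Sum>i<CARD('n). (ks ! i * (v \<bullet> bs ! i)) *\<^sub>R bs ! i) $ a" for a
    proof -
      have "(A *v v) $ a = (\<Sum>b\<in>UNIV. \<Sum>i<CARD('n). ks ! i * (bs ! i) $ a * (bs ! i) $ b * v $ b)"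
        by (simp add: A_def matrix_vector_mult_def sum_distrib_right)
      also have "\<dots> = (\<Sum>i<CARD('n). \<Sum>b\<in>UNIV. ks ! i * (bs ! i) $ a * (bs ! i) $ b * v $ b)"
        by (rule sum.swap)
      also have "\<dots> = (\<Sum>i<CARD('n). (ks ! i * (v \<bullet> bs ! i)) *\<^sub>R bs ! i) $ a"
        by (simp add: inner_vec_def sum_distrib_left sum_distrib_right mult_ac)
      finally show ?thesis .
    qed
    then show ?thesis by (subst vec_eq_iff) blast
  qed
  have "transpose A = A"
    by (simp add: A_def transpose_def vec_eq_iff mult_ac)
  moreover have "eigenbasis A bs ks"
    unfolding eigenbasis_def
  proof (intro conjI allI impI)
    fix i assume i: "i < CARD('n)"
    have "A *v bs ! i = (\<Sum>j<CARD('n). if j = i then ks ! i *\<^sub>R bs ! i else 0)"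
      unfolding Av using assms(1,2) i by (intro sum.cong) (auto simp: orthonormal_list_def)
    then show "A *v bs ! i = ks ! i *\<^sub>R bs ! i"
      using i by simp
  qed (use assms in auto)
  moreover have "v \<bullet> (A *v v) = (\<Sum>i<CARD('n). ks ! i * (v \<bullet> bs ! i)\<^sup>2)" for v
    unfolding Av inner_sum_right by (simp add: power2_eq_square mult_ac)
  ultimately show thesis using that by blast
qed

subsection \<open>Second derivatives\<close>

lemma gradient_has_derivative:
  fixes f :: "real^'n \<Rightarrow> real"
  assumes "f differentiable (at x)"
  shows "(f has_derivative (\<lambda>h. gradient f x \<bullet> h)) (at x)"
proof -
  let ?D = "frechet_derivative f (at x)"
  have D: "(f has_derivative ?D) (at x)"
    using assms by (simp add: frechet_derivative_works)
  then have "linear ?D" by (rule has_derivative_linear)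
  have "?D h = gradient f x \<bullet> h" for h
  proof -
    have "?D h = ?D (\<Sum>i\<in>UNIV. h $ i *\<^sub>R axis i 1)"
      by (simp add: basis_expansion[of h, unfolded scalar_mult_eq_scaleR])
    also have "\<dots> = (\<Sum>i\<in>UNIV. h $ i *\<^sub>R ?D (axis i 1))"
      by (simp add: linear_sum[OF \<open>linear ?D\<close>] linear_scale[OF \<open>linear ?D\<close>])
    also have "\<dots> = gradient f x \<bullet> h"
      by (simp add: gradient_def inner_vec_def mult.commute)
    finally show ?thesis .
  qed
  then have "?D = (\<lambda>h. gradient f x \<bullet> h)" by blast
  with D show ?thesis by simp
qed

lemma gradient_eqI:
  assumes "(f has_derivative (\<lambda>h. g \<bullet> h)) (at x)"
  shows "gradient f x = g"
  using frechet_derivative_at[OF assms, symmetric]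
  by (simp add: gradient_def vec_eq_iff inner_axis)

lemma hessian_has_derivative:
  assumes "gradient f differentiable (at x)"
  shows "(gradient f has_derivative (\<lambda>h. hessian f x *v h)) (at x)"
proof -
  have D: "(gradient f has_derivative frechet_derivative (gradient f) (at x)) (at x)"
    using assms by (simp add: frechet_derivative_works)
  then have "(\<lambda>h. hessian f x *v h) = frechet_derivative (gradient f) (at x)"
    unfolding hessian_def by (intro matrix_vector_mul(2) has_derivative_linear)
  with D show ?thesis by simp
qed

lemma hessian_eqI:
  assumes "open S" "x \<in> S"
    and "\<And>y. y \<in> S \<Longrightarrow> (f has_derivative (\<lambda>h. G y \<bullet> h)) (at y)"
    and "(G has_derivative (\<lambda>h. H *v h)) (at x)"
  shows "hessian f x = H" and "gradient f differentiable (at x)"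
proof -
  have D: "(gradient f has_derivative (\<lambda>h. H *v h)) (at x)"
    using assms(4,1,2) by (rule has_derivative_transform_within_open) (simp add: gradient_eqI[OF assms(3)])
  from frechet_derivative_at[OF D] show "hessian f x = H"
    unfolding hessian_def by (metis matrix_of_matrix_vector_mul)
  from D show "gradient f differentiable (at x)"
    by (auto simp: differentiable_def)
qed

definition twice_differentiable_on :: "(real^'n) set \<Rightarrow> (real^'n \<Rightarrow> real) \<Rightarrow> bool" where
  "twice_differentiable_on S f \<longleftrightarrow>
     (\<forall>x\<in>S. f differentiable (at x) \<and> gradient f differentiable (at x))"

lemma C2_on_imp_twice_differentiable_on: "C2_on S f \<Longrightarrow> twice_differentiable_on S f"
  by (simp add: C2_on_def twice_differentiable_on_def)

lemma twice_differentiable_on_subset: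
  "twice_differentiable_on S f \<Longrightarrow> T \<subseteq> S \<Longrightarrow> twice_differentiable_on T f"
  by (auto simp: twice_differentiable_on_def)

lemma twice_differentiable_onD:
  assumes "twice_differentiable_on S f" "x \<in> S"
  shows "(f has_derivative (\<lambda>h. gradient f x \<bullet> h)) (at x)"
    and "(gradient f has_derivative (\<lambda>h. hessian f x *v h)) (at x)"
  using assms unfolding twice_differentiable_on_def
  by (auto intro: gradient_has_derivative hessian_has_derivative)

text \<open>The mean value theorem along v turns the mixed difference into a difference of two
  gradients, and both are evaluated by differentiability of the gradient at the single point
  x.\<close>

lemma second_difference_estimate:
  fixes f :: "real^'n \<Rightarrow> real"
  assumes tw: "twice_differentiable_on (ball x r) f" and x: "r > 0" and e: "e > 0"
  obtains d where "d > 0"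
    "\<And>t. 0 < t \<Longrightarrow> t < d \<Longrightarrow>
      \<bar>f (x + t *\<^sub>R v + t *\<^sub>R w) - f (x + t *\<^sub>R v) - f (x + t *\<^sub>R w) + f x - t\<^sup>2 * (v \<bullet> (hessian f x *v w))\<bar>
        \<le> 2 * e * t\<^sup>2 * (norm v + norm w)\<^sup>2"
proof -
  let ?H = "hessian f x"
  have "(gradient f has_derivative (\<lambda>h. ?H *v h)) (at x)"
    using twice_differentiable_onD(2)[OF tw] x by simp
  then obtain \<delta> where \<delta>: "\<delta> > 0"
    "\<And>y. norm (y - x) < \<delta> \<Longrightarrow> norm (gradient f y - gradient f x - ?H *v (y - x)) \<le> e * norm (y - x)"
    using e unfolding has_derivative_at_alt by blast
  define N where "N = norm v + norm w"
  have N: "N \<ge> 0" "norm v \<le> N" by (simp_all add: N_def)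
  \<comment> \<open>All points \<open>?p s c\<close> below lie within \<open>t * N\<close> of x, so
    this bound on t keeps them in the ball and in the delta-neighbourhood; N + 1 covers N =
    0.\<close>
  define d where "d = min \<delta> r / (N + 1)"
  have "d > 0" using \<delta>(1) x N by (simp add: d_def)
  moreover have "\<bar>f (x + t *\<^sub>R v + t *\<^sub>R w) - f (x + t *\<^sub>R v) - f (x + t *\<^sub>R w) + f x - t\<^sup>2 * (v \<bullet> (?H *v w))\<bar>
      \<le> 2 * e * t\<^sup>2 * N\<^sup>2" if t: "0 < t" "t < d" for t
  proof -
    have tN: "t * N < min \<delta> r"
    proof -
      have "t * N \<le> t * (N + 1)" using t by simp
      also have "\<dots> < d * (N + 1)" using t N by (intro mult_strict_right_mono) auto
      also have "\<dots> = min \<delta> r" using N by (simp add: d_def)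
      finally show ?thesis .
    qed
    have bound: "norm (s *\<^sub>R t *\<^sub>R v + c *\<^sub>R t *\<^sub>R w) \<le> t * N"
      if "0 \<le> s" "s \<le> 1" "0 \<le> c" "c \<le> 1" for s c
    proof -
      have "norm (s *\<^sub>R t *\<^sub>R v + c *\<^sub>R t *\<^sub>R w) \<le> s * (t * norm v) + c * (t * norm w)"
        using that t by (intro order_trans[OF norm_triangle_ineq]) simp
      also have "\<dots> \<le> 1 * (t * norm v) + 1 * (t * norm w)"
        using that t by (intro add_mono mult_right_mono) auto
      finally show ?thesis by (simp add: N_def algebra_simps)
    qed
    let ?p = "\<lambda>s c. x + (s *\<^sub>R t *\<^sub>R v + c *\<^sub>R t *\<^sub>R w)"
    have near: "?p s c \<in> ball x r" "norm (?p s c - x) < \<delta>"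
      if "0 \<le> s" "s \<le> 1" "0 \<le> c" "c \<le> 1" for s c
    proof -
      have n: "norm (?p s c - x) < r" "norm (?p s c - x) < \<delta>"
        using bound[OF that] tN by simp_all
      from n(1) show "?p s c \<in> ball x r" by (metis mem_ball dist_commute dist_norm)
      from n(2) show "norm (?p s c - x) < \<delta>" .
    qed
    define \<phi> where "\<phi> s = f (?p s 1) - f (?p s 0)" for s
    have D: "((\<lambda>s. f (?p s c)) has_real_derivative gradient f (?p s c) \<bullet> (t *\<^sub>R v)) (at s)"
      if "0 \<le> s" "s \<le> 1" "0 \<le> c" "c \<le> 1" for s c
      unfolding has_field_derivative_def
      by (rule has_derivative_eq_rhs[OF has_derivative_compose[of "\<lambda>s. ?p s c" "\<lambda>h. h *\<^sub>R t *\<^sub>R v"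
        _ _ f, OF _ twice_differentiable_onD(1)[OF tw near(1)[OF that]]]])
        (auto intro!: derivative_eq_intros simp: fun_eq_iff)
    define \<phi>' where "\<phi>' s = gradient f (?p s 1) \<bullet> (t *\<^sub>R v) - gradient f (?p s 0) \<bullet> (t *\<^sub>R v)" for s
    have "(\<phi> has_real_derivative \<phi>' s) (at s)" if "0 \<le> s" "s \<le> 1" for s
      unfolding \<phi>_def \<phi>'_def using that by (intro DERIV_diff D) auto
    then obtain s where s: "0 < s" "s < 1" "\<phi> 1 - \<phi> 0 = (1 - 0) * \<phi>' s"
      using MVT2[of 0 1 \<phi> \<phi>'] by auto
    let ?E = "\<lambda>c. gradient f (?p s c) - gradient f x - ?H *v (?p s c - x)"
    have E: "norm (?E c) \<le> e * (t * N)" if "0 \<le> c" "c \<le> 1" for c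
    proof -
      have "norm (?E c) \<le> e * norm (?p s c - x)"
        using s that by (intro \<delta>(2) near(2)) auto
      also have "norm (?p s c - x) \<le> t * N"
        using bound[of s c] s that by simp
      finally show ?thesis using e by simp
    qed
    have eq: "gradient f (?p s 1) - gradient f (?p s 0) = t *\<^sub>R (?H *v w) + (?E 1 - ?E 0)"
      by (simp add: matrix_vector_right_distrib matrix_vector_mult_scaleR algebra_simps)
    have "\<phi> 1 - \<phi> 0 = t * (v \<bullet> (gradient f (?p s 1) - gradient f (?p s 0)))"
      using s(3) by (simp add: \<phi>'_def inner_diff_right inner_commute right_diff_distrib)
    also have "\<dots> = t * (v \<bullet> (t *\<^sub>R (?H *v w) + (?E 1 - ?E 0)))"
      by (simp only: eq)
    finally have "\<phi> 1 - \<phi> 0 - t\<^sup>2 * (v \<bullet> (?H *v w)) = t * (v \<bullet> (?E 1 - ?E 0))"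
      by (simp only: inner_add_right) (simp add: power2_eq_square algebra_simps)
    then have "\<bar>\<phi> 1 - \<phi> 0 - t\<^sup>2 * (v \<bullet> (?H *v w))\<bar> = t * \<bar>v \<bullet> (?E 1 - ?E 0)\<bar>"
      using t by (simp add: abs_mult)
    also have "\<dots> \<le> t * (norm v * norm (?E 1 - ?E 0))"
      using t by (intro mult_left_mono Cauchy_Schwarz_ineq2) auto
    also have "\<dots> \<le> t * (N * (e * (t * N) + e * (t * N)))"
      using t N order_trans[OF norm_triangle_ineq4 add_mono[OF E[of 1] E[of 0]]]
      by (intro mult_left_mono mult_mono) auto
    also have "\<dots> = 2 * e * t\<^sup>2 * N\<^sup>2" by (simp add: power2_eq_square)
    finally show ?thesis
      unfolding \<phi>_def by (simp add: algebra_simps)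
  qed
  ultimately show thesis using that unfolding N_def by blast
qed

text \<open>The second difference is unchanged when v and w are swapped, so both values of the
  bilinear form, multiplied by t^2, approximate it up to an arbitrarily small multiple of
  t^2.\<close>

lemma hessian_symmetric:
  fixes f :: "real^'n \<Rightarrow> real"
  assumes "twice_differentiable_on S f" "open S" "x \<in> S"
  shows "transpose (hessian f x) = hessian f x"
proof -
  let ?H = "hessian f x"
  obtain r where r: "r > 0" "ball x r \<subseteq> S" using assms openE by blast
  have tw: "twice_differentiable_on (ball x r) f"
    using assms r twice_differentiable_on_subset by blast
  have *: "v \<bullet> (?H *v w) = w \<bullet> (?H *v v)" for v w
  proof -
    define K where "K = 4 * (norm v + norm w)\<^sup>2"
    have "\<bar>v \<bullet> (?H *v w) - w \<bullet> (?H *v v)\<bar> \<le> e * K" if e: "e > 0" for e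
    proof -
      obtain d1 where d1: "d1 > 0" "\<And>t. 0 < t \<Longrightarrow> t < d1 \<Longrightarrow>
      \<bar>f (x + t *\<^sub>R v + t *\<^sub>R w) - f (x + t *\<^sub>R v) - f (x + t *\<^sub>R w) + f x - t\<^sup>2 * (v \<bullet> (hessian f x *v w))\<bar>
        \<le> 2 * e * t\<^sup>2 * (norm v + norm w)\<^sup>2"
        using second_difference_estimate[OF tw r(1) e, of v w] by blast
      obtain d2 where d2: "d2 > 0" "\<And>t. 0 < t \<Longrightarrow> t < d2 \<Longrightarrow>
      \<bar>f (x + t *\<^sub>R w + t *\<^sub>R v) - f (x + t *\<^sub>R w) - f (x + t *\<^sub>R v) + f x - t\<^sup>2 * (w \<bullet> (hessian f x *v v))\<bar>
        \<le> 2 * e * t\<^sup>2 * (norm w + norm v)\<^sup>2"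
        using second_difference_estimate[OF tw r(1) e, of w v] by blast
      define t where "t = min d1 d2 / 2"
      have t: "0 < t" "t < d1" "t < d2" using d1 d2 by (auto simp: t_def)
      have eq: "x + t *\<^sub>R w + t *\<^sub>R v = x + t *\<^sub>R v + t *\<^sub>R w" by simp
      have "\<bar>t\<^sup>2 * (v \<bullet> (?H *v w)) - t\<^sup>2 * (w \<bullet> (?H *v v))\<bar> \<le> t\<^sup>2 * (e * K)"
        using d1(2)[OF t(1,2)] d2(2)[OF t(1,3)] unfolding eq K_def add.commute[of "norm w"]
        by (simp only: abs_le_iff) (simp add: algebra_simps)
      then have "t\<^sup>2 * \<bar>v \<bullet> (?H *v w) - w \<bullet> (?H *v v)\<bar> \<le> t\<^sup>2 * (e * K)"
        by (simp add: right_diff_distrib[symmetric] abs_mult)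
      with t(1) show ?thesis by simp
    qed note bound = this
    have "\<bar>v \<bullet> (?H *v w) - w \<bullet> (?H *v v)\<bar> \<le> 0"
    proof (rule field_le_epsilon)
      fix e :: real assume "e > 0"
      have "K \<ge> 0" by (simp add: K_def)
      have "\<bar>v \<bullet> (?H *v w) - w \<bullet> (?H *v v)\<bar> \<le> e / (K + 1) * K"
        using \<open>e > 0\<close> \<open>K \<ge> 0\<close> by (intro bound) simp
      also have "\<dots> \<le> e" using \<open>e > 0\<close> \<open>K \<ge> 0\<close> by (simp add: field_simps)
      finally show "\<bar>v \<bullet> (?H *v w) - w \<bullet> (?H *v v)\<bar> \<le> 0 + e" by simp
    qed
    then show ?thesis by simp
  qed
  have "?H $ i $ j = ?H $ j $ i" for i j
    using *[of "axis i 1" "axis j 1"] by (simp add: matrix_vector_mul_component inner_axis' inner_axis matrix_vector_mult_basis column_def)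
  then show ?thesis by (simp add: transpose_def vec_eq_iff)
qed

text \<open>If the form were positive at v, the derivative along v would vanish at 0 and be positive
  just after it, and the mean value theorem would produce a larger value.\<close>

lemma hessian_local_max:
  fixes f :: "real^'n \<Rightarrow> real"
  assumes tw: "twice_differentiable_on S f" and S: "open S" "x \<in> S"
    and max: "\<And>y. y \<in> S \<Longrightarrow> f y \<le> f x"
  shows "v \<bullet> (hessian f x *v v) \<le> 0"
proof (rule ccontr)
  assume "\<not> ?thesis"
  then have pos: "v \<bullet> (hessian f x *v v) > 0" by simp
  then have "v \<noteq> 0" by auto
  obtain r where r: "r > 0" "ball x r \<subseteq> S" using S openE by blast
  define r' where "r' = r / norm v"
  have r': "r' > 0" using r \<open>v \<noteq> 0\<close> by (simp add: r'_def)
  have inS: "x + t *\<^sub>R v \<in> S" if "\<bar>t\<bar> < r'" for t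
    using that r \<open>v \<noteq> 0\<close> by (intro subsetD[OF r(2)]) (simp add: dist_norm r'_def less_divide_eq)
  define g where "g t = f (x + t *\<^sub>R v)" for t
  define g' where "g' t = gradient f (x + t *\<^sub>R v) \<bullet> v" for t
  have Dg: "(g has_real_derivative g' t) (at t)" if "\<bar>t\<bar> < r'" for t
    unfolding has_field_derivative_def g_def g'_def
    by (rule has_derivative_eq_rhs[OF has_derivative_compose[of "\<lambda>t. x + t *\<^sub>R v" "\<lambda>h. h *\<^sub>R v"
        _ _ f, OF _ twice_differentiable_onD(1)[OF tw inS[OF that]]]])
      (auto intro!: derivative_eq_intros simp: fun_eq_iff)
  have "((\<lambda>t. gradient f (x + t *\<^sub>R v)) has_derivative (\<lambda>h. hessian f x *v (h *\<^sub>R v))) (at 0)"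
    by (rule has_derivative_compose[of "\<lambda>t. x + t *\<^sub>R v" "\<lambda>h. h *\<^sub>R v" _ _ "gradient f"])
      (use twice_differentiable_onD(2)[OF tw S(2)] in \<open>auto intro!: derivative_eq_intros simp: fun_eq_iff\<close>)
  then have "(g' has_derivative (\<lambda>h. (hessian f x *v (h *\<^sub>R v)) \<bullet> v)) (at 0)"
    unfolding g'_def by (rule has_derivative_inner_left)
  then have Dg': "(g' has_real_derivative v \<bullet> (hessian f x *v v)) (at 0)"
    unfolding has_field_derivative_def
    by (rule has_derivative_eq_rhs) (simp add: fun_eq_iff matrix_vector_mult_scaleR inner_commute)
  have "g' 0 = 0"
  proof (rule DERIV_local_max[OF Dg r'])
    show "\<forall>y. \<bar>0 - y\<bar> < r' \<longrightarrow> g y \<le> g 0"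
      using max inS by (auto simp: g_def)
  qed (use r' in simp)
  from DERIV_pos_inc_right[OF Dg' pos] obtain d where d: "d > 0"
    "\<And>h. h > 0 \<Longrightarrow> h < d \<Longrightarrow> g' 0 < g' (0 + h)" by blast
  define t where "t = min d r' / 2"
  have t: "0 < t" "t < d" "t < r'" using d r' by (auto simp: t_def)
  obtain s where s: "0 < s" "s < t" "g t - g 0 = (t - 0) * g' s"
    using MVT2[of 0 t g g'] t Dg by auto
  have "g' s > 0" using d(2)[of s] s t \<open>g' 0 = 0\<close> by simp
  then have "g t > g 0" using s t by (simp add: algebra_simps)
  moreover have "g t \<le> g 0" using max inS[of t] t by (simp add: g_def)
  ultimately show False by simp
qed

lemma lincomb_derivatives:
  fixes f g :: "real^'n \<Rightarrow> real"
  assumes "twice_differentiable_on S f" "twice_differentiable_on S g" "open S" "x \<in> S"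
  shows "hessian (\<lambda>y. a * f y + b * g y + c) x = a *\<^sub>R hessian f x + b *\<^sub>R hessian g x"
    and "gradient (\<lambda>y. a * f y + b * g y + c) x = a *\<^sub>R gradient f x + b *\<^sub>R gradient g x"
    and "(\<lambda>y. a * f y + b * g y + c) differentiable (at x)"
    and "gradient (\<lambda>y. a * f y + b * g y + c) differentiable (at x)"
proof -
  have 1: "((\<lambda>y. a * f y + b * g y + c) has_derivative
      (\<lambda>h. (a *\<^sub>R gradient f y + b *\<^sub>R gradient g y) \<bullet> h)) (at y)" if "y \<in> S" for y
    using twice_differentiable_onD(1)[OF assms(1) that] twice_differentiable_onD(1)[OF assms(2) that]
    by (auto intro!: derivative_eq_intros simp: inner_add_left)
  have 2: "((\<lambda>y. a *\<^sub>R gradient f y + b *\<^sub>R gradient g y) has_derivative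
      (\<lambda>h. (a *\<^sub>R hessian f x + b *\<^sub>R hessian g x) *v h)) (at x)"
    using twice_differentiable_onD(2)[OF assms(1,4)] twice_differentiable_onD(2)[OF assms(2,4)]
    by (auto intro!: derivative_eq_intros
        simp: matrix_vector_mult_add_rdistrib scaleR_matrix_vector_assoc)
  show "hessian (\<lambda>y. a * f y + b * g y + c) x = a *\<^sub>R hessian f x + b *\<^sub>R hessian g x"
    "gradient (\<lambda>y. a * f y + b * g y + c) differentiable (at x)"
    using hessian_eqI[OF assms(3,4) 1 2] by auto
  show "gradient (\<lambda>y. a * f y + b * g y + c) x = a *\<^sub>R gradient f x + b *\<^sub>R gradient g x"
    by (rule gradient_eqI[OF 1[OF assms(4)]])
  show "(\<lambda>y. a * f y + b * g y + c) differentiable (at x)"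
    using 1[OF assms(4)] by (auto simp: differentiable_def)
qed

lemma hessian_order_at_max:
  fixes f g :: "real^'n \<Rightarrow> real"
  assumes "twice_differentiable_on S f" "twice_differentiable_on S g" "open S" "x \<in> S"
    and max: "\<And>y. y \<in> S \<Longrightarrow> f y - g y \<le> f x - g x"
  shows "v \<bullet> (hessian f x *v v) \<le> v \<bullet> (hessian g x *v v)"
proof -
  have "twice_differentiable_on S (\<lambda>y. 1 * f y + (-1) * g y + 0)"
    unfolding twice_differentiable_on_def
    using lincomb_derivatives(3,4)[OF assms(1-3)] by blast
  then have "v \<bullet> (hessian (\<lambda>y. 1 * f y + (-1) * g y + 0) x *v v) \<le> 0"
    by (rule hessian_local_max[OF _ assms(3,4)]) (use max in auto)
  also have "hessian (\<lambda>y. 1 * f y + (-1) * g y + 0) x = hessian f x - hessian g x"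
    by (subst lincomb_derivatives(1)[OF assms(1-4)]) simp
  finally show ?thesis
    by (simp add: matrix_vector_mult_diff_rdistrib inner_diff_right)
qed

lemma mat_mult_vec: "mat k *v v = k *\<^sub>R (v :: real^'n)"
  by (simp add: vec_eq_iff mat_def matrix_vector_mult_def if_distrib if_distribR cong: if_cong)

definition outer :: "real^'n \<Rightarrow> real^'n^'n" where
  "outer g = (\<chi> i j. g $ i * g $ j)"

lemma outer_mult_vec: "outer g *v v = (g \<bullet> v) *\<^sub>R g"
  by (simp add: outer_def vec_eq_iff matrix_vector_mult_def inner_vec_def sum_distrib_left
      sum_distrib_right mult_ac)

lemma trace_outer: "trace (outer g) = g \<bullet> g"
  by (simp add: trace_def outer_def inner_vec_def)

text \<open>One computation for both barriers: b > 0 > c in the subsolution below the profile, b < 0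
  < c in the supersolution above the initial datum. The square of \<open>\<rho>\<close> supplies the
  second derivative in the normal direction.\<close>

lemma barrier_derivatives:
  fixes \<rho> :: "real^'n \<Rightarrow> real" and z :: "real^'n" and a b c :: real
  assumes tw: "twice_differentiable_on S \<rho>" and S: "open S"
  defines "\<psi> \<equiv> \<lambda>y. a * \<rho> y + b * (\<rho> y)\<^sup>2 + c * ((y - z) \<bullet> (y - z))"
  shows "twice_differentiable_on S \<psi>"
    and "x \<in> S \<Longrightarrow> hessian \<psi> x =
      (a + 2 * b * \<rho> x) *\<^sub>R hessian \<rho> x + (2 * b) *\<^sub>R outer (gradient \<rho> x) + mat (2 * c)"
proof -
  let ?G = "\<lambda>y. (a + 2 * b * \<rho> y) *\<^sub>R gradient \<rho> y + (2 * c) *\<^sub>R (y - z)"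
  have 1: "(\<psi> has_derivative (\<lambda>h. ?G y \<bullet> h)) (at y)" if "y \<in> S" for y
    unfolding \<psi>_def using twice_differentiable_onD(1)[OF tw that]
    by (auto intro!: derivative_eq_intros
        simp: fun_eq_iff inner_add_left inner_diff_left inner_diff_right inner_commute algebra_simps)
  have 2: "(?G has_derivative (\<lambda>h. ((a + 2 * b * \<rho> x) *\<^sub>R hessian \<rho> x +
      (2 * b) *\<^sub>R outer (gradient \<rho> x) + mat (2 * c)) *v h)) (at x)" if "x \<in> S" for x
  proof -
    show ?thesis
      using twice_differentiable_onD[OF tw that]
      by (auto intro!: derivative_eq_intros simp: fun_eq_iff matrix_vector_mult_add_rdistrib
          scaleR_matrix_vector_assoc[symmetric] outer_mult_vec mat_mult_vec algebra_simps)
  qed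
  show "twice_differentiable_on S \<psi>"
    unfolding twice_differentiable_on_def
    using hessian_eqI(2)[OF S _ 1 2] 1 by (auto simp: differentiable_def)
  show "x \<in> S \<Longrightarrow> hessian \<psi> x =
      (a + 2 * b * \<rho> x) *\<^sub>R hessian \<rho> x + (2 * b) *\<^sub>R outer (gradient \<rho> x) + mat (2 * c)"
    using hessian_eqI(1)[OF S _ 1 2] by blast
qed

subsection \<open>Parabolic comparison and self-similar solutions\<close>

lemma closure_minus_frontier:
  fixes S :: "'a::topological_space set"
  shows "open S \<Longrightarrow> x \<in> closure S \<Longrightarrow> x \<notin> frontier S \<Longrightarrow> x \<in> S"
  by (simp add: frontier_def interior_open)

lemma real_differentiableI:
  "(f has_real_derivative D) (at x) \<Longrightarrow> f differentiable (at x)"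
  by (auto simp: real_differentiable_def)

text \<open>At a positive interior maximum of u - v - e t the Hessians are ordered, so u_t <=
  S_k(D^2 u) <= S_k(D^2 v) <= v_t, whereas maximality in time demands u_t - v_t >= e.\<close>

lemma parabolic_comparison:
  fixes u v :: "real \<Rightarrow> real^'n \<Rightarrow> real"
  assumes \<Omega>: "open \<Omega>" "bounded \<Omega>"
    and cont: "continuous_on ({0..T} \<times> closure \<Omega>) (\<lambda>(t, x). u t x)"
      "continuous_on ({0..T} \<times> closure \<Omega>) (\<lambda>(t, x). v t x)"
    and tw: "\<And>t. 0 < t \<Longrightarrow> twice_differentiable_on \<Omega> (u t)"
      "\<And>t. 0 < t \<Longrightarrow> twice_differentiable_on \<Omega> (v t)"
    and diff: "\<And>t x. 0 < t \<Longrightarrow> x \<in> \<Omega> \<Longrightarrow> (\<lambda>s. u s x) differentiable (at t)"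
      "\<And>t x. 0 < t \<Longrightarrow> x \<in> \<Omega> \<Longrightarrow> (\<lambda>s. v s x) differentiable (at t)"
    and cone: "\<And>t x. 0 < t \<Longrightarrow> x \<in> \<Omega> \<Longrightarrow> eigenvalues (hessian (u t) x) \<in> garding_cone k"
    and sub: "\<And>t x. 0 < t \<Longrightarrow> x \<in> \<Omega> \<Longrightarrow> deriv (\<lambda>s. u s x) t \<le> hess_op k (u t) x"
    and super: "\<And>t x. 0 < t \<Longrightarrow> x \<in> \<Omega> \<Longrightarrow> hess_op k (v t) x \<le> deriv (\<lambda>s. v s x) t"
    and boundary: "\<And>t x. 0 \<le> t \<Longrightarrow> x \<in> frontier \<Omega> \<Longrightarrow> u t x \<le> v t x"
    and initial: "\<And>x. x \<in> closure \<Omega> \<Longrightarrow> u 0 x \<le> v 0 x"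
    and t: "0 \<le> t" "t \<le> T" and x: "x \<in> closure \<Omega>"
  shows "u t x \<le> v t x"
proof (rule ccontr)
  assume neg: "\<not> ?thesis"
  define m where "m = u t x - v t x"
  have m: "m > 0" using neg by (simp add: m_def)
  \<comment> \<open>Small enough that the penalty costs at most m/2, so the penalised maximum stays
    positive.\<close>
  define e where "e = m / (2 * (T + 1))"
  have e: "e > 0" using m t by (simp add: e_def)
  define w where "w p = (case p of (t, x) \<Rightarrow> u t x) - (case p of (t, x) \<Rightarrow> v t x) - e * fst p" for p
  let ?K = "{0..T} \<times> closure \<Omega>"
  have "compact ?K"
    using \<Omega>(2) by (intro compact_Times) auto
  moreover have "(t, x) \<in> ?K" using t x by auto
  moreover have "continuous_on ?K w"
    unfolding w_def by (intro continuous_intros cont)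
  ultimately obtain p where p: "p \<in> ?K" "\<And>q. q \<in> ?K \<Longrightarrow> w q \<le> w p"
    using continuous_attains_sup[of ?K w] by blast
  obtain t0 x0 where tx: "p = (t0, x0)" by fastforce
  have t0: "0 \<le> t0" "t0 \<le> T" and x0: "x0 \<in> closure \<Omega>" using p tx by auto
  have max: "u s y - v s y - e * s \<le> u t0 x0 - v t0 x0 - e * t0"
    if "0 \<le> s" "s \<le> T" "y \<in> closure \<Omega>" for s y
    using p(2)[of "(s, y)"] that unfolding w_def tx by simp
  have "e * t \<le> e * (T + 1)" using e t by simp
  also have "\<dots> = m / 2" using t by (simp add: e_def field_simps)
  finally have "m / 2 \<le> u t x - v t x - e * t" by (simp add: m_def)
  also have "\<dots> \<le> u t0 x0 - v t0 x0 - e * t0" using max t x by blast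
  finally have "m / 2 + e * t0 \<le> u t0 x0 - v t0 x0" by simp
  then have pos: "u t0 x0 > v t0 x0" using m e t0 mult_nonneg_nonneg[of e t0] by linarith
  have "t0 \<noteq> 0" using pos initial[OF x0] by auto
  then have t0': "t0 > 0" using t0 by simp
  have x0': "x0 \<in> \<Omega>" using closure_minus_frontier[OF \<Omega>(1) x0] boundary[OF t0(1)] pos by force
  have ord: "z \<bullet> (hessian (u t0) x0 *v z) \<le> z \<bullet> (hessian (v t0) x0 *v z)" for z
    by (rule hessian_order_at_max[OF tw(1)[OF t0'] tw(2)[OF t0'] \<Omega>(1) x0'])
      (use max[OF t0] closure_subset in fastforce)
  have S: "hess_op k (u t0) x0 \<le> hess_op k (v t0) x0"
    unfolding hess_op_def
    by (rule elem_sym_eigenvalues_mono(2)[OF hessian_symmetric[OF tw(1)[OF t0'] \<Omega>(1) x0']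
      hessian_symmetric[OF tw(2)[OF t0'] \<Omega>(1) x0'] ord cone[OF t0' x0']])
  let ?D = "deriv (\<lambda>s. u s x0) t0 - deriv (\<lambda>s. v s x0) t0 - e"
  have D: "((\<lambda>s. u s x0 - v s x0 - e * s) has_real_derivative ?D) (at t0)"
  proof -
    have 1: "((\<lambda>s. u s x0) has_real_derivative deriv (\<lambda>s. u s x0) t0) (at t0)"
      using diff(1)[OF t0' x0'] DERIV_deriv_iff_real_differentiable by blast
    have 2: "((\<lambda>s. v s x0) has_real_derivative deriv (\<lambda>s. v s x0) t0) (at t0)"
      using diff(2)[OF t0' x0'] DERIV_deriv_iff_real_differentiable by blast
    show ?thesis by (rule derivative_eq_intros 1 2 refl)+ simp
  qed
  \<comment> \<open>Only times before \<open>t0\<close> are compared, so \<open>t0 = T\<close> is no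
    exception.\<close>
  have "?D \<ge> 0"
  proof (rule ccontr)
    assume "\<not> ?D \<ge> 0"
    then have "?D < 0" by simp
    from DERIV_neg_dec_left[OF D this] obtain d where d: "d > 0"
      "\<And>h. h > 0 \<Longrightarrow> h < d \<Longrightarrow> u t0 x0 - v t0 x0 - e * t0
        < u (t0 - h) x0 - v (t0 - h) x0 - e * (t0 - h)" by blast
    define h where "h = min d t0 / 2"
    have "h > 0" "h < d" "h < t0" using d(1) t0' by (auto simp: h_def)
    with d(2)[of h] max[of "t0 - h" x0] t0 x0 show False by force
  qed
  with sub[OF t0' x0'] super[OF t0' x0'] S e show False by linarith
qed

lemma admissible_garding_cone:
  assumes "u \<in> admissible k \<Omega>" "x \<in> \<Omega>" "j \<le> k"
  shows "eigenvalues (hessian u x) \<in> garding_cone j"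
  using assms by (auto simp: admissible_def garding_cone_def)

lemma admissible_twice_differentiable_on: "u \<in> admissible k \<Omega> \<Longrightarrow> twice_differentiable_on \<Omega> u"
  by (simp add: admissible_def C2_on_imp_twice_differentiable_on)

text \<open>Constants change neither the equation nor the cone, and both flows vanish on the
  boundary, so there the comparison reduces to \<open>c \<le> d\<close>. These constants provide the
  slack used for initial data near the boundary.\<close>

lemma hessian_flow_comparison:
  assumes \<Omega>: "open \<Omega>" "bounded \<Omega>" and u: "hessian_flow k \<Omega> u" and v: "hessian_flow k \<Omega> v"
    and c: "\<And>x. x \<in> frontier \<Omega> \<Longrightarrow> c \<le> d"
    and initial: "\<And>x. x \<in> closure \<Omega> \<Longrightarrow> u 0 x + c \<le> v 0 x + d"
    and t: "0 \<le> t" and x: "x \<in> closure \<Omega>"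
  shows "u t x + c \<le> v t x + d"
proof -
  have shift: "continuous_on ({0..t} \<times> closure \<Omega>) (\<lambda>(t, x). w t x + a) \<and>
      (\<forall>s>0. twice_differentiable_on \<Omega> (\<lambda>x. w s x + a) \<and>
        (\<forall>x\<in>\<Omega>.
          (\<lambda>s. w s x + a) differentiable (at s) \<and>
          deriv (\<lambda>s. w s x + a) s = hess_op k (\<lambda>x. w s x + a) x \<and>
          eigenvalues (hessian (\<lambda>x. w s x + a) x) \<in> garding_cone k)) \<and>
      (\<forall>s\<ge>0. \<forall>x\<in>frontier \<Omega>. w s x = 0)"
    if w: "hessian_flow k \<Omega> w" for w a
  proof -
    have 1: "continuous_on ({0..t} \<times> closure \<Omega>) (\<lambda>(t, x). w t x + a)"
    proof -
      have "continuous_on ({0..t} \<times> closure \<Omega>) (\<lambda>(t, x). w t x)"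
        using w unfolding hessian_flow_def by (auto elim!: continuous_on_subset)
      then show ?thesis
        by (simp add: case_prod_unfold continuous_on_add)
    qed
    have 2: "twice_differentiable_on \<Omega> (w s)" if "s > 0" for s
      using w that unfolding hessian_flow_def C12_on_def by (auto intro: C2_on_imp_twice_differentiable_on)
    have 3: "twice_differentiable_on \<Omega> (\<lambda>x. w s x + a)" if "s > 0" for s
      using lincomb_derivatives(3,4)[OF 2[OF that] 2[OF that] \<Omega>(1), of _ 1 0 a]
      unfolding twice_differentiable_on_def by simp
    have 4: "hessian (\<lambda>x. w s x + a) x = hessian (w s) x" if "s > 0" "x \<in> \<Omega>" for s x
      using lincomb_derivatives(1)[OF 2[OF that(1)] 2[OF that(1)] \<Omega>(1) that(2), of 1 0 a] by simp
    have 5: "((\<lambda>s. w s x + a) has_real_derivative deriv (\<lambda>s. w s x) s) (at s)" if "s > 0" "x \<in> \<Omega>" for s x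
    proof -
      have "(\<lambda>s. w s x) differentiable (at s)"
        using w that unfolding hessian_flow_def C12_on_def by auto
      then have "((\<lambda>s. w s x) has_real_derivative deriv (\<lambda>s. w s x) s) (at s)"
        using DERIV_deriv_iff_real_differentiable by blast
      then show ?thesis by (auto intro!: derivative_eq_intros)
    qed
    have 6: "deriv (\<lambda>s. w s x) s = hess_op k (w s) x" if "s > 0" "x \<in> \<Omega>" for s x
      using w that unfolding hessian_flow_def by auto
    have 7: "eigenvalues (hessian (w s) x) \<in> garding_cone k" if "s > 0" "x \<in> \<Omega>" for s x
      using w that admissible_garding_cone[of "w s" k \<Omega> x k] unfolding hessian_flow_def by auto
    have 8: "\<forall>s\<ge>0. \<forall>x\<in>frontier \<Omega>. w s x = 0"
      using w unfolding hessian_flow_def by auto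
    show ?thesis
      using 1 3 4 7 8 DERIV_imp_deriv[OF 5] 6 5[THEN real_differentiableI]
      by (simp add: hess_op_def)
  qed
  show ?thesis
    by (rule parabolic_comparison[where u = "\<lambda>t x. u t x + c" and v = "\<lambda>t x. v t x + d" and T = t and k = k, OF \<Omega>])
      (use shift[OF u, of c] shift[OF v, of d] c initial t x in auto)
qed

lemma hessian_flow_unique:
  assumes "open \<Omega>" "bounded \<Omega>" "hessian_flow k \<Omega> u" "hessian_flow k \<Omega> v"
    and "\<And>x. x \<in> closure \<Omega> \<Longrightarrow> u 0 x = v 0 x" "0 \<le> t" "x \<in> closure \<Omega>"
  shows "u t x = v t x"
  using hessian_flow_comparison[OF assms(1,2,3,4), of 0 0 t x]
    hessian_flow_comparison[OF assms(1,2,4,3), of 0 0 t x] assms(5-)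
  by force

section \<open>Self-similar solutions, two-sided bounds and the rate\<close>

lemma profile_facts:
  assumes "profile k \<Omega> \<theta>" "open \<Omega>"
  shows "twice_differentiable_on \<Omega> \<theta>" "continuous_on (closure \<Omega>) \<theta>" "C2_on \<Omega> \<theta>"
    and "\<And>x. x \<in> frontier \<Omega> \<Longrightarrow> \<theta> x = 0" "\<And>x. x \<in> \<Omega> \<Longrightarrow> \<theta> x < 0"
    and "\<And>x. x \<in> closure \<Omega> \<Longrightarrow> \<theta> x \<le> 0"
    and "\<And>x. x \<in> \<Omega> \<Longrightarrow> hess_op k \<theta> x = - (1 / (real k - 1)) * \<theta> x"
    and "\<And>x. x \<in> \<Omega> \<Longrightarrow> eigenvalues (hessian \<theta> x) \<in> garding_cone k"
proof -
  have "\<theta> \<in> admissible k \<Omega>" using assms by (auto simp: profile_def admissible0_def)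
  then show "twice_differentiable_on \<Omega> \<theta>" "continuous_on (closure \<Omega>) \<theta>" "C2_on \<Omega> \<theta>"
    "\<And>x. x \<in> \<Omega> \<Longrightarrow> eigenvalues (hessian \<theta> x) \<in> garding_cone k"
    by (auto intro: admissible_twice_differentiable_on admissible_garding_cone simp: admissible_def)
  show "\<And>x. x \<in> frontier \<Omega> \<Longrightarrow> \<theta> x = 0" and neg: "\<And>x. x \<in> \<Omega> \<Longrightarrow> \<theta> x < 0"
    and "\<And>x. x \<in> \<Omega> \<Longrightarrow> hess_op k \<theta> x = - (1 / (real k - 1)) * \<theta> x"
    using assms by (auto simp: profile_def admissible0_def)
  then show "\<And>x. x \<in> closure \<Omega> \<Longrightarrow> \<theta> x \<le> 0"
    using closure_minus_frontier[OF assms(2)] by (metis order.refl less_imp_le)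
qed

text \<open>Separation of variables: the time factor solves c' = -p c^k with p = 1/(k-1), and p is
  exactly the constant in the equation of the profile.\<close>

lemma selfsimilar_flow:
  fixes \<Omega> :: "(real^'n) set"
  assumes \<Omega>: "open \<Omega>" and k: "k \<ge> 2" and \<theta>: "profile k \<Omega> \<theta>" and s: "s > 0"
  shows "hessian_flow k \<Omega> (\<lambda>t x. (s + t) powr (- (1 / (real k - 1))) * \<theta> x)"
proof -
  define p where "p = 1 / (real k - 1)"
  define c where "c t = (s + t) powr (- p)" for t
  define c' where "c' t = - p * (s + t) powr (- p - 1)" for t
  have p: "p * (real k - 1) = 1" using k by (simp add: p_def)
  note P = profile_facts[OF \<theta> \<Omega>]
  have grad: "gradient (\<lambda>x. a * \<theta> x) x = a *\<^sub>R gradient \<theta> x"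
    and hess: "hessian (\<lambda>x. a * \<theta> x) x = a *\<^sub>R hessian \<theta> x"
    and dif: "(\<lambda>x. a * \<theta> x) differentiable (at x)" "gradient (\<lambda>x. a * \<theta> x) differentiable (at x)"
    if "x \<in> \<Omega>" for a x
    using lincomb_derivatives[OF P(1) P(1) \<Omega> that, of a 0 0] by simp_all
  have cpos: "c t > 0" if "t \<ge> 0" for t using s that by (simp add: c_def)
  have cD: "((\<lambda>t. c t * \<theta> x) has_real_derivative c' t * \<theta> x) (at t)" if "t \<ge> 0" for t x
    unfolding c_def c'_def using s that
    by (auto intro!: derivative_eq_intros simp: powr_diff)
  have ch: "continuous_on \<Omega> (hessian \<theta>)" using P(3) by (simp add: C2_on_def)
  have cg: "continuous_on \<Omega> (gradient \<theta>)"
    using P(1) \<Omega> unfolding twice_differentiable_on_def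
    by (simp add: continuous_on_eq_continuous_at differentiable_imp_continuous_within)
  have c\<theta>: "continuous_on \<Omega> \<theta>"
    using P(2) closure_subset by (rule continuous_on_subset)
  have C2: "C2_on \<Omega> (\<lambda>x. a * \<theta> x)" for a
    unfolding C2_on_def using dif hess
    by (auto intro!: continuous_intros ch cong: continuous_on_cong)
  have S: "elem_sym j (eigenvalues (hessian (\<lambda>x. a * \<theta> x) x)) = a ^ j * elem_sym j (eigenvalues (hessian \<theta> x))"
    if "x \<in> \<Omega>" for a x j
    unfolding hess[OF that] by (rule elem_sym_eigenvalues_scaleR[OF hessian_symmetric[OF P(1) \<Omega> that]])
  have eq: "deriv (\<lambda>r. c r * \<theta> x) t = hess_op k (\<lambda>x. c t * \<theta> x) x" if t: "t > 0" and x: "x \<in> \<Omega>" for t x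
  proof -
    have "c t ^ k = (s + t) powr (- p * real k)"
      using s t by (simp add: c_def powr_powr powr_realpow[symmetric] mult.commute)
    \<comment> \<open>Here the exponent is used: p (k - 1) = 1 makes the k-th power of c agree with
      its time derivative up to the factor -p.\<close>
    also have "- p * real k = - p - 1" using p by (simp add: algebra_simps)
    finally have "c t ^ k = (s + t) powr (- p - 1)" .
    then have "hess_op k (\<lambda>x. c t * \<theta> x) x = c' t * \<theta> x"
      using P(7)[OF x] S[OF x, of k "c t"] by (simp add: hess_op_def c'_def p_def)
    moreover have "deriv (\<lambda>r. c r * \<theta> x) t = c' t * \<theta> x"
      using cD[of t x] t by (simp add: DERIV_imp_deriv)
    ultimately show ?thesis by simp
  qed
  have adm: "(\<lambda>x. c t * \<theta> x) \<in> admissible k \<Omega>" if "t \<ge> 0" for t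
    unfolding admissible_def
  proof (intro CollectI conjI ballI)
    show "continuous_on (closure \<Omega>) (\<lambda>x. c t * \<theta> x)"
      by (intro continuous_intros P(2))
    fix j x assume "j \<in> {1..k}" "x \<in> \<Omega>"
    then show "elem_sym j (eigenvalues (hessian (\<lambda>x. c t * \<theta> x) x)) > 0"
      using garding_coneD[OF P(8)[of x], of j] cpos[OF that] by (simp add: S)
  qed (rule C2)
  have snd_cont: "continuous_on (A \<times> \<Omega>) (\<lambda>q. f (snd q))" if "continuous_on \<Omega> f"
    for A :: "real set" and f :: "real^'n \<Rightarrow> 'b::topological_space"
    by (rule continuous_on_compose2[OF that]) (auto intro!: continuous_intros)
  have ccont: "continuous_on ({0<..} \<times> B) (\<lambda>q. c (fst q))" "continuous_on ({0<..} \<times> B) (\<lambda>q. c' (fst q))"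
    for B :: "(real^'n) set"
    unfolding c_def c'_def using s by (auto intro!: continuous_intros)
  have C12: "C12_on \<Omega> (\<lambda>t x. c t * \<theta> x)"
    unfolding C12_on_def
  proof (intro conjI allI impI ballI)
    show "(\<lambda>t. c t * \<theta> x) differentiable (at t)" if "t > 0" for t x
      by (rule real_differentiableI[OF cD]) (use that in simp)
    have "continuous_on ({0<..} \<times> \<Omega>) (\<lambda>q. c' (fst q) * \<theta> (snd q))"
      by (intro continuous_intros ccont snd_cont c\<theta>)
    then show "continuous_on ({0<..} \<times> \<Omega>) (\<lambda>(t, x). deriv (\<lambda>t. c t * \<theta> x) t)"
      by (rule continuous_on_eq) (auto simp: DERIV_imp_deriv[OF cD])
    have "continuous_on ({0<..} \<times> \<Omega>) (\<lambda>q. c (fst q) *\<^sub>R gradient \<theta> (snd q))"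
      by (intro continuous_intros ccont snd_cont cg)
    then show "continuous_on ({0<..} \<times> \<Omega>) (\<lambda>(t, x). gradient (\<lambda>x. c t * \<theta> x) x)"
      by (rule continuous_on_eq) (auto simp: grad)
    have "continuous_on ({0<..} \<times> \<Omega>) (\<lambda>q. c (fst q) *\<^sub>R hessian \<theta> (snd q))"
      by (intro continuous_intros ccont snd_cont ch)
    then show "continuous_on ({0<..} \<times> \<Omega>) (\<lambda>(t, x). hessian (\<lambda>x. c t * \<theta> x) x)"
      by (rule continuous_on_eq) (auto simp: hess)
  qed (rule C2)
  have "continuous_on ({0..} \<times> closure \<Omega>) (\<lambda>q. c (fst q) * \<theta> (snd q))"
  proof (intro continuous_intros)
    show "continuous_on ({0..} \<times> closure \<Omega>) (\<lambda>q. c (fst q))"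
      unfolding c_def using s by (auto intro!: continuous_intros)
    show "continuous_on ({0..} \<times> closure \<Omega>) (\<lambda>q. \<theta> (snd q))"
      by (rule continuous_on_compose2[OF P(2)]) (auto intro!: continuous_intros)
  qed
  then have "hessian_flow k \<Omega> (\<lambda>t x. c t * \<theta> x)"
    unfolding hessian_flow_def using C12 eq adm P(4) by (auto simp: case_prod_unfold)
  then show ?thesis by (simp add: c_def p_def)
qed

lemma compact_closure_bounds:
  fixes f :: "'a::heine_borel \<Rightarrow> real"
  assumes "bounded S" "continuous_on (closure S) f"
  obtains M where "M > 0" "\<And>x. x \<in> closure S \<Longrightarrow> \<bar>f x\<bar> \<le> M"
proof -
  have "bounded (f ` closure S)"
    using assms by (intro compact_imp_bounded compact_continuous_image) auto
  then show thesis using that unfolding bounded_pos by auto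
qed

lemma hessian_flow_lower_bound:
  fixes \<Omega> :: "(real^'n) set"
  assumes \<Omega>: "open \<Omega>" "bounded \<Omega>" and k: "k \<ge> 2" and \<theta>: "profile k \<Omega> \<theta>"
    and u: "hessian_flow k \<Omega> u" and t: "t > 0" and x: "x \<in> closure \<Omega>"
  shows "t powr (- (1 / (real k - 1))) * \<theta> x \<le> u t x"
proof (rule field_le_epsilon)
  fix e :: real assume e: "e > 0"
  let ?p = "1 / (real k - 1)"
  note P = profile_facts[OF \<theta> \<Omega>(1)]
  have cu: "continuous_on (closure \<Omega>) (u 0)"
    using u by (auto simp: hessian_flow_def admissible_def)
  obtain M where M: "M > 0" "\<And>x. x \<in> closure \<Omega> \<Longrightarrow> \<bar>u 0 x\<bar> \<le> M"
    using compact_closure_bounds[OF \<Omega>(2) cu] by blast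
  \<comment> \<open>Zero boundary values make this set a compact subset of the open domain, where
    the profile stays below some -h < 0.\<close>
  define K where "K = {x \<in> closure \<Omega>. u 0 x \<le> - e}"
  have "compact K"
    unfolding K_def using \<Omega>(2) continuous_closed_preimage[OF cu closed_closure, of "{..- e}"]
    by (auto simp: compact_eq_bounded_closed vimage_def Int_def intro: bounded_subset)
  have "K \<subseteq> \<Omega>"
  proof
    fix y assume "y \<in> K"
    then have "y \<notin> frontier \<Omega>" "y \<in> closure \<Omega>"
      using u e by (auto simp: K_def hessian_flow_def)
    then show "y \<in> \<Omega>" using closure_minus_frontier[OF \<Omega>(1)] by blast
  qed
  obtain h where h: "h > 0" "\<And>y. y \<in> K \<Longrightarrow> \<theta> y \<le> - h"
  proof (cases "K = {}")
    case False
    have "continuous_on K \<theta>"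
      using P(2) by (rule continuous_on_subset) (auto simp: K_def)
    then obtain z where "z \<in> K" "\<And>y. y \<in> K \<Longrightarrow> \<theta> y \<le> \<theta> z"
      using continuous_attains_sup[OF \<open>compact K\<close> False] by blast
    then show thesis
      using that[of "- \<theta> z"] P(5)[of z] \<open>K \<subseteq> \<Omega>\<close> by auto
  qed (use that[of 1] in auto)
  \<comment> \<open>Chosen so that the initial factor is M/h: on \<open>K\<close> the self-similar
    solution starts below -M, and off \<open>K\<close> the shift by -e suffices because the profile
    is nonpositive.\<close>
  define s where "s = (M / h) powr (- (real k - 1))"
  have s: "s > 0" using M h by (simp add: s_def)
  have sp: "s powr (- ?p) = M / h"
  proof -
    have "- (real k - 1) * - ?p = 1" using k by (simp add: field_simps)
    then show ?thesis unfolding s_def powr_powr using M h by simp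
  qed
  let ?v = "\<lambda>t x. (s + t) powr (- ?p) * \<theta> x"
  have "?v t x + (- e) \<le> u t x + 0"
  proof (rule hessian_flow_comparison[OF \<Omega> selfsimilar_flow[OF \<Omega>(1) k \<theta> s] u])
    fix y assume y: "y \<in> closure \<Omega>"
    show "?v 0 y + (- e) \<le> u 0 y + 0"
    proof (cases "y \<in> K")
      case True
      have "M / h * \<theta> y \<le> M / h * (- h)"
        using h(2)[OF True] M h by (intro mult_left_mono) auto
      then show ?thesis using M(2)[OF y] h e by (simp add: sp)
    next
      case False
      have "M / h * \<theta> y \<le> 0"
        using P(6)[OF y] M(1) h(1) by (intro mult_nonneg_nonpos) auto
      then show ?thesis using False y by (simp add: sp K_def)
    qed
  qed (use e t x in auto)
  \<comment> \<open>As the profile is nonpositive, s > 0 only strengthens the bound, so the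
    dependence of s on e disappears.\<close>
  moreover have "t powr (- ?p) * \<theta> x \<le> ?v t x"
    using P(6)[OF x] s t k by (intro mult_right_mono_neg powr_mono2') auto
  ultimately show "t powr (- ?p) * \<theta> x \<le> u t x + e" by simp
qed

text \<open>The lower bound is applied to the self-similar flow of the second profile.
  Multiplication by t^p leaves the ratio (t/(1+t))^p, which tends to 1.\<close>

lemma profile_le:
  fixes \<Omega> :: "(real^'n) set"
  assumes \<Omega>: "open \<Omega>" "bounded \<Omega>" and k: "k \<ge> 2"
    and \<theta>: "profile k \<Omega> \<theta>" "profile k \<Omega> \<theta>'" and x: "x \<in> closure \<Omega>"
  shows "\<theta> x \<le> \<theta>' x"
proof (rule ccontr)
  assume "\<not> ?thesis"
  then have d: "\<theta> x - \<theta>' x > 0" by simp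
  let ?p = "1 / (real k - 1)"
  have neg: "\<theta>' x \<le> 0" by (rule profile_facts(6)[OF \<theta>(2) \<Omega>(1) x])
  have *: "t * (\<theta> x - \<theta>' x) \<le> - \<theta>' x" if t: "t > 0" for t
  proof -
    have "t powr (- ?p) * \<theta> x \<le> (1 + t) powr (- ?p) * \<theta>' x"
      by (rule hessian_flow_lower_bound[OF \<Omega> k \<theta>(1) selfsimilar_flow[OF \<Omega>(1) k \<theta>(2)] t x]) simp
    then have "t powr ?p * (t powr (- ?p) * \<theta> x) \<le> t powr ?p * ((1 + t) powr (- ?p) * \<theta>' x)"
      by (intro mult_left_mono) auto
    then have "\<theta> x \<le> (t / (1 + t)) powr ?p * \<theta>' x"
      using t by (simp add: powr_divide powr_minus field_simps)
    \<comment> \<open>Since p <= 1 and the base is at most 1, exponent 1 gives the smaller power;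
      multiplied by a nonpositive value it gives the larger product, now rational in t.\<close>
    also have "\<dots> \<le> (t / (1 + t)) powr 1 * \<theta>' x"
      using t k neg by (intro mult_right_mono_neg powr_mono') auto
    finally have "\<theta> x \<le> t / (1 + t) * \<theta>' x" using t by simp
    then have "\<theta> x * (1 + t) \<le> t * \<theta>' x"
      using t by (simp add: field_simps)
    then have "t * (\<theta> x - \<theta>' x) \<le> - \<theta> x" by (simp add: algebra_simps)
    then show ?thesis using d by simp
  qed
  define t where "t = (- \<theta>' x + 1) / (\<theta> x - \<theta>' x)"
  have "t > 0" using d neg by (simp add: t_def)
  from *[OF this] d show False by (simp add: t_def)
qed

lemma profile_unique:
  assumes "open \<Omega>" "bounded \<Omega>" "k \<ge> 2" "profile k \<Omega> \<theta>" "profile k \<Omega> \<theta>'" "x \<in> closure \<Omega>"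
  shows "\<theta> x = \<theta>' x"
  using profile_le[OF assms(1-3)] assms(4-6) by (meson order_antisym)

lemma hessian_flow_upper_bound:
  fixes \<Omega> :: "(real^'n) set"
  assumes \<Omega>: "open \<Omega>" "bounded \<Omega>" and k: "k \<ge> 2" and \<theta>: "profile k \<Omega> \<theta>"
    and u: "hessian_flow k \<Omega> u" and a: "a > 0" "\<And>x. x \<in> closure \<Omega> \<Longrightarrow> u 0 x \<le> a * \<theta> x"
  obtains s where "s \<ge> 1"
    "\<And>t x. t \<ge> 0 \<Longrightarrow> x \<in> closure \<Omega> \<Longrightarrow> u t x \<le> (s + t) powr (- (1 / (real k - 1))) * \<theta> x"
proof -
  let ?p = "1 / (real k - 1)"
  \<comment> \<open>The power of a solves s^(-p) = a; s >= 1 will keep (1+t)/(s+t) at most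
    1.\<close>
  define s where "s = max 1 (a powr (- (real k - 1)))"
  have s: "s \<ge> 1" by (simp add: s_def)
  have "s powr (- ?p) \<le> (a powr (- (real k - 1))) powr (- ?p)"
    using a k by (intro powr_mono2') (auto simp: s_def)
  also have "\<dots> = a"
  proof -
    have "- (real k - 1) * - ?p = 1" using k by (simp add: field_simps)
    then show ?thesis unfolding powr_powr using a(1) by simp
  qed
  finally have sp: "s powr (- ?p) \<le> a" .
  have "u t x + 0 \<le> (s + t) powr (- ?p) * \<theta> x + 0" if t: "t \<ge> 0" and x: "x \<in> closure \<Omega>" for t x
  proof (rule hessian_flow_comparison[OF \<Omega> u selfsimilar_flow[OF \<Omega>(1) k \<theta>]])
    fix y assume y: "y \<in> closure \<Omega>"
    have "a * \<theta> y \<le> s powr (- ?p) * \<theta> y"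
      using sp profile_facts(6)[OF \<theta> \<Omega>(1) y] by (rule mult_right_mono_neg)
    with a(2)[OF y] show "u 0 y + 0 \<le> (s + 0) powr (- ?p) * \<theta> y + 0" by simp
  qed (use s t x in auto)
  with s that show thesis by auto
qed

lemma deviation_bound:
  fixes \<Omega> :: "(real^'n) set"
  assumes \<Omega>: "open \<Omega>" "bounded \<Omega>" "\<Omega> \<noteq> {}" and k: "k \<ge> 2" and \<theta>: "profile k \<Omega> \<theta>"
    and u: "hessian_flow k \<Omega> u" and a: "a > 0" "\<And>x. x \<in> closure \<Omega> \<Longrightarrow> u 0 x \<le> a * \<theta> x"
  obtains C where "C > 0" "\<And>t. t \<ge> 0 \<Longrightarrow> deviation k \<Omega> \<theta> u t \<le> C * inverse (1 + t)"
proof -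
  define p where "p = 1 / (real k - 1)"
  have p: "0 < p" "p \<le> 1" using k by (simp_all add: p_def)
  note P = profile_facts[OF \<theta> \<Omega>(1)]
  obtain s where s: "s \<ge> 1"
    and upper: "\<And>t x. t \<ge> 0 \<Longrightarrow> x \<in> closure \<Omega> \<Longrightarrow> u t x \<le> (s + t) powr (- p) * \<theta> x"
    using hessian_flow_upper_bound[OF \<Omega>(1,2) k \<theta> u a] unfolding p_def by blast
  have lower: "t powr (- p) * \<theta> x \<le> u t x" if "t > 0" "x \<in> closure \<Omega>" for t x
    using hessian_flow_lower_bound[OF \<Omega>(1,2) k \<theta> u that] by (simp add: p_def)
  obtain M where M: "M > 0" "\<And>x. x \<in> closure \<Omega> \<Longrightarrow> \<bar>\<theta> x\<bar> \<le> M"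
    using compact_closure_bounds[OF \<Omega>(2) P(2)] by blast
  have "continuous_on ({0..1} \<times> closure \<Omega>) (\<lambda>(t, x). u t x)"
    using u unfolding hessian_flow_def by (auto elim!: continuous_on_subset)
  then have "bounded ((\<lambda>(t, x). u t x) ` ({0..1} \<times> closure \<Omega>))"
    using \<Omega>(2) by (intro compact_imp_bounded compact_continuous_image compact_Times) auto
  then obtain N where N: "N > 0" "\<And>t x. t \<in> {0..1} \<Longrightarrow> x \<in> closure \<Omega> \<Longrightarrow> \<bar>u t x\<bar> \<le> N"
    unfolding bounded_pos by force
  \<comment> \<open>For t > 1 the upper bound costs s M and the lower one 2 M, because 1/t <=
    2/(1+t). For t <= 1 the crude bound 2 N + M is half of 4 N + 2 M, and 1/2 <= 1/(1+t).\<close>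
  define C where "C = 2 * M + s * M + 4 * N"
  have C: "C > 0" using M N s by (simp add: C_def add_pos_pos)
  have "\<bar>(1 + t) powr p * u t x - \<theta> x\<bar> \<le> C * inverse (1 + t)" if t: "t \<ge> 0" and x: "x \<in> \<Omega>" for t x
  proof -
    have xc: "x \<in> closure \<Omega>" using x closure_subset by blast
    have \<theta>x: "\<theta> x < 0" "- \<theta> x \<le> M" using P(5)[OF x] M(2)[OF xc] by auto
    show ?thesis
    \<comment> \<open>The lower bound t^(-p) theta is singular at t = 0, so small times are handled
      by boundedness of u.\<close>
    proof (cases "t \<le> 1")
      case True
      have "(1 + t) powr p \<le> (1 + t) powr 1"
        using t p by (intro powr_mono) auto
      also have "\<dots> \<le> 2" using True t by simp
      finally have "(1 + t) powr p * \<bar>u t x\<bar> \<le> 2 * N"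
        using N(2)[of t x] True t xc by (intro mult_mono) auto
      then have "\<bar>(1 + t) powr p * u t x - \<theta> x\<bar> \<le> 2 * N + M"
        using \<theta>x by (intro order_trans[OF abs_triangle_ineq4] add_mono) (auto simp: abs_mult)
      also have "\<dots> = (C - s * M) * (1 / 2)" by (simp add: C_def)
      also have "\<dots> \<le> C * inverse (1 + t)"
        using True t M N s C by (intro mult_mono) (auto simp: C_def field_simps)
      finally show ?thesis .
    next
      case False
      then have t1: "t > 1" by simp
      have "(1 + t) powr p * u t x - \<theta> x \<le> M * s * inverse (1 + t)"
      proof -
        have "(1 + t) powr p * u t x \<le> (1 + t) powr p * ((s + t) powr (- p) * \<theta> x)"
          using upper[OF t xc] by (intro mult_left_mono) auto
        also have "\<dots> = ((1 + t) / (s + t)) powr p * \<theta> x"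
          using t s by (simp add: powr_divide powr_minus field_simps)
        also have "\<dots> \<le> ((1 + t) / (s + t)) powr 1 * \<theta> x"
          using t s p \<theta>x by (intro mult_right_mono_neg powr_mono') auto
        also have "((1 + t) / (s + t)) powr 1 = (1 + t) / (s + t)"
          using t s by simp
        finally have "(1 + t) powr p * u t x - \<theta> x \<le> (1 + t) / (s + t) * \<theta> x - \<theta> x"
          by simp
        also have "\<dots> = (- \<theta> x) * (1 - (1 + t) / (s + t))"
          unfolding right_diff_distrib by simp
        also have "1 - (1 + t) / (s + t) = (s - 1) / (s + t)"
          using t s by (simp add: field_simps)
        also have "(- \<theta> x) * ((s - 1) / (s + t)) \<le> M * (s / (1 + t))"
          using t s \<theta>x by (intro mult_mono frac_le) auto
        finally show ?thesis by (simp add: divide_inverse)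
      qed
      moreover have "- (2 * M * inverse (1 + t)) \<le> (1 + t) powr p * u t x - \<theta> x"
      proof -
        \<comment> \<open>Replacing the exponent p <= 1 by 1 linearises the error; the negative
          profile reverses the inequality.\<close>
        have "(1 + 1 / t) powr 1 * \<theta> x \<le> (1 + 1 / t) powr p * \<theta> x"
          using t1 p \<theta>x by (intro mult_right_mono_neg powr_mono) auto
        also have "\<dots> = (1 + t) powr p * (t powr (- p) * \<theta> x)"
        proof -
          have "1 + 1 / t = (1 + t) / t" using t1 by (simp add: field_simps)
          then show ?thesis using t1 by (simp add: powr_divide powr_minus field_simps)
        qed
        also have "\<dots> \<le> (1 + t) powr p * u t x"
          using lower[of t x] t1 xc by (intro mult_left_mono) auto
        finally have "\<theta> x * (1 / t) \<le> (1 + t) powr p * u t x - \<theta> x"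
          using t1 by (simp add: algebra_simps)
        moreover have "- \<theta> x * (1 / t) \<le> M * (2 * inverse (1 + t))"
          using t1 \<theta>x by (intro mult_mono) (auto simp: field_simps)
        ultimately show ?thesis by simp
      qed
      moreover have "M * s * inverse (1 + t) \<le> C * inverse (1 + t)"
        "2 * M * inverse (1 + t) \<le> C * inverse (1 + t)"
        using t M N s by (auto intro!: mult_right_mono simp: C_def)
      ultimately show ?thesis by linarith
    qed
  qed
  then have "deviation k \<Omega> \<theta> u t \<le> C * inverse (1 + t)" if "t \<ge> 0" for t
    unfolding deviation_def p_def[symmetric] using that \<Omega>(3) by (intro cSUP_least) auto
  with C that show thesis by blast
qed

text \<open>The shift 1 would reproduce the profile with deviation 0. With shift 2 the rescaled
  error is (1 - r) times the absolute value of the profile, where r = ((1+t)/(2+t))^p.\<close>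

lemma selfsimilar_deviation_not_smallo:
  fixes \<Omega> :: "(real^'n) set"
  assumes \<Omega>: "open \<Omega>" "bounded \<Omega>" "\<Omega> \<noteq> {}" and k: "k \<ge> 2" and \<theta>: "profile k \<Omega> \<theta>"
  shows "deviation k \<Omega> \<theta> (\<lambda>t x. (2 + t) powr (- (1 / (real k - 1))) * \<theta> x) \<notin> o[at_top](\<lambda>t. inverse (1 + t))"
proof
  define p where "p = 1 / (real k - 1)"
  have p: "0 < p" "p \<le> 1" using k by (simp_all add: p_def)
  let ?u = "\<lambda>t x. (2 + t) powr (- (1 / (real k - 1))) * \<theta> x"
  note P = profile_facts[OF \<theta> \<Omega>(1)]
  obtain x where x: "x \<in> \<Omega>" using \<Omega>(3) by blast
  obtain M where M: "M > 0" "\<And>x. x \<in> closure \<Omega> \<Longrightarrow> \<bar>\<theta> x\<bar> \<le> M"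
    using compact_closure_bounds[OF \<Omega>(2) P(2)] by blast
  have lower: "p * (- \<theta> x) / 4 * inverse (1 + t) \<le> deviation k \<Omega> \<theta> ?u t" if t: "t \<ge> 0" for t
  proof -
    define r where "r = ((1 + t) / (2 + t)) powr p"
    have r: "(1 + t) powr p * ((2 + t) powr (- p) * \<theta> y) - \<theta> y = (1 - r) * (- \<theta> y)" for y
      using t by (simp add: r_def powr_divide powr_minus field_simps)
    \<comment> \<open>From ln y <= y - 1 one gets r <= exp(-z) <= 1/(1+z), hence 1 - r >= z/2;
      finally 2 + t <= 2 (1 + t).\<close>
    define z where "z = p / (2 + t)"
    have z: "0 < z" "z \<le> 1" using p t by (simp_all add: z_def)
    have "ln ((1 + t) / (2 + t)) \<le> (1 + t) / (2 + t) - 1"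
      using t by (intro ln_le_minus_one) auto
    also have "\<dots> = - (1 / (2 + t))" using t by (simp add: field_simps)
    finally have "p * ln ((1 + t) / (2 + t)) \<le> p * - (1 / (2 + t))"
      using p by (intro mult_left_mono) auto
    then have "r \<le> exp (- z)"
      using t by (simp add: r_def powr_def z_def)
    also have "\<dots> \<le> inverse (1 + z)"
      unfolding exp_minus using z exp_ge_add_one_self[of z] by (intro le_imp_inverse_le) auto
    finally have "1 - r \<ge> z / (1 + z)" using z by (simp add: field_simps)
    moreover have "z / (1 + z) \<ge> z / 2" using z by (intro divide_left_mono) auto
    moreover have "z / 2 \<ge> p / 4 * inverse (1 + t)" using p t by (simp add: z_def field_simps)
    ultimately have r1: "p / 4 * inverse (1 + t) \<le> 1 - r" by simp
    have r0: "\<bar>1 - r\<bar> \<le> 1"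
    proof -
      have "r \<le> 1 powr p" unfolding r_def using t p by (intro powr_mono2) auto
      moreover have "r \<ge> 0" by (simp add: r_def)
      ultimately show ?thesis by simp
    qed
    have "p * (- \<theta> x) / 4 * inverse (1 + t) \<le> (1 - r) * (- \<theta> x)"
      using mult_right_mono[OF r1, of "- \<theta> x"] P(5)[OF x] by (simp add: mult_ac)
    also have "\<dots> \<le> \<bar>(1 + t) powr p * ?u t x - \<theta> x\<bar>"
      unfolding p_def[symmetric] r by (rule abs_ge_self)
    \<comment> \<open>A value is below the conditionally complete supremum only if the set is
      bounded above; \<open>r0\<close> supplies the bound M.\<close>
    also have "\<dots> \<le> deviation k \<Omega> \<theta> ?u t"
      unfolding deviation_def p_def[symmetric]
    proof (rule cSUP_upper[OF x], rule bdd_aboveI2)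
      fix y assume "y \<in> \<Omega>"
      then have "\<bar>1 - r\<bar> * \<bar>\<theta> y\<bar> \<le> 1 * M"
        using r0 M closure_subset by (intro mult_mono) auto
      then show "\<bar>(1 + t) powr p * ((2 + t) powr - p * \<theta> y) - \<theta> y\<bar> \<le> M"
        unfolding r by (simp add: abs_mult)
    qed
    finally show ?thesis .
  qed
  assume "deviation k \<Omega> \<theta> ?u \<in> o[at_top](\<lambda>t. inverse (1 + t))"
  \<comment> \<open>Half of the constant in \<open>lower\<close>, so that the little-o estimate
    contradicts it.\<close>
  moreover define c where "c = p * (- \<theta> x) / 8"
  have c: "c > 0" using p P(5)[OF x] mult_pos_neg[of p "\<theta> x"] by (simp add: c_def)
  ultimately have "\<forall>\<^sub>F t in at_top. norm (deviation k \<Omega> \<theta> ?u t) \<le> c * norm (inverse (1 + t))"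
    by (rule landau_o.smallD)
  then have "\<forall>\<^sub>F t::real in at_top. False"
    using eventually_ge_at_top[of "0::real"]
  proof eventually_elim
    case (elim t)
    then have "2 * (c * inverse (1 + t)) \<le> c * inverse (1 + t)"
      using lower[of t] by (simp add: c_def)
    moreover have "c * inverse (1 + t) > 0" using c elim by simp
    ultimately show False by linarith
  qed
  then show False by simp
qed

subsection \<open>Curvature of the boundary\<close>

text \<open>In each order j the coefficient of N is \<open>elem_sym (j - 1) xs > 0\<close>, so a
  large N wins. This is how (k-1)-convexity of the boundary yields a k-admissible barrier: one large
  normal eigenvalue raises the order by one.\<close>

lemma garding_cone_extend:
  assumes "xs \<in> garding_cone m"
  obtains N where "N > 0" "N # xs \<in> garding_cone (Suc m)"
proof -
  have "\<forall>\<^sub>F N in at_top. elem_sym j (N # xs) > 0" if j: "j \<in> {1..Suc m}" for j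
  proof -
    obtain i where i: "j = Suc i" "i \<le> m" using j by (cases j) auto
    define c where "c = elem_sym i xs"
    have c: "c > 0" unfolding c_def using assms i(2) by (rule garding_coneD)
    show ?thesis
      using eventually_gt_at_top[of "- elem_sym j xs / c"]
    proof eventually_elim
      case (elim N)
      then have "- elem_sym j xs < N * c" using c by (simp only: pos_divide_less_eq)
      then show ?case by (simp add: i(1) elem_sym_Cons c_def)
    qed
  qed
  then have "\<forall>\<^sub>F N in at_top. \<forall>j\<in>{1..Suc m}. elem_sym j (N # xs) > 0"
    by (intro eventually_ball_finite) auto
  then have "\<forall>\<^sub>F N in at_top. N > 0 \<and> N # xs \<in> garding_cone (Suc m)"
    using eventually_gt_at_top[of 0] by eventually_elim (simp add: garding_cone_def)
  then show thesis
    using that eventually_happens by (metis (no_types, lifting) trivial_limit_at_top_linorder)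
qed

text \<open>Homogeneity and openness of the cone. The factor \<open>a\<close> will be the length of
  the gradient, and \<open>\<tau>\<close> is the room for absorbing mixed terms.\<close>

lemma garding_cone_perturb:
  assumes "ks \<in> garding_cone m" "a > 0"
  obtains \<tau> where "\<tau> > 0" "map (\<lambda>\<kappa>. a * \<kappa> - \<tau>) ks \<in> garding_cone m"
proof -
  let ?e = "\<lambda>j \<tau>. elem_sym j (map (\<lambda>\<kappa>. a * \<kappa> - \<tau>) ks)"
  have cont: "continuous_on UNIV (?e j)" for j
  proof (induction ks arbitrary: j)
    case (Cons k ks)
    then show ?case by (cases j) (auto simp: elem_sym_Cons intro!: continuous_intros)
  qed simp
  have "\<forall>\<^sub>F \<tau> in at_right 0. ?e j \<tau> > 0" if "j \<in> {1..m}" for j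
  proof -
    have "?e j 0 = a ^ j * elem_sym j ks" by (simp add: elem_sym_scale)
    also have "\<dots> > 0" using assms that by (simp add: garding_coneD)
    finally have "?e j 0 > 0" .
    moreover have "isCont (?e j) 0"
      using cont[of j] by (simp add: continuous_on_eq_continuous_at)
    then have "(?e j \<longlongrightarrow> ?e j 0) (at_right 0)"
      unfolding isCont_def by (rule tendsto_within_subset) simp
    ultimately show ?thesis by (rule order_tendstoD(1)[rotated])
  qed
  then have "\<forall>\<^sub>F \<tau> in at_right 0. \<forall>j\<in>{1..m}. ?e j \<tau> > 0"
    by (intro eventually_ball_finite) auto
  then have "\<forall>\<^sub>F \<tau> in at_right 0. \<tau> > 0 \<and> map (\<lambda>\<kappa>. a * \<kappa> - \<tau>) ks \<in> garding_cone m"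
    using eventually_at_right_less[of 0] by eventually_elim (simp add: garding_cone_def)
  then show thesis
    using that eventually_happens by (metis (no_types, lifting) trivial_limit_at_right_real)
qed

lemma sum_set_conv_nth: "distinct bs \<Longrightarrow> (\<Sum>b\<in>set bs. f b) = (\<Sum>i<length bs. f (bs ! i))"
  by (simp add: sum.distinct_set_conv_list sum_list_sum_nth atLeast0LessThan)

lemma orthonormal_basis_span:
  fixes bs :: "(real^'n) list"
  assumes "orthonormal_list bs" "length bs = CARD('n)"
  shows "span (set bs) = UNIV"
proof -
  have "distinct bs" using assms(1) by (simp add: orthonormal_list_conv_set)
  then show ?thesis
    using card_eq_dim[of "set bs" UNIV] orthonormal_list_independent[OF assms(1)] assms(2)
    by (auto simp: distinct_card dim_UNIV)
qed

text \<open>A large multiple of \<open>outer g\<close> absorbs the mixed terms between \<open>g\<close> and its orthogonal complement,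
  at the price of an arbitrarily small shift of the eigenvalues on the complement.\<close>
lemma garding_cone_add_outer:
  fixes H :: "real^'n^'n"
  assumes sym: "transpose H = H" and g: "g \<noteq> 0"
    and es: "orthonormal_list es" "length es = CARD('n) - 1" "length ks = CARD('n) - 1"
    and perp: "\<And>i. i < CARD('n) - 1 \<Longrightarrow> es ! i \<bullet> g = 0"
    and eig: "\<And>i. i < CARD('n) - 1 \<Longrightarrow> H *v es ! i = (norm g * ks ! i) *\<^sub>R es ! i + \<beta> i *\<^sub>R g"
    and ks: "ks \<in> garding_cone m"
  obtains M \<sigma> and D :: "real^'n^'n" where "M > 0" "\<sigma> > 0" "transpose D = D"
    "eigenvalues D \<in> garding_cone (Suc m)"
    "\<And>v. v \<bullet> (D *v v) + \<sigma> * (v \<bullet> v) \<le> v \<bullet> ((H + (2 * M) *\<^sub>R outer g) *v v)"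
proof -
  let ?n = "CARD('n) - 1"
  have n: "CARD('n) = Suc ?n" by simp
  define \<nu> where "\<nu> = g /\<^sub>R norm g"
  have \<nu>: "norm \<nu> = 1" "g = norm g *\<^sub>R \<nu>" using g by (simp_all add: \<nu>_def)
  have \<nu>es: "\<nu> \<bullet> es ! i = 0" if "i < ?n" for i
    using perp[OF that] by (simp add: \<nu>_def inner_commute)
  define bs where "bs = es @ [\<nu>]"
  have o': "orthonormal_list (\<nu> # es)"
    unfolding orthonormal_list_Cons using \<nu> \<nu>es es by (auto simp: in_set_conv_nth)
  then have "distinct (\<nu> # es)" by (simp add: orthonormal_list_conv_set)
  then have "distinct bs" by (auto simp: bs_def)
  then have o: "orthonormal_list bs"
    by (rule orthonormal_list_subset[OF o']) (auto simp: bs_def)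
  have len: "length bs = CARD('n)" using es n by (simp add: bs_def)
  obtain \<tau> where \<tau>: "\<tau> > 0" "map (\<lambda>\<kappa>. norm g * \<kappa> - \<tau>) ks \<in> garding_cone m"
    using garding_cone_perturb[OF ks, of "norm g"] g by auto
  define xs where "xs = map (\<lambda>\<kappa>. norm g * \<kappa> - \<tau>) ks"
  obtain N where N: "N > 0" "N # xs \<in> garding_cone (Suc m)"
    using garding_cone_extend[OF \<tau>(2)] unfolding xs_def by blast
  define ds where "ds = xs @ [N]"
  have lend: "length ds = CARD('n)" using es n by (simp add: ds_def xs_def)
  obtain D :: "real^'n^'n" where D: "transpose D = D" "eigenbasis D bs ds"
    "\<And>v. v \<bullet> (D *v v) = (\<Sum>i<CARD('n). ds ! i * (v \<bullet> bs ! i)\<^sup>2)"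
    using symmetric_matrix_with_eigenbasis[OF o len lend] by blast
  have "mset (eigenvalues D) = mset (N # xs)"
    using eigenbasis_eigenvalues[OF D(2)] by (simp add: ds_def)
  then have cone: "eigenvalues D \<in> garding_cone (Suc m)"
    using N(2) garding_cone_mset_cong by blast
  \<comment> \<open>Determined by \<open>M2\<close>: the normal part must pay for N, for the
    remaining half of \<open>\<tau>\<close>, for the normal entry of H, and for the normal remainder
    of Young's inequality.\<close>
  define M where "M = (N + \<tau> / 2 + \<bar>\<nu> \<bullet> (H *v \<nu>)\<bar> + 2 / \<tau> * ((H *v \<nu>) \<bullet> (H *v \<nu>))) / (2 * (norm g)\<^sup>2)"
  have M: "M > 0"
    unfolding M_def using N \<tau> g by (intro divide_pos_pos add_pos_nonneg mult_nonneg_nonneg) auto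
  have M2: "2 * M * (norm g)\<^sup>2 = N + \<tau> / 2 + \<bar>\<nu> \<bullet> (H *v \<nu>)\<bar> + 2 / \<tau> * ((H *v \<nu>) \<bullet> (H *v \<nu>))"
    using g by (simp add: M_def)
  have main: "v \<bullet> (D *v v) + \<tau> / 2 * (v \<bullet> v) \<le> v \<bullet> ((H + (2 * M) *\<^sub>R outer g) *v v)" for v
  proof -
    define a where "a i = v \<bullet> es ! i" for i
    define b where "b = v \<bullet> \<nu>"
    define w where "w = (\<Sum>i<?n. a i *\<^sub>R es ! i)"
    have split: "(\<Sum>i<CARD('n). f i (bs ! i)) = (\<Sum>i<?n. f i (es ! i)) + f ?n \<nu>" for f :: "nat \<Rightarrow> real^'n \<Rightarrow> 'b::comm_monoid_add"
    proof -
      have "(\<Sum>i<Suc ?n. f i (bs ! i)) = (\<Sum>i<?n. f i (bs ! i)) + f ?n (bs ! ?n)"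
        by (rule sum.lessThan_Suc)
      also have "(\<Sum>i<?n. f i (bs ! i)) = (\<Sum>i<?n. f i (es ! i))"
        using es by (intro sum.cong) (auto simp: bs_def nth_append)
      also have "bs ! ?n = \<nu>" using es by (simp add: bs_def nth_append)
      finally show ?thesis by (simp only: n[symmetric])
    qed
    have "v \<in> span (set bs)" using orthonormal_basis_span[OF o len] by simp
    from orthonormal_list_expand[OF o this] orthonormal_list_norm[OF o this]
    have v: "v = w + b *\<^sub>R \<nu>" and vv: "v \<bullet> v = (\<Sum>i<?n. (a i)\<^sup>2) + b\<^sup>2"
      using split[of "\<lambda>_ u. (v \<bullet> u) *\<^sub>R u"] split[of "\<lambda>_ u. (v \<bullet> u)\<^sup>2"] \<open>distinct bs\<close>
      by (simp_all add: sum_set_conv_nth len w_def a_def b_def)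
    have Dv: "v \<bullet> (D *v v) = (\<Sum>i<?n. norm g * ks ! i * (a i)\<^sup>2) - \<tau> * (\<Sum>i<?n. (a i)\<^sup>2) + N * b\<^sup>2"
    proof -
      have "v \<bullet> (D *v v) = (\<Sum>i<?n. ds ! i * (a i)\<^sup>2) + ds ! ?n * b\<^sup>2"
        unfolding D(3) using split[of "\<lambda>i u. ds ! i * (v \<bullet> u)\<^sup>2"] by (simp add: a_def b_def)
      also have "ds ! ?n = N" using es by (simp add: ds_def xs_def nth_append)
      also have "(\<Sum>i<?n. ds ! i * (a i)\<^sup>2) = (\<Sum>i<?n. norm g * ks ! i * (a i)\<^sup>2 - \<tau> * (a i)\<^sup>2)"
        using es by (intro sum.cong) (auto simp: ds_def xs_def nth_append algebra_simps)
      finally show ?thesis by (simp add: sum_subtractf sum_distrib_left)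
    qed
    have wg: "w \<bullet> g = 0"
      unfolding w_def by (simp add: inner_sum_left perp)
    have we: "w \<bullet> es ! i = a i" if "i < ?n" for i
    proof -
      have "a i = w \<bullet> es ! i + b * (\<nu> \<bullet> es ! i)"
        unfolding a_def by (subst v) (simp add: inner_add_left)
      then show ?thesis using \<nu>es[OF that] by simp
    qed
    have ww: "w \<bullet> w = (\<Sum>i<?n. (a i)\<^sup>2)"
    proof -
      have "w \<bullet> w = w \<bullet> (\<Sum>i<?n. a i *\<^sub>R es ! i)" by (simp only: w_def[symmetric])
      then show ?thesis by (simp add: inner_sum_right we power2_eq_square)
    qed
    \<comment> \<open>The multiples \<open>\<beta> i\<close> of g drop out because w is orthogonal
      to g.\<close>
    have wHw: "w \<bullet> (H *v w) = (\<Sum>i<?n. norm g * ks ! i * (a i)\<^sup>2)"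
    proof -
      have "H *v w = (\<Sum>i<?n. a i *\<^sub>R (H *v es ! i))"
        unfolding w_def by (simp add: linear_sum[OF matrix_vector_mul_linear] matrix_vector_mult_scaleR)
      also have "\<dots> = (\<Sum>i<?n. a i *\<^sub>R ((norm g * ks ! i) *\<^sub>R es ! i + \<beta> i *\<^sub>R g))"
        by (intro sum.cong) (auto simp: eig)
      finally show ?thesis
        by (simp add: inner_sum_right inner_add_right wg we power2_eq_square mult_ac)
    qed
    have vHv: "v \<bullet> (H *v v) = w \<bullet> (H *v w) + 2 * b * (w \<bullet> (H *v \<nu>)) + b\<^sup>2 * (\<nu> \<bullet> (H *v \<nu>))"
      using symmetric_matrix_inner[OF sym, of \<nu> w] unfolding v
      by (simp add: inner_add_left inner_add_right matrix_vector_right_distrib matrix_vector_mult_scaleR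
          power2_eq_square inner_commute algebra_simps)
    \<comment> \<open>Young's inequality for the mixed term, by completing a square: it uses up half
      of the shift \<open>\<tau>\<close>, and the other half survives as
      \<open>\<sigma>\<close>.\<close>
    have "0 \<le> ((\<tau> / 2) *\<^sub>R w + b *\<^sub>R (H *v \<nu>)) \<bullet> ((\<tau> / 2) *\<^sub>R w + b *\<^sub>R (H *v \<nu>))"
      by (rule inner_ge_zero)
    also have "\<dots> = \<tau> / 2 * (\<tau> / 2 * (w \<bullet> w) + 2 * b * (w \<bullet> (H *v \<nu>)) + b\<^sup>2 * (2 / \<tau> * ((H *v \<nu>) \<bullet> (H *v \<nu>))))"
      using \<tau>(1) by (simp add: inner_add_left inner_add_right power2_eq_square inner_commute field_simps)
    finally have "0 \<le> \<tau> / 2 * (w \<bullet> w) + 2 * b * (w \<bullet> (H *v \<nu>)) + b\<^sup>2 * (2 / \<tau> * ((H *v \<nu>) \<bullet> (H *v \<nu>)))"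
      using \<tau>(1) by (simp add: zero_le_mult_iff)
    moreover have "v \<bullet> ((H + (2 * M) *\<^sub>R outer g) *v v) = v \<bullet> (H *v v) + b\<^sup>2 * (2 * M * (norm g)\<^sup>2)"
    proof -
      have "g \<bullet> v = norm g * b" by (subst \<nu>(2)) (simp add: b_def inner_commute)
      then show ?thesis
        by (simp add: matrix_vector_mult_add_rdistrib scaleR_matrix_vector_assoc[symmetric]
            outer_mult_vec inner_add_right inner_commute power2_eq_square mult_ac)
    qed
    moreover have "b\<^sup>2 * - (\<nu> \<bullet> (H *v \<nu>)) \<le> b\<^sup>2 * \<bar>\<nu> \<bullet> (H *v \<nu>)\<bar>"
      by (intro mult_left_mono) auto
    ultimately show ?thesis
      unfolding M2 vHv wHw Dv vv ww by (simp add: algebra_simps)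
  qed
  show thesis
    using that[OF M _ D(1) cone main] \<tau>(1) by simp
qed

lemma quadratic_form_lower_semicontinuous:
  fixes F :: "'a::metric_space \<Rightarrow> real^'n^'n"
  assumes "isCont F p" "\<delta> > 0"
  obtains r where "r > 0"
    "\<And>x v. x \<in> ball p r \<Longrightarrow> v \<bullet> (F p *v v) - \<delta> * (v \<bullet> v) \<le> v \<bullet> (F x *v v)"
proof -
  define s where "s x = (\<Sum>i\<in>UNIV. \<Sum>j\<in>UNIV. \<bar>(F x - F p) $ i $ j\<bar>)" for x
  have "(s \<longlongrightarrow> (\<Sum>i\<in>(UNIV::'n set). \<Sum>j\<in>(UNIV::'n set). \<bar>(F p - F p) $ i $ j\<bar>)) (at p)"
    unfolding s_def using assms(1) unfolding isCont_def by (intro tendsto_intros)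
  then have "(s \<longlongrightarrow> 0) (at p)" by simp
  then have "\<forall>\<^sub>F x in at p. s x < \<delta>" using assms(2) by (rule order_tendstoD)
  then obtain r where r: "r > 0" "\<And>x. x \<noteq> p \<Longrightarrow> dist x p < r \<Longrightarrow> s x < \<delta>"
    unfolding eventually_at by blast
  have "v \<bullet> (F p *v v) - \<delta> * (v \<bullet> v) \<le> v \<bullet> (F x *v v)" if "x \<in> ball p r" for x v
  proof (cases "x = p")
    case False
    have "\<bar>v \<bullet> ((F x - F p) *v v)\<bar> \<le> norm v * norm ((F x - F p) *v v)"
      by (rule Cauchy_Schwarz_ineq2)
    also have "\<dots> \<le> norm v * (onorm ((*v) (F x - F p)) * norm v)"
      by (intro mult_left_mono onorm) auto
    also have "\<dots> \<le> norm v * (s x * norm v)"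
      unfolding s_def by (intro mult_left_mono mult_right_mono onorm_le_matrix_component_sum) auto
    also have "\<dots> \<le> norm v * (\<delta> * norm v)"
      using r(2)[OF False] that by (intro mult_left_mono mult_right_mono) (auto simp: dist_commute)
    also have "\<dots> = \<delta> * (v \<bullet> v)"
      by (simp add: norm_eq_sqrt_inner)
    finally show ?thesis
      by (simp add: matrix_vector_mult_diff_rdistrib inner_diff_right abs_le_iff)
  qed (use assms(2) in simp)
  with r(1) that show thesis by blast
qed

lemma C2_on_isCont:
  assumes "C2_on U \<rho>" "open U" "p \<in> U"
  shows "isCont \<rho> p" "isCont (gradient \<rho>) p" "isCont (hessian \<rho>) p"
  using assms unfolding C2_on_def
  by (auto intro: differentiable_imp_continuous_within simp: continuous_on_eq_continuous_at)

lemma isCont_outer: "isCont f p \<Longrightarrow> isCont (\<lambda>x. outer (f x)) p"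
  unfolding outer_def isCont_def by (intro tendsto_intros)

text \<open>Differentiating the normalised gradient gives the Hessian divided by the gradient
  length, plus a multiple of the gradient from the normalising factor; \<open>\<beta>\<close>
  collects that normal component.\<close>

lemma weingarten_hessian:
  fixes \<rho> :: "real^'n \<Rightarrow> real"
  assumes df: "C2_defining_function \<Omega> p U \<rho>" and e: "e \<bullet> interior_normal \<rho> p = 0"
    and W: "- frechet_derivative (interior_normal \<rho>) (at p) e = \<kappa> *\<^sub>R e"
  shows "e \<bullet> gradient \<rho> p = 0"
    and "\<exists>\<beta>. hessian \<rho> p *v e = (norm (gradient \<rho> p) * \<kappa>) *\<^sub>R e + \<beta> *\<^sub>R gradient \<rho> p"
proof -
  let ?g = "gradient \<rho> p" and ?H = "hessian \<rho> p"
  have g: "?g \<noteq> 0" and tw: "twice_differentiable_on U \<rho>" "p \<in> U"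
    using df by (auto simp: C2_defining_function_def C2_on_imp_twice_differentiable_on)
  show "e \<bullet> ?g = 0" using e g by (simp add: interior_normal_def)
  have G: "(gradient \<rho> has_derivative (\<lambda>h. ?H *v h)) (at p)"
    by (rule twice_differentiable_onD(2)[OF tw])
  have nG: "((\<lambda>x. norm (gradient \<rho> x)) has_derivative (\<lambda>h. (?H *v h) \<bullet> sgn ?g)) (at p)"
    using has_derivative_compose[OF G has_derivative_norm[OF g]] .
  have inv: "((\<lambda>x. inverse (norm (gradient \<rho> x))) has_derivative
      (\<lambda>h. - (inverse (norm ?g) * ((?H *v h) \<bullet> sgn ?g) * inverse (norm ?g)))) (at p)"
    using Deriv.has_derivative_inverse[OF _ nG] g by simp
  have "((\<lambda>x. - (inverse (norm (gradient \<rho> x)) *\<^sub>R gradient \<rho> x)) has_derivative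
      (\<lambda>h. - (inverse (norm ?g) *\<^sub>R (?H *v h) +
        (- (inverse (norm ?g) * ((?H *v h) \<bullet> sgn ?g) * inverse (norm ?g))) *\<^sub>R ?g))) (at p)"
    by (intro has_derivative_minus has_derivative_scaleR inv G)
  from frechet_derivative_at[OF this] W
  have "inverse (norm ?g) *\<^sub>R (?H *v e) +
      (- (inverse (norm ?g) * ((?H *v e) \<bullet> sgn ?g) * inverse (norm ?g))) *\<^sub>R ?g = \<kappa> *\<^sub>R e"
    unfolding interior_normal_def by (metis (no_types, lifting) minus_minus)
  then have "norm ?g *\<^sub>R (inverse (norm ?g) *\<^sub>R (?H *v e) +
      (- (inverse (norm ?g) * ((?H *v e) \<bullet> sgn ?g) * inverse (norm ?g))) *\<^sub>R ?g) = norm ?g *\<^sub>R (\<kappa> *\<^sub>R e)"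
    by simp
  then have "?H *v e = (norm ?g * \<kappa>) *\<^sub>R e +
      (norm ?g * (inverse (norm ?g) * ((?H *v e) \<bullet> sgn ?g) * inverse (norm ?g))) *\<^sub>R ?g"
    using g by (simp add: scaleR_right_distrib scaleR_right_diff_distrib algebra_simps)
  then show "\<exists>\<beta>. ?H *v e = (norm ?g * \<kappa>) *\<^sub>R e + \<beta> *\<^sub>R ?g" by blast
qed

text \<open>The condition of order 1 says that the Laplacian is positive, so there is no interior
  maximum.\<close>

lemma admissible0_negative:
  assumes \<Omega>: "open \<Omega>" "bounded \<Omega>" and w: "w \<in> admissible0 k \<Omega>" and k: "k \<ge> 1" and x: "x \<in> \<Omega>"
  shows "w x < 0"
proof (rule ccontr)
  assume neg: "\<not> w x < 0"
  have adm: "w \<in> admissible k \<Omega>" and bd: "\<And>y. y \<in> frontier \<Omega> \<Longrightarrow> w y = 0"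
    using w by (auto simp: admissible0_def)
  have tw: "twice_differentiable_on \<Omega> w" using adm by (rule admissible_twice_differentiable_on)
  have cont: "continuous_on (closure \<Omega>) w" using adm by (simp add: admissible_def)
  have xc: "x \<in> closure \<Omega>" using x closure_subset by blast
  have no_max: False if y: "y \<in> \<Omega>" and max: "\<And>z. z \<in> \<Omega> \<Longrightarrow> w z \<le> w y" for y
  proof -
    let ?H = "hessian w y"
    have cone: "eigenvalues ?H \<in> garding_cone 1"
      using adm y k by (rule admissible_garding_cone)
    have "elem_sym 1 (eigenvalues ?H) \<le> elem_sym 1 (eigenvalues (0 :: real^'a^'a))"
      using hessian_local_max[OF tw \<Omega>(1) y max]
      by (intro elem_sym_eigenvalues_mono(2)[OF hessian_symmetric[OF tw \<Omega>(1) y] _ _ cone])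
        (auto simp: transpose_def vec_eq_iff)
    also have "\<dots> = 0"
      using sum_list_eigenvalues[of "0 :: real^'a^'a"] by (simp add: elem_sym_1 trace_def transpose_def vec_eq_iff)
    finally show False using garding_coneD[OF cone, of 1] by simp
  qed
  have "compact (closure \<Omega>)" "closure \<Omega> \<noteq> {}" using \<Omega>(2) xc by auto
  then obtain z where z: "z \<in> closure \<Omega>" "\<And>y. y \<in> closure \<Omega> \<Longrightarrow> w y \<le> w z"
    using continuous_attains_sup[OF _ _ cont] by blast
  show False
  proof (cases "z \<in> \<Omega>")
    case True
    then show False using no_max[OF True] z(2) closure_subset by blast
  next
    case False
    then have "w z = 0" using closure_minus_frontier[OF \<Omega>(1) z(1)] bd by blast
    \<comment> \<open>The maximum is then 0, and \<open>w x \<ge> 0\<close> turns the interior point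
      x into a maximum point as well.\<close>
    then have "w y \<le> w x" if "y \<in> \<Omega>" for y
      using z(2)[of y] neg that closure_subset by force
    then show False using no_max[OF x] by blast
  qed
qed

subsection \<open>Boundary barriers\<close>

lemma isCont_less_ball:
  fixes f :: "'a::metric_space \<Rightarrow> real"
  assumes "isCont f p" "f p < c"
  obtains r where "r > 0" "\<And>x. x \<in> ball p r \<Longrightarrow> f x < c"
proof -
  have "\<forall>\<^sub>F x in at p. f x < c"
    using assms unfolding isCont_def by (rule order_tendstoD)
  then obtain r where r: "r > 0" "\<And>x. x \<noteq> p \<Longrightarrow> dist x p < r \<Longrightarrow> f x < c"
    unfolding eventually_at by blast
  have "f x < c" if "x \<in> ball p r" for x
    using r(2)[of x] assms(2) that by (cases "x = p") (auto simp: dist_commute)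
  with r(1) that show thesis by blast
qed

lemma defining_functionD:
  assumes "C2_defining_function \<Omega> p U \<rho>"
  shows "open U" "p \<in> U" "C2_on U \<rho>" "twice_differentiable_on U \<rho>" "gradient \<rho> p \<noteq> 0"
    and "\<And>x. x \<in> U \<Longrightarrow> x \<in> \<Omega> \<longleftrightarrow> \<rho> x < 0" "\<And>x. x \<in> U \<Longrightarrow> x \<in> frontier \<Omega> \<longleftrightarrow> \<rho> x = 0"
    and "isCont \<rho> p" "isCont (gradient \<rho>) p" "isCont (hessian \<rho>) p" "continuous_on U \<rho>"
proof -
  show *: "open U" "p \<in> U" "C2_on U \<rho>" "gradient \<rho> p \<noteq> 0"
    "\<And>x. x \<in> U \<Longrightarrow> x \<in> \<Omega> \<longleftrightarrow> \<rho> x < 0" "\<And>x. x \<in> U \<Longrightarrow> x \<in> frontier \<Omega> \<longleftrightarrow> \<rho> x = 0"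
    using assms by (auto simp: C2_defining_function_def)
  then show "twice_differentiable_on U \<rho>" by (simp add: C2_on_imp_twice_differentiable_on)
  show "isCont \<rho> p" "isCont (gradient \<rho>) p" "isCont (hessian \<rho>) p"
    using C2_on_isCont[OF *(3,1,2)] .
  show "continuous_on U \<rho>"
    using C2_on_isCont(1)[OF *(3,1)] *(1) by (simp add: continuous_on_eq_continuous_at)
qed

text \<open>The paraboloid is centred at the point \<open>x\<^sub>0\<close> at which the estimate is wanted, so its contribution
  vanishes there.\<close>
lemma profile_boundary_lower_bound:
  fixes \<Omega> :: "(real^'n) set"
  assumes \<Omega>: "open \<Omega>" "bounded \<Omega>" and k: "k \<ge> 2" and \<theta>: "profile k \<Omega> \<theta>"
    and p: "p \<in> frontier \<Omega>" and df: "C2_defining_function \<Omega> p U \<rho>"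
    and len: "length ks = CARD('n) - 1" "length es = CARD('n) - 1"
    and es: "\<And>i j. i < CARD('n) - 1 \<Longrightarrow> j < CARD('n) - 1 \<Longrightarrow> es ! i \<bullet> es ! j = (if i = j then 1 else 0)"
    and N: "\<And>i. i < CARD('n) - 1 \<Longrightarrow> es ! i \<bullet> interior_normal \<rho> p = 0"
    and W: "\<And>i. i < CARD('n) - 1 \<Longrightarrow>
      - frechet_derivative (interior_normal \<rho>) (at p) (es ! i) = (ks ! i) *\<^sub>R (es ! i)"
    and ks: "ks \<in> garding_cone (k - 1)"
  obtains B r where "B > 0" "r > 0" "\<And>x. x \<in> \<Omega> \<inter> ball p r \<Longrightarrow> B * \<rho> x \<le> \<theta> x"
proof -
  note U = defining_functionD[OF df]
  note P = profile_facts[OF \<theta> \<Omega>(1)]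
  have \<rho>p: "\<rho> p = 0" using U(7)[OF U(2)] p by simp
  have "\<exists>\<beta>. \<forall>i<CARD('n) - 1. hessian \<rho> p *v es ! i =
      (norm (gradient \<rho> p) * ks ! i) *\<^sub>R es ! i + \<beta> i *\<^sub>R gradient \<rho> p"
    using weingarten_hessian(2)[OF df N W] by metis
  then obtain \<beta> where \<beta>: "\<And>i. i < CARD('n) - 1 \<Longrightarrow> hessian \<rho> p *v es ! i =
      (norm (gradient \<rho> p) * ks ! i) *\<^sub>R es ! i + \<beta> i *\<^sub>R gradient \<rho> p" by blast
  have o: "orthonormal_list es"
    using es len by (simp add: orthonormal_list_def)
  obtain M \<sigma> and D :: "real^'n^'n" where M: "M > 0" and \<sigma>: "\<sigma> > 0" and D: "transpose D = D"
    "eigenvalues D \<in> garding_cone (Suc (k - 1))"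
    "\<And>v. v \<bullet> (D *v v) + \<sigma> * (v \<bullet> v)
      \<le> v \<bullet> ((hessian \<rho> p + (2 * M) *\<^sub>R outer (gradient \<rho> p)) *v v)"
    using garding_cone_add_outer[OF hessian_symmetric[OF U(4,1,2)] U(5) o len(2,1)
      weingarten_hessian(1)[OF df N W] \<beta> ks] by blast
  have Dk: "eigenvalues D \<in> garding_cone k" using D(2) k by simp
  define Y where "Y x = (1 + 2 * M * \<rho> x) *\<^sub>R hessian \<rho> x + (2 * M) *\<^sub>R outer (gradient \<rho> x)" for x
  have "isCont Y p"
    unfolding Y_def by (intro continuous_intros isCont_outer U)
  then obtain r1 where r1: "r1 > 0"
    "\<And>x v. x \<in> ball p r1 \<Longrightarrow> v \<bullet> (Y p *v v) - \<sigma> / 2 * (v \<bullet> v) \<le> v \<bullet> (Y x *v v)"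
    using quadratic_form_lower_semicontinuous[where F = Y and p = p and \<delta> = "\<sigma> / 2"] \<sigma> by (metis half_gt_zero)
  \<comment> \<open>Half of \<open>\<sigma>\<close> pays for moving the Hessian from p to x; the
    other half is reserved for the paraboloid, whose Hessian is \<open>- B * \<sigma> / 2\<close>
    times the identity.\<close>
  have D_le: "v \<bullet> (D *v v) \<le> v \<bullet> (Y x *v v) - \<sigma> / 2 * (v \<bullet> v)" if "x \<in> ball p r1" for x v
    using D(3)[of v] r1(2)[OF that, of v] \<rho>p by (simp add: Y_def)
  \<comment> \<open>This bound gives \<open>1 + M * \<rho> \<ge> 0\<close>, so that
    \<open>\<rho> + M * \<rho>^2\<close> stays nonpositive on the closure of the domain.\<close>
  have "isCont (\<lambda>x. \<bar>\<rho> x\<bar>) p" "\<bar>\<rho> p\<bar> < 1 / M"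
    using U(8) M \<rho>p by (auto intro: continuous_rabs)
  then obtain r2 where r2: "r2 > 0" "\<And>x. x \<in> ball p r2 \<Longrightarrow> \<bar>\<rho> x\<bar> < 1 / M"
    using isCont_less_ball by blast
  obtain r3 where r3: "r3 > 0" "ball p r3 \<subseteq> U" using U(1,2) openE by blast
  define r0 where "r0 = min r1 (min r2 r3)"
  define r where "r = r0 / 2"
  have r: "r > 0" "2 * r = r0" using r1 r2 r3 by (auto simp: r_def r0_def)
  obtain L where L: "L > 0" "\<And>x. x \<in> closure \<Omega> \<Longrightarrow> \<bar>\<theta> x\<bar> \<le> L"
    using compact_closure_bounds[OF \<Omega>(2) P(2)] by blast
  define s where "s = elem_sym k (eigenvalues D)"
  have s: "s > 0" unfolding s_def using Dk by (rule garding_coneD) simp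
  \<comment> \<open>The summand (L+1)/s makes S_k of the barrier exceed the right-hand side of the
    profile equation; the last one makes the paraboloid beat L on the sphere of radius r; the
    summand 1 gives B^k >= B.\<close>
  define B where "B = 1 + (L + 1) / s + L / (\<sigma> / 4 * r\<^sup>2)"
  have B: "B \<ge> 1" "B \<ge> (L + 1) / s" "B \<ge> L / (\<sigma> / 4 * r\<^sup>2)"
    using L s \<sigma> r by (auto simp: B_def)
  have "B * \<rho> x0 \<le> \<theta> x0" if x0: "x0 \<in> \<Omega> \<inter> ball p r" for x0
  proof -
    define K where "K = closure \<Omega> \<inter> cball x0 r"
    define \<psi> where "\<psi> = (\<lambda>y. B * \<rho> y + (B * M) * (\<rho> y)\<^sup>2 + (- B * \<sigma> / 4) * ((y - x0) \<bullet> (y - x0)))"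
    have near: "cball x0 r \<subseteq> ball p r0"
    proof
      fix y assume "y \<in> cball x0 r"
      then show "y \<in> ball p r0"
        using x0 r dist_triangle[of p y x0] by (simp add: dist_commute)
    qed
    \<comment> \<open>The constants B and r were fixed before \<open>x0\<close>; the radius r = r0/2
      keeps every ball around such a centre inside the good neighbourhood of p.\<close>
    moreover have "ball p r0 \<subseteq> ball p r1" "ball p r0 \<subseteq> ball p r2" "ball p r0 \<subseteq> ball p r3"
      by (auto simp: r0_def)
    ultimately have KU: "cball x0 r \<subseteq> U" and K1: "cball x0 r \<subseteq> ball p r1" and K2: "cball x0 r \<subseteq> ball p r2"
      using r3(2) by blast+
    have "compact K" unfolding K_def using \<Omega>(2) by (intro compact_Int) auto
    moreover have x0K: "x0 \<in> K" using x0 r closure_subset by (auto simp: K_def)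
    moreover have "continuous_on K (\<lambda>y. \<theta> y - \<psi> y)"
      unfolding \<psi>_def K_def
      by (intro continuous_intros continuous_on_subset[OF P(2)] continuous_on_subset[OF U(11)])
        (use KU in auto)
    ultimately obtain z where z: "z \<in> K" "\<And>y. y \<in> K \<Longrightarrow> \<theta> z - \<psi> z \<le> \<theta> y - \<psi> y"
      using continuous_attains_inf[of K "\<lambda>y. \<theta> y - \<psi> y"] by blast
    have zU: "z \<in> U" "z \<in> ball p r1" "\<bar>\<rho> z\<bar> < 1 / M" and zc: "z \<in> closure \<Omega>" and zr: "dist x0 z \<le> r"
      using z(1) KU K1 K2 r2(2) by (auto simp: K_def)
    have "\<psi> z \<le> \<theta> z"
    proof (rule ccontr)
      assume neg: "\<not> \<psi> z \<le> \<theta> z"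
      have "M * \<bar>\<rho> z\<bar> \<le> 1" using zU(3) M by (simp add: field_simps)
      moreover have "M * - \<bar>\<rho> z\<bar> \<le> M * \<rho> z"
        using M by (intro mult_left_mono) linarith+
      ultimately have "1 + M * \<rho> z \<ge> 0" by simp
      moreover have "\<rho> z \<le> 0"
        using U(6,7)[OF zU(1)] closure_minus_frontier[OF \<Omega>(1) zc] by force
      ultimately have "B * (\<rho> z * (1 + M * \<rho> z)) \<le> 0"
        using B(1) by (intro mult_nonneg_nonpos mult_nonpos_nonneg) auto
      moreover have "B * \<rho> z + (B * M) * (\<rho> z)\<^sup>2 = B * (\<rho> z * (1 + M * \<rho> z))"
        by (simp add: algebra_simps power2_eq_square)
      ultimately have \<psi>z: "\<psi> z \<le> - (B * (\<sigma> / 4 * (dist x0 z)\<^sup>2))"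
        by (simp add: \<psi>_def dist_norm norm_minus_commute[of x0] power2_norm_eq_inner)
      have "z \<notin> frontier \<Omega>"
      proof
        assume "z \<in> frontier \<Omega>"
        then have "\<theta> z = 0" by (rule P(4))
        moreover have "B * (\<sigma> / 4 * (dist x0 z)\<^sup>2) \<ge> 0" using B(1) \<sigma> by simp
        ultimately show False using \<psi>z neg by simp
      qed
      then have z\<Omega>: "z \<in> \<Omega>" using closure_minus_frontier[OF \<Omega>(1) zc] by blast
      have "dist x0 z \<noteq> r"
      proof
        assume eq: "dist x0 z = r"
        have "L \<le> B * (\<sigma> / 4 * r\<^sup>2)"
          using B(3) \<sigma> r by (subst (asm) pos_divide_le_eq) auto
        then show False using \<psi>z neg L(2)[OF zc] unfolding eq by linarith
      qed
      then have zb: "z \<in> ball x0 r" using zr by simp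
      let ?S = "\<Omega> \<inter> ball x0 r"
      have S: "open ?S" "z \<in> ?S" using \<Omega>(1) z\<Omega> zb by auto
      have SU: "?S \<subseteq> U" using KU by auto
      have tw\<psi>: "twice_differentiable_on ?S \<psi>"
        unfolding \<psi>_def by (rule barrier_derivatives(1)[OF twice_differentiable_on_subset[OF U(4) SU] S(1)])
      have tw\<theta>: "twice_differentiable_on ?S \<theta>"
        using P(1) by (rule twice_differentiable_on_subset) auto
      have h\<psi>: "hessian \<psi> z = B *\<^sub>R (Y z + mat (- (\<sigma> / 2)))"
        unfolding \<psi>_def
        by (subst barrier_derivatives(2)[OF twice_differentiable_on_subset[OF U(4) SU] S])
          (simp add: Y_def vec_eq_iff mat_def algebra_simps)
      have ord: "v \<bullet> ((B *\<^sub>R D) *v v) \<le> v \<bullet> (hessian \<theta> z *v v)" for v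
      proof -
        have "v \<bullet> ((B *\<^sub>R D) *v v) \<le> B * (v \<bullet> (Y z *v v) - \<sigma> / 2 * (v \<bullet> v))"
          using D_le[OF zU(2), of v] B(1) by (simp add: scaleR_matrix_vector_assoc[symmetric] mult_left_mono)
        also have "\<dots> = v \<bullet> (hessian \<psi> z *v v)"
          unfolding h\<psi> by (simp add: scaleR_matrix_vector_assoc[symmetric] matrix_vector_mult_add_rdistrib
            mat_mult_vec inner_add_right inner_diff_right)
        also have "\<dots> \<le> v \<bullet> (hessian \<theta> z *v v)"
        proof (rule hessian_order_at_max[OF tw\<psi> tw\<theta> S])
          fix y assume "y \<in> ?S"
          then have "y \<in> K" using closure_subset by (auto simp: K_def)
          then show "\<psi> y - \<theta> y \<le> \<psi> z - \<theta> z" using z(2) by fastforce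
        qed
        finally show ?thesis .
      qed
      have BD: "elem_sym j (eigenvalues (B *\<^sub>R D)) = B ^ j * elem_sym j (eigenvalues D)" for j
        by (rule elem_sym_eigenvalues_scaleR[OF D(1)])
      have "eigenvalues (B *\<^sub>R D) \<in> garding_cone k"
        using garding_coneD[OF Dk] B(1) by (simp add: garding_cone_def BD)
      then have "B ^ k * s \<le> elem_sym k (eigenvalues (hessian \<theta> z))"
        unfolding s_def BD[symmetric]
        by (intro elem_sym_eigenvalues_mono(2)[OF _ hessian_symmetric[OF P(1) \<Omega>(1) z\<Omega>] ord])
          (simp_all add: transpose_scalar D(1))
      also have "\<dots> = (1 / (real k - 1)) * - \<theta> z"
        using P(7)[OF z\<Omega>] by (simp add: hess_op_def)
      also have "\<dots> \<le> 1 * L"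
        using k L(2)[OF zc] P(5)[OF z\<Omega>] L(1) by (intro mult_mono) auto
      finally have "B ^ k * s \<le> L" by simp
      moreover have "B * s \<le> B ^ k * s"
        using B(1) k s by (intro mult_right_mono self_le_power) auto
      moreover have "L + 1 \<le> B * s" using B(2) s by (simp add: pos_divide_le_eq)
      ultimately show False by simp
    qed
    then have "\<psi> x0 \<le> \<theta> x0" using z(2)[OF x0K] by simp
    \<comment> \<open>At the centre the paraboloid vanishes and the quadratic term in
      \<open>\<rho>\<close> has the favourable sign.\<close>
    moreover have "B * \<rho> x0 \<le> \<psi> x0"
      using B(1) M by (simp add: \<psi>_def)
    ultimately show ?thesis by simp
  qed
  with B(1) r(1) that show thesis by (metis less_le_trans zero_less_one)
qed

lemma trace_lincomb: "trace (a *\<^sub>R A + b *\<^sub>R B + mat d :: real^'n^'n) = a * trace A + b * trace B + d * CARD('n)"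
  by (simp add: trace_def mat_def sum.distrib sum_distrib_left)

text \<open>A Hopf-type estimate, linear decay at the boundary, using only that the Laplacian of w
  is positive.\<close>

lemma admissible0_boundary_upper_bound:
  fixes \<Omega> :: "(real^'n) set"
  assumes \<Omega>: "open \<Omega>" "bounded \<Omega>" and k: "k \<ge> 1" and w: "w \<in> admissible0 k \<Omega>"
    and p: "p \<in> frontier \<Omega>" and df: "C2_defining_function \<Omega> p U \<rho>"
  obtains c r where "c > 0" "r > 0" "\<And>x. x \<in> \<Omega> \<inter> ball p r \<Longrightarrow> w x \<le> c * \<rho> x"
proof -
  note U = defining_functionD[OF df]
  let ?n = "real CARD('n)"
  have \<rho>p: "\<rho> p = 0" using U(7)[OF U(2)] p by simp
  have adm: "w \<in> admissible k \<Omega>" and bd: "\<And>y. y \<in> frontier \<Omega> \<Longrightarrow> w y = 0"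
    using w by (auto simp: admissible0_def)
  have tw: "twice_differentiable_on \<Omega> w" using adm by (rule admissible_twice_differentiable_on)
  have cont: "continuous_on (closure \<Omega>) w" using adm by (simp add: admissible_def)
  have wneg: "w x < 0" if "x \<in> \<Omega>" for x
    by (rule admissible0_negative[OF \<Omega> w k that])
  define g2 where "g2 x = gradient \<rho> x \<bullet> gradient \<rho> x" for x
  define \<gamma> where "\<gamma> = g2 p / 2"
  define T where "T = \<bar>trace (hessian \<rho> p)\<bar> + 1"
  \<comment> \<open>Near p the Laplacian of the barrier is at most c (2 T - 2 M gamma + 2 n) = -2
    c.\<close>
  define M where "M = (T + ?n + 1) / \<gamma>"
  have \<gamma>: "\<gamma> > 0" using U(5) by (simp add: \<gamma>_def g2_def)
  have T: "T > 0" by (simp add: T_def)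
  have M: "M > 0" "M * \<gamma> = T + ?n + 1" using \<gamma> T by (auto simp: M_def intro!: divide_pos_pos add_pos_nonneg)
  have "isCont (\<lambda>x. \<bar>trace (hessian \<rho> x)\<bar>) p" "\<bar>trace (hessian \<rho> p)\<bar> < T"
    using U(10) unfolding trace_def isCont_def T_def by (intro tendsto_intros) auto
  then obtain r1 where r1: "r1 > 0" "\<And>x. x \<in> ball p r1 \<Longrightarrow> \<bar>trace (hessian \<rho> x)\<bar> < T"
    using isCont_less_ball by blast
  have "isCont (\<lambda>x. - g2 x) p" "- g2 p < - \<gamma>"
    using U(9) \<gamma> unfolding g2_def[abs_def] \<gamma>_def by (auto intro!: continuous_intros)
  then obtain r2 where r2: "r2 > 0" "\<And>x. x \<in> ball p r2 \<Longrightarrow> - g2 x < - \<gamma>"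
    using isCont_less_ball by blast
  have "isCont (\<lambda>x. \<bar>\<rho> x\<bar>) p" "\<bar>\<rho> p\<bar> < 1 / (2 * M)"
    using U(8) M \<rho>p by (auto intro: continuous_rabs)
  then obtain r3 where r3: "r3 > 0" "\<And>x. x \<in> ball p r3 \<Longrightarrow> \<bar>\<rho> x\<bar> < 1 / (2 * M)"
    using isCont_less_ball by blast
  obtain r4 where r4: "r4 > 0" "ball p r4 \<subseteq> U" using U(1,2) openE by blast
  define r0 where "r0 = min (min r1 r2) (min r3 r4)"
  define r where "r = r0 / 3"
  have r: "r > 0" "3 * r = r0" using r1 r2 r3 r4 by (auto simp: r_def r0_def)
  have sub: "cball p (2 * r) \<subseteq> ball p r0" using r by auto
  have near: "\<bar>trace (hessian \<rho> x)\<bar> < T" "g2 x > \<gamma>" "\<bar>\<rho> x\<bar> < 1 / (2 * M)" "x \<in> U"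
    if "x \<in> cball p (2 * r)" for x
    using subsetD[OF sub that] r1(2)[of x] r2(2)[of x] r3(2)[of x] r4(2) by (auto simp: r0_def)
  \<comment> \<open>The points where the barrier, taken at distance r from its centre, is not
    positive. The set does not depend on the centre, and the term \<open>r\<^sup>2\<close> keeps it
    away from the boundary.\<close>
  define K where "K = {x \<in> closure \<Omega> \<inter> cball p (2 * r). \<rho> x - M * (\<rho> x)\<^sup>2 + r\<^sup>2 \<le> 0}"
  have cont\<rho>: "continuous_on (closure \<Omega> \<inter> cball p (2 * r)) \<rho>"
    using near(4) by (intro continuous_on_subset[OF U(11)]) auto
  have "compact K"
  proof -
    have "closed (closure \<Omega> \<inter> cball p (2 * r) \<inter> (\<lambda>x. \<rho> x - M * (\<rho> x)\<^sup>2 + r\<^sup>2) -` {..0})"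
      by (intro continuous_closed_preimage continuous_intros cont\<rho>) auto
    also have "\<dots> = K" by (auto simp: K_def)
    finally have "closed K" .
    moreover have "bounded K"
      by (rule bounded_subset[OF bounded_cball[of p "2 * r"]]) (auto simp: K_def)
    ultimately show ?thesis by (simp add: compact_eq_bounded_closed)
  qed
  have K\<Omega>: "K \<subseteq> \<Omega>"
  proof
    fix x assume x: "x \<in> K"
    have "x \<notin> frontier \<Omega>"
    proof
      assume "x \<in> frontier \<Omega>"
      then have "\<rho> x = 0" using U(7)[of x] near(4)[of x] x by (auto simp: K_def)
      then show False using x r by (simp add: K_def power2_eq_square mult_le_0_iff)
    qed
    then show "x \<in> \<Omega>" using x closure_minus_frontier[OF \<Omega>(1)] by (auto simp: K_def)
  qed
  obtain m where m: "m > 0" "\<And>x. x \<in> K \<Longrightarrow> w x \<le> - m"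
  proof (cases "K = {}")
    case False
    have "continuous_on K w" using cont by (rule continuous_on_subset) (auto simp: K_def)
    then obtain z where "z \<in> K" "\<And>y. y \<in> K \<Longrightarrow> w y \<le> w z"
      using continuous_attains_sup[OF \<open>compact K\<close> False] by blast
    then show thesis using that[of "- w z"] wneg[of z] K\<Omega> by auto
  qed (use that[of 1] in auto)
  \<comment> \<open>On \<open>K\<close> the barrier is at least -c/M = -m, hence above w; on the
    rest of the sphere around the centre it is positive while w is negative.\<close>
  define c where "c = m * M"
  have c: "c > 0" using m M by (simp add: c_def)
  have "w x0 \<le> c * \<rho> x0" if x0: "x0 \<in> \<Omega> \<inter> ball p r" for x0
  proof -
    define Q where "Q = closure \<Omega> \<inter> cball x0 r"
    define \<phi> where "\<phi> = (\<lambda>y. c * \<rho> y + (- c * M) * (\<rho> y)\<^sup>2 + c * ((y - x0) \<bullet> (y - x0)))"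
    have Qnear: "cball x0 r \<subseteq> cball p (2 * r)"
    proof
      fix y assume "y \<in> cball x0 r"
      then show "y \<in> cball p (2 * r)"
        using x0 dist_triangle[of p y x0] by (simp add: dist_commute)
    qed
    have "compact Q" unfolding Q_def using \<Omega>(2) by (intro compact_Int) auto
    moreover have x0Q: "x0 \<in> Q" using x0 r closure_subset by (auto simp: Q_def)
    moreover have "continuous_on Q (\<lambda>y. w y - \<phi> y)"
      unfolding \<phi>_def Q_def
      by (intro continuous_intros continuous_on_subset[OF cont] continuous_on_subset[OF cont\<rho>])
        (use Qnear in auto)
    ultimately obtain z where z: "z \<in> Q" "\<And>y. y \<in> Q \<Longrightarrow> w y - \<phi> y \<le> w z - \<phi> z"
      using continuous_attains_sup[of Q "\<lambda>y. w y - \<phi> y"] by blast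
    have zp: "z \<in> cball p (2 * r)" and zc: "z \<in> closure \<Omega>" and zr: "dist x0 z \<le> r"
      using z(1) Qnear by (auto simp: Q_def)
    have \<phi>z: "\<phi> z = c * (\<rho> z - M * (\<rho> z)\<^sup>2 + (dist x0 z)\<^sup>2)"
      by (simp add: \<phi>_def dist_norm norm_minus_commute[of x0] power2_norm_eq_inner algebra_simps)
    have M\<rho>: "2 * (M * \<bar>\<rho> z\<bar>) \<le> 1" using near(3)[OF zp] M by (simp add: field_simps)
    have "w z \<le> \<phi> z"
    proof (rule ccontr)
      assume neg: "\<not> w z \<le> \<phi> z"
      have "z \<notin> frontier \<Omega>"
      proof
        assume "z \<in> frontier \<Omega>"
        then have "w z = 0" "\<rho> z = 0" using bd U(7)[OF near(4)[OF zp]] by auto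
        then show False using neg c by (simp add: \<phi>z)
      qed
      then have z\<Omega>: "z \<in> \<Omega>" using closure_minus_frontier[OF \<Omega>(1) zc] by blast
      have "dist x0 z \<noteq> r"
      proof
        assume eq: "dist x0 z = r"
        show False
        proof (cases "z \<in> K")
          case True
          have "M * (\<rho> z - M * (\<rho> z)\<^sup>2) \<ge> - 1"
          proof -
            have "M * - \<bar>\<rho> z\<bar> \<le> M * \<rho> z"
              using M by (intro mult_left_mono) linarith+
            moreover have "(M * \<bar>\<rho> z\<bar>)\<^sup>2 \<le> (1 / 2)\<^sup>2"
              using M\<rho> M by (intro power_mono) auto
            ultimately show ?thesis
              using M\<rho> by (simp add: power2_eq_square algebra_simps)
          qed
          then have "m * - 1 \<le> m * (M * (\<rho> z - M * (\<rho> z)\<^sup>2))"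
            using m by (intro mult_left_mono) auto
          also have "\<dots> = c * (\<rho> z - M * (\<rho> z)\<^sup>2)" by (simp add: c_def)
          also have "\<dots> \<le> \<phi> z"
            using c unfolding \<phi>z by (intro mult_left_mono) auto
          finally show False using m(2)[OF True] neg by simp
        next
          case False
          then have "\<phi> z > 0"
            using c zp zc eq by (simp add: \<phi>z K_def)
          then show False using neg wneg[OF z\<Omega>] by simp
        qed
      qed
      then have zb: "z \<in> ball x0 r" using zr by simp
      let ?S = "\<Omega> \<inter> ball x0 r"
      have S: "open ?S" "z \<in> ?S" using \<Omega>(1) z\<Omega> zb by auto
      have "?S \<subseteq> cball p (2 * r)" using Qnear ball_subset_cball by blast
      then have SU: "?S \<subseteq> U" using near(4) by blast
      have tw\<phi>: "twice_differentiable_on ?S \<phi>"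
        unfolding \<phi>_def by (rule barrier_derivatives(1)[OF twice_differentiable_on_subset[OF U(4) SU] S(1)])
      have tww: "twice_differentiable_on ?S w"
        using tw by (rule twice_differentiable_on_subset) auto
      have "trace (hessian \<phi> z) = c * (trace (hessian \<rho> z) + (- 2 * M * \<rho> z) * trace (hessian \<rho> z) - 2 * (M * g2 z) + 2 * ?n)"
        unfolding \<phi>_def barrier_derivatives(2)[OF twice_differentiable_on_subset[OF U(4) SU] S]
          trace_lincomb trace_outer g2_def by (simp add: algebra_simps)
      also have "\<dots> < c * 0"
      proof (rule mult_strict_left_mono[OF _ c])
        have "(- 2 * M * \<rho> z) * trace (hessian \<rho> z) \<le> \<bar>- 2 * M * \<rho> z\<bar> * \<bar>trace (hessian \<rho> z)\<bar>"
          unfolding abs_mult[symmetric] by (rule abs_ge_self)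
        also have "\<dots> \<le> 1 * T"
          using M\<rho> M near(1)[OF zp] by (intro mult_mono) (auto simp: abs_mult)
        finally have "(- 2 * M * \<rho> z) * trace (hessian \<rho> z) \<le> T" by simp
        moreover have "trace (hessian \<rho> z) \<le> T" using near(1)[OF zp] by simp
        moreover have "M * \<gamma> \<le> M * g2 z" using near(2)[OF zp] M(1) by (intro mult_left_mono) auto
        ultimately show "trace (hessian \<rho> z) + (- 2 * M * \<rho> z) * trace (hessian \<rho> z) - 2 * (M * g2 z) + 2 * ?n < 0"
          using M(2) by linarith
      qed
      finally have tr: "trace (hessian \<phi> z) < 0" by simp
      have sym: "transpose (hessian \<phi> z) = hessian \<phi> z" "transpose (hessian w z) = hessian w z"
        using hessian_symmetric[OF tw\<phi> S] hessian_symmetric[OF tww S] by auto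
      have cone: "eigenvalues (hessian w z) \<in> garding_cone 1"
        using adm z\<Omega> k by (rule admissible_garding_cone)
      have "elem_sym 1 (eigenvalues (hessian w z)) \<le> elem_sym 1 (eigenvalues (hessian \<phi> z))"
      proof (rule elem_sym_eigenvalues_mono(2)[OF sym(2,1) _ cone], rule hessian_order_at_max[OF tww tw\<phi> S])
        fix y assume "y \<in> ?S"
        then have "y \<in> Q" using closure_subset by (auto simp: Q_def)
        then show "w y - \<phi> y \<le> w z - \<phi> z" by (rule z(2))
      qed
      also have "\<dots> = trace (hessian \<phi> z)"
        using sum_list_eigenvalues[OF sym(1)] by (simp add: elem_sym_1)
      finally show False using tr garding_coneD[OF cone, of 1] by simp
    qed
    then have "w x0 \<le> \<phi> x0" using z(2)[OF x0Q] by simp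
    also have "\<phi> x0 \<le> c * \<rho> x0" using c M by (simp add: \<phi>_def)
    finally show ?thesis .
  qed
  with c r(1) that show thesis by blast
qed

section \<open>Comparing the initial datum with the profile globally\<close>

lemma initial_comparison_local:
  fixes \<Omega> :: "(real^'n) set"
  assumes \<Omega>: "open \<Omega>" "bounded \<Omega>" and k: "k \<ge> 2" and \<theta>: "profile k \<Omega> \<theta>"
    and conv: "strictly_convex_domain (k - 1) \<Omega>" and w: "w \<in> admissible0 k \<Omega>"
    and p: "p \<in> closure \<Omega>"
  shows "\<exists>a r. a > 0 \<and> r > 0 \<and> (\<forall>x\<in>closure \<Omega> \<inter> ball p r. w x \<le> a * \<theta> x)"
proof (cases "p \<in> \<Omega>")
  case True
  note P = profile_facts[OF \<theta> \<Omega>(1)]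
  have wp: "w p < 0" using admissible0_negative[OF \<Omega> w _ True] k by simp
  have cw: "isCont w p" and c\<theta>: "isCont \<theta> p"
  proof -
    have "continuous_on \<Omega> w" "continuous_on \<Omega> \<theta>"
      using P(2) w closure_subset by (auto simp: admissible0_def admissible_def intro: continuous_on_subset)
    then show "isCont w p" "isCont \<theta> p"
      using \<Omega>(1) True by (auto simp: continuous_on_eq_continuous_at)
  qed
  have "w p < w p / 2" using wp by simp
  then obtain r1 where r1: "r1 > 0" "\<And>x. x \<in> ball p r1 \<Longrightarrow> w x < w p / 2"
    using isCont_less_ball[OF cw] by blast
  have "isCont (\<lambda>x. - \<theta> x) p" "- \<theta> p < - (2 * \<theta> p)"
    using c\<theta> P(5)[OF True] by (auto intro: continuous_intros)
  then obtain r2 where r2: "r2 > 0" "\<And>x. x \<in> ball p r2 \<Longrightarrow> - \<theta> x < - (2 * \<theta> p)"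
    using isCont_less_ball by blast
  \<comment> \<open>Near p one has w < w(p)/2 and theta > 2 theta(p); this a makes
    \<open>a * (2 * \<theta> p)\<close> equal to w(p)/2.\<close>
  define a where "a = w p / (4 * \<theta> p)"
  have a: "a > 0" using wp P(5)[OF True] by (simp add: a_def divide_neg_neg)
  have "w x \<le> a * \<theta> x" if "x \<in> ball p (min r1 r2)" for x
  proof -
    have "a * (2 * \<theta> p) = w p / 2" using P(5)[OF True] by (simp add: a_def)
    then have "w x \<le> a * (2 * \<theta> p)" using r1(2)[of x] that by simp
    also have "\<dots> \<le> a * \<theta> x" using r2(2)[of x] that a by (intro mult_left_mono) auto
    finally show ?thesis .
  qed
  with a r1(1) r2(1) show ?thesis by (intro exI[of _ a] exI[of _ "min r1 r2"]) auto
next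
  case False
  note P = profile_facts[OF \<theta> \<Omega>(1)]
  have pf: "p \<in> frontier \<Omega>" using closure_minus_frontier[OF \<Omega>(1) p] False by blast
  from conv pf obtain ks where pc: "principal_curvatures \<Omega> p ks" and ks: "ks \<in> garding_cone (k - 1)"
    unfolding strictly_convex_domain_def garding_cone_def by blast
  from pc obtain U \<rho> es where df: "C2_defining_function \<Omega> p U \<rho>"
    and len: "length ks = CARD('n) - 1" "length es = CARD('n) - 1"
    and es: "\<forall>i<CARD('n) - 1. \<forall>j<CARD('n) - 1. (es ! i) \<bullet> (es ! j) = (if i = j then 1 else 0)"
    and W: "\<forall>i<CARD('n) - 1. (es ! i) \<bullet> interior_normal \<rho> p = 0 \<and>
           - frechet_derivative (interior_normal \<rho>) (at p) (es ! i) = (ks ! i) *\<^sub>R (es ! i)"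
    unfolding principal_curvatures_def by blast
  \<comment> \<open>The defining function that comes with the curvatures is used in both barriers,
    so \<open>\<rho>\<close> can be eliminated between the two estimates.\<close>
  obtain B r1 where B: "B > 0" "r1 > 0" "\<And>x. x \<in> \<Omega> \<inter> ball p r1 \<Longrightarrow> B * \<rho> x \<le> \<theta> x"
    using profile_boundary_lower_bound[OF \<Omega> k \<theta> pf df len _ _ _ ks] es W by blast
  obtain c r2 where c: "c > 0" "r2 > 0" "\<And>x. x \<in> \<Omega> \<inter> ball p r2 \<Longrightarrow> w x \<le> c * \<rho> x"
    using admissible0_boundary_upper_bound[OF \<Omega> _ w pf df] k by (metis one_le_numeral order_trans)
  have "w x \<le> c / B * \<theta> x" if x: "x \<in> closure \<Omega> \<inter> ball p (min r1 r2)" for x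
  proof (cases "x \<in> \<Omega>")
    case True
    then have "w x \<le> c / B * (B * \<rho> x)" using c(3)[of x] B(1) x by simp
    also have "\<dots> \<le> c / B * \<theta> x" using B c True x by (intro mult_left_mono) auto
    finally show ?thesis .
  next
    case False
    then have "x \<in> frontier \<Omega>" using x closure_minus_frontier[OF \<Omega>(1)] by blast
    then show ?thesis using P(4) w by (simp add: admissible0_def)
  qed
  with B(1,2) c(1,2) show ?thesis
    by (intro exI[of _ "c / B"] exI[of _ "min r1 r2"]) auto
qed

lemma initial_comparison:
  fixes \<Omega> :: "(real^'n) set"
  assumes \<Omega>: "open \<Omega>" "bounded \<Omega>" and k: "k \<ge> 2" and \<theta>: "profile k \<Omega> \<theta>"
    and conv: "strictly_convex_domain (k - 1) \<Omega>" and w: "w \<in> admissible0 k \<Omega>"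
  obtains a where "a > 0" "\<And>x. x \<in> closure \<Omega> \<Longrightarrow> w x \<le> a * \<theta> x"
proof -
  have "\<exists>a r. \<forall>p\<in>closure \<Omega>. a p > 0 \<and> r p > 0 \<and> (\<forall>x\<in>closure \<Omega> \<inter> ball p (r p). w x \<le> a p * \<theta> x)"
    using initial_comparison_local[OF assms] by metis
  then obtain a r where ar: "\<And>p. p \<in> closure \<Omega> \<Longrightarrow> a p > 0" "\<And>p. p \<in> closure \<Omega> \<Longrightarrow> r p > 0"
    "\<And>p x. p \<in> closure \<Omega> \<Longrightarrow> x \<in> closure \<Omega> \<inter> ball p (r p) \<Longrightarrow> w x \<le> a p * \<theta> x" by blast
  have "compact (closure \<Omega>)" using \<Omega>(2) by simp
  then obtain F where F: "F \<subseteq> closure \<Omega>" "finite F" "closure \<Omega> \<subseteq> (\<Union>p\<in>F. ball p (r p))"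
    by (rule compactE_image[of _ "closure \<Omega>" "\<lambda>p. ball p (r p)"]) (use ar(2) in force)+
  \<comment> \<open>The smallest factor serves everywhere because the profile is nonpositive;
    inserting 1 keeps the minimum defined for an empty cover.\<close>
  define A where "A = Min (insert 1 (a ` F))"
  have "A > 0" unfolding A_def using F(1,2) ar(1) by (subst Min_gr_iff) auto
  moreover have "w x \<le> A * \<theta> x" if x: "x \<in> closure \<Omega>" for x
  proof -
    obtain p where p: "p \<in> F" "x \<in> ball p (r p)" using F(3) x by blast
    have "A \<le> a p" unfolding A_def using p(1) F(2) by (intro Min_le) auto
    have "w x \<le> a p * \<theta> x" using ar(3)[of p x] p x F(1) by blast
    also have "\<dots> \<le> A * \<theta> x"
      using \<open>A \<le> a p\<close> profile_facts(6)[OF \<theta> \<Omega>(1) x] by (rule mult_right_mono_neg)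
    finally show ?thesis .
  qed
  ultimately show thesis using that by blast
qed

section \<open>Uniformity of the constant\<close>

lemma deviation_cong:
  assumes "\<And>x. x \<in> \<Omega> \<Longrightarrow> \<theta> x = \<theta>' x" "\<And>x. x \<in> \<Omega> \<Longrightarrow> u t x = u' t x"
  shows "deviation k \<Omega> \<theta> u t = deviation k \<Omega> \<theta>' u' t"
  unfolding deviation_def using assms by (intro SUP_cong) auto

text \<open>C is chosen before the profile and the flow. Both are unique on the closure, so the
  constant of one admissible pair serves all; without such a pair the claim is vacuous.\<close>

lemma uniform_deviation_bound:
  fixes \<Omega> :: "(real^'n) set"
  assumes \<Omega>: "open \<Omega>" "bounded \<Omega>" "\<Omega> \<noteq> {}" and k: "k \<ge> 2"
  shows "\<exists>C>0. \<forall>\<theta> u. strictly_convex_domain (k - 1) \<Omega> \<longrightarrow> profile k \<Omega> \<theta> \<longrightarrow> hessian_flow k \<Omega> u \<longrightarrow>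
    (\<forall>x\<in>closure \<Omega>. u 0 x = u0 x) \<longrightarrow> (\<forall>t\<ge>0. deviation k \<Omega> \<theta> u t \<le> C * inverse (1 + t))"
proof (cases "\<exists>\<theta> u. strictly_convex_domain (k - 1) \<Omega> \<and> profile k \<Omega> \<theta> \<and> hessian_flow k \<Omega> u \<and>
    (\<forall>x\<in>closure \<Omega>. u 0 x = u0 x)")
  case True
  then obtain \<theta> u where conv: "strictly_convex_domain (k - 1) \<Omega>" and \<theta>: "profile k \<Omega> \<theta>"
    and u: "hessian_flow k \<Omega> u" and u0: "\<forall>x\<in>closure \<Omega>. u 0 x = u0 x" by blast
  have "u 0 \<in> admissible0 k \<Omega>" using u by (simp add: hessian_flow_def admissible0_def)
  then obtain a where a: "a > 0" "\<And>x. x \<in> closure \<Omega> \<Longrightarrow> u 0 x \<le> a * \<theta> x"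
    using initial_comparison[OF \<Omega>(1,2) k \<theta> conv] by blast
  obtain C where C: "C > 0" "\<And>t. t \<ge> 0 \<Longrightarrow> deviation k \<Omega> \<theta> u t \<le> C * inverse (1 + t)"
    using deviation_bound[OF \<Omega> k \<theta> u a] by blast
  have "deviation k \<Omega> \<theta>' u' t \<le> C * inverse (1 + t)"
    if "profile k \<Omega> \<theta>'" "hessian_flow k \<Omega> u'" "\<forall>x\<in>closure \<Omega>. u' 0 x = u0 x" "t \<ge> 0" for \<theta>' u' t
  proof -
    have "deviation k \<Omega> \<theta>' u' t = deviation k \<Omega> \<theta> u t"
      by (rule deviation_cong)
        (use profile_unique[OF \<Omega>(1,2) k that(1) \<theta>] hessian_flow_unique[OF \<Omega>(1,2) that(2) u _ that(4)]
          u0 that(3) closure_subset[of \<Omega>] in \<open>auto simp: subset_eq\<close>)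
    then show ?thesis using C(2)[OF that(4)] by simp
  qed
  with C(1) show ?thesis by blast
next
  case False
  then show ?thesis by (intro exI[of _ 1]) (simp, blast)
qed

theorem theorem2p2:
  fixes \<Omega> :: "(real^'n) set"
  assumes "CARD('n) \<ge> 2"
    and "open \<Omega>" and "connected \<Omega>" and "\<Omega> \<noteq> {}" and "bounded \<Omega>"
    and "C2_boundary \<Omega>"
  shows
    "(\<forall>u0. \<exists>C>0. \<forall>k \<theta> u.
        2 \<le> k \<longrightarrow> k \<le> CARD('n) \<longrightarrow> strictly_convex_domain (k - 1) \<Omega> \<longrightarrow> profile k \<Omega> \<theta> \<longrightarrow>
        hessian_flow k \<Omega> u \<longrightarrow> (\<forall>x\<in>closure \<Omega>. u 0 x = u0 x) \<longrightarrow>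
        (\<forall>t\<ge>0. deviation k \<Omega> \<theta> u t \<le> C * inverse (1 + t))) \<and>
     (\<forall>k \<theta>.
        2 \<le> k \<longrightarrow> k \<le> CARD('n) \<longrightarrow> strictly_convex_domain (k - 1) \<Omega> \<longrightarrow> profile k \<Omega> \<theta> \<longrightarrow>
        (\<exists>u. hessian_flow k \<Omega> u \<and>
             deviation k \<Omega> \<theta> u \<notin> o[at_top](\<lambda>t. inverse (1 + t))))"
proof (intro conjI allI impI)
  note \<Omega> = assms(2,5,4)
  fix u0 :: "real^'n \<Rightarrow> real"
  define R where "R k C \<longleftrightarrow> (\<forall>\<theta> u. strictly_convex_domain (k - 1) \<Omega> \<longrightarrow> profile k \<Omega> \<theta> \<longrightarrow>
    hessian_flow k \<Omega> u \<longrightarrow> (\<forall>x\<in>closure \<Omega>. u 0 x = u0 x) \<longrightarrow>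
    (\<forall>t\<ge>0. deviation k \<Omega> \<theta> u t \<le> C * inverse (1 + t)))" for k C
  have "\<forall>k\<in>{2..CARD('n)}. \<exists>C>0. R k C"
    unfolding R_def using uniform_deviation_bound[OF \<Omega>] by simp
  then obtain c where c: "\<And>k. k \<in> {2..CARD('n)} \<Longrightarrow> c k > 0 \<and> R k (c k)" by metis
  \<comment> \<open>The order k is quantified after C as well; summing over the finitely many orders
    gives a common bound.\<close>
  define C where "C = (\<Sum>k\<in>{2..CARD('n)}. c k)"
  have le: "c k \<le> C" if "k \<in> {2..CARD('n)}" for k
    unfolding C_def using that c by (intro member_le_sum) (auto intro: less_imp_le)
  \<comment> \<open>The index 2 lies in the range because the dimension is at least 2.\<close>
  have "C > 0" using le[of 2] c[of 2] assms(1) by force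
  moreover have "deviation k \<Omega> \<theta> u t \<le> C * inverse (1 + t)"
    if "k \<in> {2..CARD('n)}" "strictly_convex_domain (k - 1) \<Omega>" "profile k \<Omega> \<theta>" "hessian_flow k \<Omega> u"
      "\<forall>x\<in>closure \<Omega>. u 0 x = u0 x" "t \<ge> 0" for k \<theta> u t
  proof -
    have "deviation k \<Omega> \<theta> u t \<le> c k * inverse (1 + t)"
      using c[OF that(1)] that(2-) unfolding R_def by blast
    also have "\<dots> \<le> C * inverse (1 + t)"
      using le[OF that(1)] that(6) by (intro mult_right_mono) auto
    finally show ?thesis .
  qed
  ultimately show "\<exists>C>0. \<forall>k \<theta> u.
        2 \<le> k \<longrightarrow> k \<le> CARD('n) \<longrightarrow> strictly_convex_domain (k - 1) \<Omega> \<longrightarrow> profile k \<Omega> \<theta> \<longrightarrow>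
        hessian_flow k \<Omega> u \<longrightarrow> (\<forall>x\<in>closure \<Omega>. u 0 x = u0 x) \<longrightarrow>
        (\<forall>t\<ge>0. deviation k \<Omega> \<theta> u t \<le> C * inverse (1 + t))"
    by (intro exI[of _ C]) auto
next
  fix k \<theta> assume "2 \<le> k" "profile k \<Omega> \<theta>"
  then show "\<exists>u. hessian_flow k \<Omega> u \<and>
      deviation k \<Omega> \<theta> u \<notin> o[at_top](\<lambda>t. inverse (1 + t))"
    using selfsimilar_flow[OF assms(2), of k \<theta> 2]
      selfsimilar_deviation_not_smallo[OF assms(2,5,4), of k \<theta>] by auto
qed

end
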